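(* Let $N\ge3$, $s\in(0,\frac N2)$, $\theta\in(0,2s)$ and $\alpha\in(0,N)$, and put $2^*_{s,\theta}=\frac{2(N-\theta)}{N-2s}$, $2^*_\alpha=\frac{2N-\alpha}{N-2s}$. Then there exists a constant $C_4>0$ such that the inequality $$\int_{\mathbb{R}^N}\frac{|u|^{2^*_{s,\theta}}}{|x|^\theta}\,\mathrm{d}x\le C_4\,\|u\|_D^{\frac{2(N+\theta-\alpha)}{N+2s-\alpha}}\left(\int_{\mathbb{R}^N}\int_{\mathbb{R}^N}\frac{|u(x)|^{2^*_\alpha}|u(y)|^{2^*_\alpha}}{|x-y|^\alpha}\,\mathrm{d}x\,\mathrm{d}y\right)^{\frac{2s-\theta}{N+2s-\alpha}}$$ holds for all $u\in\mathcal{E}^{s,\alpha,2^*_\alpha}(\mathbb{R}^N)$.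
   Context: $D^{s,2}(\mathbb{R}^N)$ is the completion of $C_0^\infty(\mathbb{R}^N)$ with respect to the norm $\|u\|_D=\|(-\Delta)^{s/2}u\|_{L^2(\mathbb{R}^N)}$. The fractional Coulomb--Sobolev space $\mathcal{E}^{s,\alpha,2^*_\alpha}(\mathbb{R}^N)$ is the set of functions $u$ with $\|u\|_D<\infty$ (i.e. $u\in D^{s,2}(\mathbb{R}^N)$) and $\int_{\mathbb{R}^N}\int_{\mathbb{R}^N}\frac{|u(x)|^{2^*_\alpha}|u(y)|^{2^*_\alpha}}{|x-y|^\alpha}\,\mathrm{d}x\,\mathrm{d}y<\infty$. *)

theory Defs
  imports "HOL-Analysis.Analysis"
begin

definition partial_deriv :: "'n::finite \<Rightarrow> (real ^ 'n \<Rightarrow> real) \<Rightarrow> real ^ 'n \<Rightarrow> real" where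
  "partial_deriv i f x = frechet_derivative f (at x) (axis i 1)"

(* C^infinity: every iterated partial derivative is (Frechet) differentiable everywhere,
   so in particular all of them exist and are continuous. *)
definition smooth :: "(real ^ 'n::finite \<Rightarrow> real) \<Rightarrow> bool" where
  "smooth f \<longleftrightarrow> (\<forall>is :: 'n list. \<forall>x. foldr partial_deriv is f differentiable (at x))"

definition test_functions :: "(real ^ 'n::finite \<Rightarrow> real) set" where
  "test_functions = {\<phi>. smooth \<phi> \<and> compact (closure {x. \<phi> x \<noteq> 0})}"

definition fourier :: "(real ^ 'n::finite \<Rightarrow> real) \<Rightarrow> real ^ 'n \<Rightarrow> complex" where
  "fourier \<phi> \<xi> = (LINT x|lebesgue. complex_of_real (\<phi> x) * exp (- \<i> * complex_of_real (x \<bullet> \<xi>)))"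

(* frac_laplacian_half s f is (-Laplacian)^(s/2) f, the Fourier multiplier with symbol |xi|^s.
   Only used for test functions, whose transform decays rapidly, so that the inversion
   integral converges absolutely. *)
definition frac_laplacian_half :: "real \<Rightarrow> (real ^ 'n::finite \<Rightarrow> real) \<Rightarrow> real ^ 'n \<Rightarrow> complex" where
  "frac_laplacian_half s \<phi> x =
     (LINT \<xi>|lebesgue. complex_of_real (norm \<xi> powr s) * fourier \<phi> \<xi> * exp (\<i> * complex_of_real (x \<bullet> \<xi>)))
       / complex_of_real ((2 * pi) ^ CARD('n))"

definition D_norm_test :: "real \<Rightarrow> (real ^ 'n::finite \<Rightarrow> real) \<Rightarrow> real" where
  "D_norm_test s \<phi> = sqrt (LINT x|lebesgue. (cmod (frac_laplacian_half s \<phi> x))\<^sup>2)"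

definition sobolev_exponent :: "real \<Rightarrow> real \<Rightarrow> real" where
  "sobolev_exponent N s = 2 * N / (N - 2 * s)"

(* The completion for D_norm_test is realised as a space of functions. For 0 < s < N/2 the
   Sobolev inequality makes a Cauchy sequence of test functions converge in L^p with
   p = 2N/(N-2s), and its L^p limit is the function that represents its class.
   D_approx s phi u says that phi is such a sequence and that u is its limit. *)
definition D_approx ::
  "real \<Rightarrow> (nat \<Rightarrow> real ^ 'n::finite \<Rightarrow> real) \<Rightarrow> (real ^ 'n \<Rightarrow> real) \<Rightarrow> bool" where
  "D_approx s \<phi> u \<longleftrightarrow>
     (\<forall>k. \<phi> k \<in> test_functions) \<and>
     (\<forall>e>0. \<exists>K. \<forall>j\<ge>K. \<forall>k\<ge>K. D_norm_test s (\<lambda>x. \<phi> j x - \<phi> k x) < e) \<and>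
     (\<lambda>k. \<integral>\<^sup>+x. ennreal (\<bar>\<phi> k x - u x\<bar> powr sobolev_exponent (real CARD('n)) s) \<partial>lebesgue)
       \<longlonglongrightarrow> 0"

definition D_space :: "real \<Rightarrow> (real ^ 'n::finite \<Rightarrow> real) set" where
  "D_space s = {u. u \<in> borel_measurable lebesgue \<and> (\<exists>\<phi>. D_approx s \<phi> u)}"

(* The norm of the completion. The limit exists for every approximating sequence and, for
   0 < s < N/2, does not depend on it: two sequences with the same L^p limit differ by a
   sequence tending to 0 in D_norm_test. *)
definition D_norm :: "real \<Rightarrow> (real ^ 'n::finite \<Rightarrow> real) \<Rightarrow> real" where
  "D_norm s u = (SOME r. \<exists>\<phi>. D_approx s \<phi> u \<and> (\<lambda>k. D_norm_test s (\<phi> k)) \<longlonglongrightarrow> r)"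

(* The integrand is 0 on the diagonal x = y by the convention a / 0 = 0, which is harmless
   since the diagonal is a null set. *)
definition coulomb_energy :: "real \<Rightarrow> real \<Rightarrow> (real ^ 'n::finite \<Rightarrow> real) \<Rightarrow> ennreal" where
  "coulomb_energy \<alpha> p u =
     (\<integral>\<^sup>+x. \<integral>\<^sup>+y. ennreal (\<bar>u x\<bar> powr p * \<bar>u y\<bar> powr p / norm (x - y) powr \<alpha>) \<partial>lebesgue \<partial>lebesgue)"

definition coulomb_sobolev_space :: "real \<Rightarrow> real \<Rightarrow> real \<Rightarrow> (real ^ 'n::finite \<Rightarrow> real) set" where
  "coulomb_sobolev_space s \<alpha> p = {u \<in> D_space s. coulomb_energy \<alpha> p u < \<infinity>}"

definition hardy_sobolev_exponent :: "real \<Rightarrow> real \<Rightarrow> real \<Rightarrow> real" where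
  "hardy_sobolev_exponent N s \<theta> = 2 * (N - \<theta>) / (N - 2 * s)"

definition coulomb_exponent :: "real \<Rightarrow> real \<Rightarrow> real \<Rightarrow> real" where
  "coulomb_exponent N s \<alpha> = (2 * N - \<alpha>) / (N - 2 * s)"

end

(* The inequality interpolates, with weight theta / (2 s), between Hardy's inequality (theta = 2 s)
   and the Coulomb-Sobolev inequality (theta = 0). Both follow from the square function
   G x = integral of |Delta_h^m u (x)|^2 / |h|^(N + 2 s) dh, where Delta_h^m is the m-th order
   difference and m > s: by Plancherel its integral is at most C |u|_D^2.

   For every x and r > 0, u x is controlled by the differences Delta_h^m u (x) and by the values
   of u on the ball of radius m r around x, averaged over |h| < r. The differences contribute
   r^(2 s) G x. The values near x contribute at most r^(alpha - N) V x with
   V the convolution of |x|^(-alpha) and |u|^p, p = (2 N - alpha) / (N - 2 s), and optimising in r gives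
   |u|^(2 N / (N - 2 s)) <= C (|u|^p V)^kappa G^(1 - kappa) pointwise, kappa = 2 s / (N + 2 s - alpha).
   With r = K |x| and K large, the average of |u|^2 can instead be absorbed, which gives Hardy's
   inequality for test functions. Fatou's lemma passes both integral bounds to the completion,
   without any convergence of the Coulomb energies, and Hoelder's inequality concludes. *)

theory Submission
  imports Defs "HOL-Probability.Probability"
begin

section \<open>Powers of the norm\<close>

text \<open>Since s may exceed 1, first differences do not suffice: the Fourier multiplier of the
  m-th difference has size at most min (2, |xi . h|)^m, and its square integrated against |h|^(-N -
  2 s) converges at h = 0 when m > s. Finiteness decides to which function each estimate is applied.
  The pointwise bound needs V and G finite almost everywhere, so it is applied to the limit u
  itself, whose Coulomb energy is finite by hypothesis. Hardy's inequality subtracts a multiple of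
  its own left-hand side, so it is proved for test functions, where that integral is finite
  beforehand. The convergence in L^(2N/(N-2s)) enters through an almost everywhere convergent
  subsequence, which is the form in which Fatou's lemma uses it. In the last step |u|^p V, G and
  |u|^2 / |x|^(2 s) carry the weights kappa (1 - l), (1 - kappa) (1 - l) and l, where l = theta / (2
  s). The integrals of the last two are bounded by multiples of |u|_D^2; this produces the exponents
  of the theorem.\<close>

lemma nn_integral_lborel_affine:
  fixes f :: "'a::euclidean_space \<Rightarrow> ennreal"
  assumes [measurable]: "f \<in> borel_measurable borel" and c: "c \<noteq> 0"
  shows "(\<integral>\<^sup>+x. f x \<partial>lborel) = ennreal (\<bar>c\<bar> ^ DIM('a)) * (\<integral>\<^sup>+x. f (t + c *\<^sub>R x) \<partial>lborel)"
  by (subst lborel_affine[OF c, of t])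
    (simp add: nn_integral_density nn_integral_distr nn_integral_cmult)

lemma emeasure_ball_scale:
  fixes c :: "'a::euclidean_space"
  assumes "r \<ge> 0"
  shows "emeasure lborel (ball c r) = ennreal (unit_ball_vol (real DIM('a)) * r powr real DIM('a))"
  using assms by (cases "r = 0") (simp_all add: emeasure_ball powr_realpow)

lemma nn_integral_norm_powr_annulus:
  fixes b :: real
  assumes "\<rho> > 0"
  shows "(\<integral>\<^sup>+x. ennreal (norm x powr b) * indicator {x. \<rho> \<le> norm x \<and> norm x < 2 * \<rho>} x
            \<partial>(lborel :: 'a::euclidean_space measure))
    \<le> ennreal (2 powr (\<bar>b\<bar> + DIM('a)) * unit_ball_vol (DIM('a)) * \<rho> powr (b + DIM('a)))"
proof -
  \<comment> \<open>The sign of b is arbitrary; \<open>\<bar>b\<bar>\<close> bounds the variation of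
    the weight across the shell in both cases.\<close>
  have le: "norm x powr b \<le> 2 powr \<bar>b\<bar> * \<rho> powr b" if "\<rho> \<le> norm x" "norm x < 2 * \<rho>" for x :: 'a
  proof -
    define t where "t = norm x / \<rho>"
    have t: "1 \<le> t" "t \<le> 2" "norm x = t * \<rho>" using that assms by (auto simp: t_def field_simps)
    have "t powr b \<le> t powr \<bar>b\<bar>" using t by (intro powr_mono) auto
    also have "\<dots> \<le> 2 powr \<bar>b\<bar>" using t by (intro powr_mono2) auto
    finally have "t powr b \<le> 2 powr \<bar>b\<bar>" .
    then show ?thesis using t assms by (simp add: powr_mult)
  qed
  have "(\<integral>\<^sup>+x. ennreal (norm x powr b) * indicator {x. \<rho> \<le> norm x \<and> norm x < 2 * \<rho>} x \<partial>(lborel :: 'a measure))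
      \<le> (\<integral>\<^sup>+x. ennreal (2 powr \<bar>b\<bar> * \<rho> powr b) * indicator (ball 0 (2 * \<rho>)) x \<partial>(lborel :: 'a measure))"
    by (intro nn_integral_mono) (auto simp: indicator_def intro!: ennreal_leI le)
  also have "\<dots> = ennreal (2 powr \<bar>b\<bar> * \<rho> powr b) * emeasure lborel (ball (0::'a) (2 * \<rho>))"
    by (subst nn_integral_cmult) (auto intro!: borel_measurable_indicator)
  also have "\<dots> = ennreal (2 powr (\<bar>b\<bar> + DIM('a)) * unit_ball_vol (DIM('a)) * \<rho> powr (b + DIM('a)))"
    using assms by (simp add: emeasure_ball_scale ennreal_mult[symmetric] powr_add powr_mult mult_ac)
  finally show ?thesis .
qed

text \<open>This takes the place of polar coordinates. On each shell the weight is comparable to a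
  power of the radius, so the shells contribute a geometric series with ratio
  \<open>d powr (b + DIM('a))\<close>. The value d = 2 exhausts the complement of a ball, d = 1/2 a
  punctured ball.\<close>

lemma nn_integral_norm_powr_dyadic:
  fixes b d :: real
  assumes \<rho>: "\<rho> > 0" and d: "d > 0" and q: "d powr (b + DIM('a)) < 1"
    and S: "S \<subseteq> (\<Union>j. {x::'a::euclidean_space. c * \<rho> * d ^ j \<le> norm x \<and> norm x < 2 * (c * \<rho> * d ^ j)})"
    and c: "c > 0"
  shows "(\<integral>\<^sup>+x. ennreal (norm x powr b) * indicator S x \<partial>lborel)
    \<le> ennreal (2 powr (\<bar>b\<bar> + DIM('a)) * unit_ball_vol (DIM('a)) * c powr (b + DIM('a))
        / (1 - d powr (b + DIM('a))) * \<rho> powr (b + DIM('a)))" (is "_ \<le> ennreal ?R")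
proof -
  let ?A = "\<lambda>j. {x::'a. c * \<rho> * d ^ j \<le> norm x \<and> norm x < 2 * (c * \<rho> * d ^ j)}"
  let ?K = "2 powr (\<bar>b\<bar> + DIM('a)) * unit_ball_vol (DIM('a)) * (c * \<rho>) powr (b + DIM('a))"
  let ?q = "d powr (b + DIM('a))"
  have "(\<integral>\<^sup>+x. ennreal (norm x powr b) * indicator S x \<partial>lborel)
      \<le> (\<integral>\<^sup>+x. (\<Sum>j. ennreal (norm x powr b) * indicator (?A j) x) \<partial>lborel)"
  proof (intro nn_integral_mono)
    fix x :: 'a
    show "ennreal (norm x powr b) * indicator S x \<le> (\<Sum>j. ennreal (norm x powr b) * indicator (?A j) x)"
    proof (cases "x \<in> S")
      case True
      then obtain j where j: "x \<in> ?A j" using S by blast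
      have "ennreal (norm x powr b) * indicator S x = (\<Sum>i\<in>{j}. ennreal (norm x powr b) * indicator (?A i) x)"
        using True j by simp
      also have "\<dots> \<le> (\<Sum>i. ennreal (norm x powr b) * indicator (?A i) x)"
        by (intro sum_le_suminf) auto
      finally show ?thesis .
    qed simp
  qed
  also have "\<dots> = (\<Sum>j. \<integral>\<^sup>+x. ennreal (norm x powr b) * indicator (?A j) x \<partial>lborel)"
    by (intro nn_integral_suminf) measurable
  also have "\<dots> \<le> (\<Sum>j. ennreal (?K * ?q ^ j))"
  proof (intro suminf_le)
    fix j
    have "(c * \<rho> * d ^ j) powr (b + DIM('a)) = (c * \<rho>) powr (b + DIM('a)) * ?q ^ j"
      using d \<rho> c by (simp add: powr_mult powr_realpow[symmetric] powr_powr mult_ac)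
    with nn_integral_norm_powr_annulus[of "c * \<rho> * d ^ j" b, where 'a='a] \<rho> d c
    show "(\<integral>\<^sup>+x. ennreal (norm x powr b) * indicator (?A j) x \<partial>lborel) \<le> ennreal (?K * ?q ^ j)"
      by (simp add: mult_ac)
  qed auto
  also have "\<dots> = ennreal (?K / (1 - ?q))"
  proof (intro suminf_ennreal_eq)
    show "(\<lambda>j. ?K * ?q ^ j) sums (?K / (1 - ?q))"
      using sums_mult[OF geometric_sums[of ?q], of ?K] q by simp
  qed (auto intro!: mult_nonneg_nonneg)
  also have "?K / (1 - ?q) = ?R" using \<rho> c by (simp add: powr_mult mult_ac)
  finally show ?thesis .
qed

lemma dyadic_bracket:
  assumes "(y::real) \<ge> 1"
  obtains j :: nat where "2 ^ j \<le> y" "y < 2 * 2 ^ j"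
proof -
  define j where "j = nat \<lfloor>log 2 y\<rfloor>"
  have "log 2 y \<ge> 0" using assms by simp
  then have "real j \<le> log 2 y" "log 2 y < real j + 1" by (auto simp: j_def)
  then have "2 powr real j \<le> y" "y < 2 powr (real j + 1)"
    using assms by (auto simp: le_log_iff log_less_iff)
  then show ?thesis by (intro that[of j]) (auto simp: powr_realpow powr_add)
qed

lemma nn_integral_norm_powr_outside_ball:
  fixes b :: real
  assumes b: "b + DIM('a::euclidean_space) < 0"
  shows "\<exists>C>0. \<forall>\<rho>>0. (\<integral>\<^sup>+x. ennreal (norm x powr b) * indicator {x. \<rho> \<le> norm x} x \<partial>(lborel :: 'a measure))
    \<le> ennreal (C * \<rho> powr (b + DIM('a)))"
proof -
  let ?C = "2 powr (\<bar>b\<bar> + DIM('a)) * unit_ball_vol (DIM('a)) * 1 powr (b + DIM('a)) / (1 - 2 powr (b + DIM('a)))"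
  have q: "2 powr (b + DIM('a)) < 1" using powr_less_mono[OF b, of 2] by simp
  have "(\<integral>\<^sup>+x. ennreal (norm x powr b) * indicator {x. \<rho> \<le> norm x} x \<partial>(lborel :: 'a measure))
    \<le> ennreal (?C * \<rho> powr (b + DIM('a)))" if \<rho>: "\<rho> > 0" for \<rho>
  proof (rule nn_integral_norm_powr_dyadic[OF \<rho> _ q _ zero_less_one])
    show "{x::'a. \<rho> \<le> norm x} \<subseteq> (\<Union>j. {x. 1 * \<rho> * 2 ^ j \<le> norm x \<and> norm x < 2 * (1 * \<rho> * 2 ^ j)})"
    proof safe
      fix x :: 'a assume "\<rho> \<le> norm x"
      then have "norm x / \<rho> \<ge> 1" using \<rho> by simp
      then obtain j :: nat where "2 ^ j \<le> norm x / \<rho>" "norm x / \<rho> < 2 * 2 ^ j" by (rule dyadic_bracket)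
      then show "x \<in> (\<Union>j. {x. 1 * \<rho> * 2 ^ j \<le> norm x \<and> norm x < 2 * (1 * \<rho> * 2 ^ j)})"
        using \<rho> by (auto simp: field_simps)
    qed
  qed simp
  moreover have "?C > 0" using q by simp
  ultimately show ?thesis by blast
qed

lemma nn_integral_norm_powr_ball:
  fixes b :: real
  assumes b: "b + DIM('a::euclidean_space) > 0"
  shows "\<exists>C>0. \<forall>\<rho>>0. (\<integral>\<^sup>+x. ennreal (norm x powr b) * indicator {x. norm x < \<rho>} x \<partial>(lborel :: 'a measure))
    \<le> ennreal (C * \<rho> powr (b + DIM('a)))"
proof -
  let ?C = "2 powr (\<bar>b\<bar> + DIM('a)) * unit_ball_vol (DIM('a)) * 1 powr (b + DIM('a)) / (1 - (1/2) powr (b + DIM('a)))"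
  have q: "(1/2) powr (b + DIM('a)) < 1" using powr_less_mono'[of "1/2" 0] b by simp
  have "(\<integral>\<^sup>+x. ennreal (norm x powr b) * indicator {x. norm x < \<rho>} x \<partial>(lborel :: 'a measure))
    \<le> ennreal (?C * \<rho> powr (b + DIM('a)))" if \<rho>: "\<rho> > 0" for \<rho>
  proof -
    \<comment> \<open>Since \<open>0 powr b = 0\<close>, removing the origin, which no shell
      contains, costs nothing.\<close>
    have "(\<integral>\<^sup>+x. ennreal (norm x powr b) * indicator {x. norm x < \<rho>} x \<partial>(lborel :: 'a measure))
      \<le> (\<integral>\<^sup>+x. ennreal (norm x powr b) * indicator {x. x \<noteq> 0 \<and> norm x \<le> \<rho>} x \<partial>(lborel :: 'a measure))"
      by (intro nn_integral_mono) (auto simp: indicator_def)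
    also have "\<dots> \<le> ennreal (?C * \<rho> powr (b + DIM('a)))"
    proof (rule nn_integral_norm_powr_dyadic[OF \<rho> _ q _ zero_less_one])
      show "{x::'a. x \<noteq> 0 \<and> norm x \<le> \<rho>} \<subseteq> (\<Union>j. {x. 1 * \<rho> * (1/2) ^ j \<le> norm x \<and> norm x < 2 * (1 * \<rho> * (1/2) ^ j)})"
      proof safe
        fix x :: 'a assume x: "x \<noteq> 0" "norm x \<le> \<rho>"
        then have "\<rho> / norm x \<ge> 1" using \<rho> by simp
        then obtain j :: nat where "2 ^ j \<le> \<rho> / norm x" "\<rho> / norm x < 2 * 2 ^ j" by (rule dyadic_bracket)
        then have j: "norm x \<le> \<rho> / 2 ^ j" "\<rho> < 2 * 2 ^ j * norm x" using x by (auto simp: field_simps)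
        show "x \<in> (\<Union>j. {x. 1 * \<rho> * (1/2) ^ j \<le> norm x \<and> norm x < 2 * (1 * \<rho> * (1/2) ^ j)})"
        \<comment> \<open>Shells contain their inner sphere but not their outer one: on the sphere
          of radius \<open>\<rho> / 2 ^ j\<close> the index is j, strictly inside it is
          \<open>Suc j\<close>.\<close>
        proof (cases "norm x = \<rho> / 2 ^ j")
          case True
          moreover have "0 < \<rho> / 2 ^ j" using \<rho> by simp
          ultimately show ?thesis by (intro UN_I[of j]) (auto simp: power_divide)
        next
          case False
          then show ?thesis using j \<rho>
            by (intro UN_I[of "Suc j"]) (auto simp: power_divide field_simps)
        qed
      qed
    qed simp
    finally show ?thesis .
  qed
  moreover have "?C > 0" using q by simp
  ultimately show ?thesis by blast
qed

section \<open>Differences and the square function\<close>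

text \<open>This is (-1)^m times the usual forward difference. The sign gives \<open>u x\<close> the
  coefficient 1 and makes the Fourier multiplier a plain m-th power of
  \<open>1 - iexp (- (\<xi> \<bullet> h))\<close>.\<close>

definition fdiff :: "nat \<Rightarrow> 'a::real_vector \<Rightarrow> ('a \<Rightarrow> real) \<Rightarrow> 'a \<Rightarrow> real" where
  "fdiff m h u x = (\<Sum>k\<le>m. (-1) ^ k * real (m choose k) * u (x + real k *\<^sub>R h))"

definition diff_square :: "nat \<Rightarrow> real \<Rightarrow> ('a::euclidean_space \<Rightarrow> real) \<Rightarrow> 'a \<Rightarrow> ennreal" where
  "diff_square m \<sigma> u x = (\<integral>\<^sup>+h. ennreal ((fdiff m h u x)\<^sup>2 * norm h powr (- \<sigma>)) \<partial>lborel)"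

lemma fdiff_measurable [measurable]:
  fixes u :: "'a::euclidean_space \<Rightarrow> real"
  assumes [measurable]: "u \<in> borel_measurable borel"
  shows "(\<lambda>(x, h). fdiff m h u x) \<in> borel_measurable (borel \<Otimes>\<^sub>M borel)"
  unfolding fdiff_def by measurable

lemma diff_square_measurable [measurable]:
  fixes u :: "'a::euclidean_space \<Rightarrow> real"
  assumes [measurable]: "u \<in> borel_measurable borel"
  shows "diff_square m \<sigma> u \<in> borel_measurable borel"
proof -
  have "(\<lambda>(x, h). ennreal ((fdiff m h u x)\<^sup>2 * norm h powr (- \<sigma>))) \<in> borel_measurable (borel \<Otimes>\<^sub>M lborel)"
    by measurable
  then show ?thesis unfolding diff_square_def[abs_def]
    by (intro sigma_finite_measure.borel_measurable_nn_integral sigma_finite_lborel)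
qed

text \<open>Either the difference or one of the shifted values carries a fixed fraction of \<open>u x\<close>. Since
  the two terms are merely added, their exponents 2 and \<open>q\<close> are independent.\<close>

lemma pointwise_difference_dichotomy:
  fixes u :: "'a::real_vector \<Rightarrow> real"
  assumes u: "u x \<noteq> 0" and q: "q > 0"
  shows "1 \<le> 4 / (u x)\<^sup>2 * (fdiff m h u x)\<^sup>2
    + (\<Sum>k=1..m. (2 ^ (m + 1) / \<bar>u x\<bar>) powr q * \<bar>u (x + real k *\<^sub>R h)\<bar> powr q)"
proof (cases "\<bar>fdiff m h u x\<bar> \<ge> \<bar>u x\<bar> / 2")
  case True
  then have "(\<bar>u x\<bar> / 2)\<^sup>2 \<le> \<bar>fdiff m h u x\<bar>\<^sup>2" by (intro power_mono) auto
  then have "1 \<le> 4 / (u x)\<^sup>2 * (fdiff m h u x)\<^sup>2" using u by (simp add: power_divide le_divide_eq)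
  also have "\<dots> \<le> 4 / (u x)\<^sup>2 * (fdiff m h u x)\<^sup>2
    + (\<Sum>k=1..m. (2 ^ (m + 1) / \<bar>u x\<bar>) powr q * \<bar>u (x + real k *\<^sub>R h)\<bar> powr q)"
    by (intro add_increasing2 sum_nonneg) auto
  finally show ?thesis .
next
  case False
  \<comment> \<open>The divisor \<open>2 ^ (m + 1)\<close> is twice the sum \<open>2 ^ m\<close> of
    the binomial coefficients: if every shifted value were smaller, the shifted terms together would
    be at most \<open>\<bar>u x\<bar> / 2\<close>, and the difference could not be small.\<close>
  have "\<exists>k\<in>{1..m}. \<bar>u (x + real k *\<^sub>R h)\<bar> \<ge> \<bar>u x\<bar> / 2 ^ (m + 1)"
  proof (rule ccontr)
    assume none: "\<not> ?thesis"
    have less: "\<bar>u (x + real k *\<^sub>R h)\<bar> < \<bar>u x\<bar> / 2 ^ (m + 1)" if "k \<in> {1..m}" for k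
    proof (rule ccontr)
      assume "\<not> ?thesis"
      then have "\<bar>u (x + real k *\<^sub>R h)\<bar> \<ge> \<bar>u x\<bar> / 2 ^ (m + 1)" by (simp only: not_less)
      with none that show False by blast
    qed
    have "fdiff m h u x = u x + (\<Sum>k=1..m. (-1) ^ k * real (m choose k) * u (x + real k *\<^sub>R h))"
      unfolding fdiff_def by (simp add: atMost_atLeast0 sum.atLeast_Suc_atMost)
    then have "\<bar>u x\<bar> \<le> \<bar>fdiff m h u x\<bar> + \<bar>\<Sum>k=1..m. (-1) ^ k * real (m choose k) * u (x + real k *\<^sub>R h)\<bar>"
      by linarith
    also have "\<bar>\<Sum>k=1..m. (-1) ^ k * real (m choose k) * u (x + real k *\<^sub>R h)\<bar>
      \<le> (\<Sum>k=1..m. real (m choose k) * \<bar>u (x + real k *\<^sub>R h)\<bar>)"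
      by (rule order_trans[OF sum_abs]) (simp add: abs_mult power_abs)
    also have "\<dots> \<le> (\<Sum>k=1..m. real (m choose k) * (\<bar>u x\<bar> / 2 ^ (m + 1)))"
      using less by (intro sum_mono mult_left_mono less_imp_le) auto
    also have "\<dots> \<le> (\<Sum>k\<le>m. real (m choose k) * (\<bar>u x\<bar> / 2 ^ (m + 1)))"
      by (intro sum_mono2) auto
    also have "\<dots> = real (\<Sum>k\<le>m. m choose k) * (\<bar>u x\<bar> / 2 ^ (m + 1))"
      by (simp only: sum_distrib_right of_nat_sum)
    also have "\<dots> = \<bar>u x\<bar> / 2" by (simp add: choose_row_sum)
    finally show False using False by linarith
  qed
  then obtain k where k: "k \<in> {1..m}" "\<bar>u (x + real k *\<^sub>R h)\<bar> \<ge> \<bar>u x\<bar> / 2 ^ (m + 1)" by blast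
  have "1 \<le> 2 ^ (m + 1) / \<bar>u x\<bar> * \<bar>u (x + real k *\<^sub>R h)\<bar>" 
    using k(2) u by (simp add: divide_le_eq le_divide_eq mult.commute)
  then have "1 \<le> (2 ^ (m + 1) / \<bar>u x\<bar> * \<bar>u (x + real k *\<^sub>R h)\<bar>) powr q"
    using q by (intro ge_one_powr_ge_zero) auto
  also have "\<dots> = (2 ^ (m + 1) / \<bar>u x\<bar>) powr q * \<bar>u (x + real k *\<^sub>R h)\<bar> powr q"
    by (subst powr_mult) auto
  also have "\<dots> \<le> (\<Sum>k=1..m. (2 ^ (m + 1) / \<bar>u x\<bar>) powr q * \<bar>u (x + real k *\<^sub>R h)\<bar> powr q)"
    using k by (intro member_le_sum[of k "{1..m}" "\<lambda>k. (2 ^ (m + 1) / \<bar>u x\<bar>) powr q * \<bar>u (x + real k *\<^sub>R h)\<bar> powr q"]) auto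
  also have "\<dots> \<le> 4 / (u x)\<^sup>2 * (fdiff m h u x)\<^sup>2 + \<dots>" by simp
  finally show ?thesis .
qed

lemma ennreal_combination_sum:
  assumes "a \<ge> 0" "x \<ge> 0" "b \<ge> 0" "\<And>k. k \<in> K \<Longrightarrow> f k \<ge> 0"
  shows "ennreal (a * x + (\<Sum>k\<in>K. b * f k)) = ennreal a * ennreal x + (\<Sum>k\<in>K. ennreal b * ennreal (f k))"
proof -
  have "(\<Sum>k\<in>K. ennreal b * ennreal (f k)) = (\<Sum>k\<in>K. ennreal (b * f k))"
    using assms by (intro sum.cong) (simp_all add: ennreal_mult)
  also have "\<dots> = ennreal (\<Sum>k\<in>K. b * f k)" using assms by (intro sum_ennreal) auto
  finally show ?thesis using assms by (simp add: ennreal_mult ennreal_plus sum_nonneg)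
qed

lemma powr_times_ball_measurable:
  fixes u :: "'a::euclidean_space \<Rightarrow> real"
  assumes [measurable]: "u \<in> borel_measurable borel"
  shows "(\<lambda>y. ennreal (\<bar>u y\<bar> powr q) * indicator (ball x R) y) \<in> borel_measurable borel"
  by (intro borel_measurable_times_ennreal borel_measurable_indicator) auto

text \<open>The dichotomy is integrated over the ball of radius r. In the difference term the factor
  \<open>(r / norm h) powr \<sigma>\<close>, at least 1 there, is inserted to form the square
  function. In the k-th shifted term the substitution y = x + k h has the Jacobian factor k^n \<ge>
  1, which is dropped, and all shifts stay in the ball of radius m r; hence the same integral m
  times.\<close>

lemma averaged_pointwise_difference:
  fixes u :: "'a::euclidean_space \<Rightarrow> real"
  assumes [measurable]: "u \<in> borel_measurable borel"
    and u: "u x \<noteq> 0" and q: "q > 0" and r: "r > 0" and \<sigma>: "\<sigma> > 0"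
  shows "ennreal (unit_ball_vol DIM('a) * r powr DIM('a))
    \<le> ennreal (4 / (u x)\<^sup>2 * r powr \<sigma>) * diff_square m \<sigma> u x
      + ennreal (real m * (2 ^ (m + 1) / \<bar>u x\<bar>) powr q)
        * (\<integral>\<^sup>+y. ennreal (\<bar>u y\<bar> powr q) * indicator (ball x (real m * r)) y \<partial>lborel)"
proof -
  let ?c = "(2 ^ (m + 1) / \<bar>u x\<bar>) powr q"
  let ?I = "\<integral>\<^sup>+y. ennreal (\<bar>u y\<bar> powr q) * indicator (ball x (real m * r)) y \<partial>lborel"
  have "ennreal (unit_ball_vol DIM('a) * r powr DIM('a)) = (\<integral>\<^sup>+h. indicator (ball (0::'a) r) h \<partial>lborel)"
    using r by (simp add: emeasure_ball_scale)
  also have "\<dots> \<le> (\<integral>\<^sup>+h. ennreal (4 / (u x)\<^sup>2 * r powr \<sigma>) * ennreal ((fdiff m h u x)\<^sup>2 * norm h powr (- \<sigma>))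
      + (\<Sum>k=1..m. ennreal ?c * (ennreal (\<bar>u (x + real k *\<^sub>R h)\<bar> powr q)
           * indicator (ball x (real m * r)) (x + real k *\<^sub>R h))) \<partial>lborel)"
  proof (rule nn_integral_mono_AE)
    \<comment> \<open>At h = 0 the factor \<open>norm h powr (- \<sigma>)\<close> has the default
      value 0, and the lower bound 1 for the inserted factor is lost.\<close>
    have "AE h in lborel. h \<noteq> (0::'a)" using AE_lborel_singleton by auto
    then show "AE h in lborel. indicator (ball (0::'a) r) h
      \<le> ennreal (4 / (u x)\<^sup>2 * r powr \<sigma>) * ennreal ((fdiff m h u x)\<^sup>2 * norm h powr (- \<sigma>))
      + (\<Sum>k=1..m. ennreal ?c * (ennreal (\<bar>u (x + real k *\<^sub>R h)\<bar> powr q)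
           * indicator (ball x (real m * r)) (x + real k *\<^sub>R h)))"
    proof eventually_elim
      case (elim h)
      show ?case
      proof (cases "norm h < r")
        case True
        have in_ball: "x + real k *\<^sub>R h \<in> ball x (real m * r)" if "k \<in> {1..m}" for k
        proof -
          have "real k * norm h < real k * r" using that True by simp
          also have "\<dots> \<le> real m * r" using that r by simp
          finally show ?thesis by (simp add: dist_norm)
        qed
        have "1 \<le> (r / norm h) powr \<sigma>" using True elim \<sigma> by (intro ge_one_powr_ge_zero) auto
        also have "\<dots> = r powr \<sigma> * norm h powr (- \<sigma>)"
          using r elim by (simp add: powr_divide powr_minus_divide)
        finally have "4 / (u x)\<^sup>2 * (fdiff m h u x)\<^sup>2 * 1
            \<le> 4 / (u x)\<^sup>2 * (fdiff m h u x)\<^sup>2 * (r powr \<sigma> * norm h powr (- \<sigma>))"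
          by (intro mult_left_mono) auto
        also have "\<dots> = (4 / (u x)\<^sup>2 * r powr \<sigma>) * ((fdiff m h u x)\<^sup>2 * norm h powr (- \<sigma>))"
          by (simp only: mult_ac)
        finally have "4 / (u x)\<^sup>2 * (fdiff m h u x)\<^sup>2
            \<le> (4 / (u x)\<^sup>2 * r powr \<sigma>) * ((fdiff m h u x)\<^sup>2 * norm h powr (- \<sigma>))"
          by (simp only: mult_1_right)
        with pointwise_difference_dichotomy[of u x q m h, OF u q]
        have "1 \<le> (4 / (u x)\<^sup>2 * r powr \<sigma>) * ((fdiff m h u x)\<^sup>2 * norm h powr (- \<sigma>))
           + (\<Sum>k=1..m. ?c * \<bar>u (x + real k *\<^sub>R h)\<bar> powr q)" by linarith
        then have "ennreal 1 \<le> ennreal ((4 / (u x)\<^sup>2 * r powr \<sigma>) * ((fdiff m h u x)\<^sup>2 * norm h powr (- \<sigma>))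
           + (\<Sum>k=1..m. ?c * \<bar>u (x + real k *\<^sub>R h)\<bar> powr q))" by (rule ennreal_leI)
        also have "\<dots> = ennreal (4 / (u x)\<^sup>2 * r powr \<sigma>) * ennreal ((fdiff m h u x)\<^sup>2 * norm h powr (- \<sigma>))
           + (\<Sum>k=1..m. ennreal ?c * ennreal (\<bar>u (x + real k *\<^sub>R h)\<bar> powr q))"
          by (rule ennreal_combination_sum) auto
        also have "(\<Sum>k=1..m. ennreal ?c * ennreal (\<bar>u (x + real k *\<^sub>R h)\<bar> powr q))
          = (\<Sum>k=1..m. ennreal ?c * (ennreal (\<bar>u (x + real k *\<^sub>R h)\<bar> powr q)
              * indicator (ball x (real m * r)) (x + real k *\<^sub>R h)))"
          using in_ball by (intro sum.cong) (simp_all add: indicator_def)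
        finally show ?thesis using True by (simp add: indicator_def)
      qed (simp add: indicator_def)
    qed
  qed
  also have "\<dots> = ennreal (4 / (u x)\<^sup>2 * r powr \<sigma>) * diff_square m \<sigma> u x
      + (\<Sum>k=1..m. ennreal ?c * (\<integral>\<^sup>+h. ennreal (\<bar>u (x + real k *\<^sub>R h)\<bar> powr q)
           * indicator (ball x (real m * r)) (x + real k *\<^sub>R h) \<partial>lborel))"
  proof -
    define f where "f y = ennreal (\<bar>u y\<bar> powr q) * indicator (ball x (real m * r)) y" for y
    have [measurable]: "f \<in> borel_measurable borel"
      unfolding f_def using assms(1) by (rule powr_times_ball_measurable)
    have [measurable]: "(\<lambda>h. fdiff m h u x) \<in> borel_measurable borel"
      unfolding fdiff_def by measurable
    show ?thesis unfolding diff_square_def f_def[symmetric]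
      by (subst nn_integral_add, measurable) (simp add: nn_integral_cmult nn_integral_sum)
  qed
  also have "\<dots> \<le> ennreal (4 / (u x)\<^sup>2 * r powr \<sigma>) * diff_square m \<sigma> u x
      + (\<Sum>k=1..m. ennreal ?c * ?I)"
  proof (intro add_left_mono sum_mono mult_left_mono)
    fix k assume k: "k \<in> {1..m}"
    let ?J = "\<integral>\<^sup>+h. ennreal (\<bar>u (x + real k *\<^sub>R h)\<bar> powr q)
           * indicator (ball x (real m * r)) (x + real k *\<^sub>R h) \<partial>lborel"
    have "?I = ennreal (\<bar>real k\<bar> ^ DIM('a)) * ?J"
      using k assms(1) by (intro nn_integral_lborel_affine powr_times_ball_measurable) auto
    moreover have "ennreal 1 * ?J \<le> ennreal (\<bar>real k\<bar> ^ DIM('a)) * ?J"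
      using k by (intro mult_right_mono ennreal_leI) (auto intro!: one_le_power)
    ultimately show "?J \<le> ?I" by simp
  qed auto
  also have "(\<Sum>k=1..m. ennreal ?c * ?I) = ennreal (real m * ?c) * ?I"
    by (simp add: ennreal_mult ennreal_of_nat_eq_real_of_nat mult_ac)
  finally show ?thesis .
qed

section \<open>The Riesz potential V and the pointwise Coulomb bound\<close>

definition riesz_potential :: "real \<Rightarrow> real \<Rightarrow> ('a::euclidean_space \<Rightarrow> real) \<Rightarrow> 'a \<Rightarrow> ennreal" where
  "riesz_potential \<alpha> p u x = (\<integral>\<^sup>+y. ennreal (\<bar>u y\<bar> powr p / norm (x - y) powr \<alpha>) \<partial>lborel)"

lemma riesz_potential_measurable [measurable]:
  fixes u :: "'a::euclidean_space \<Rightarrow> real"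
  assumes [measurable]: "u \<in> borel_measurable borel"
  shows "riesz_potential \<alpha> p u \<in> borel_measurable borel"
proof -
  have "(\<lambda>(x, y). ennreal (\<bar>u y\<bar> powr p / norm (x - y) powr \<alpha>)) \<in> borel_measurable (borel \<Otimes>\<^sub>M lborel)"
    by measurable
  then show ?thesis unfolding riesz_potential_def[abs_def]
    by (intro sigma_finite_measure.borel_measurable_nn_integral sigma_finite_lborel)
qed

text \<open>Inside the ball the kernel of the potential is at least
  \<open>R powr (- \<alpha>)\<close>. The centre, where the convention a / 0 = 0 makes the kernel
  vanish, is a null set.\<close>

lemma ball_integral_le_riesz_potential:
  fixes u :: "'a::euclidean_space \<Rightarrow> real"
  assumes [measurable]: "u \<in> borel_measurable borel" and "\<alpha> > 0" "R \<ge> 0"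
  shows "(\<integral>\<^sup>+y. ennreal (\<bar>u y\<bar> powr p) * indicator (ball x R) y \<partial>lborel)
    \<le> ennreal (R powr \<alpha>) * riesz_potential \<alpha> p u x"
proof -
  have "(\<integral>\<^sup>+y. ennreal (\<bar>u y\<bar> powr p) * indicator (ball x R) y \<partial>lborel)
    \<le> (\<integral>\<^sup>+y. ennreal (R powr \<alpha>) * ennreal (\<bar>u y\<bar> powr p / norm (x - y) powr \<alpha>) \<partial>lborel)"
  proof (rule nn_integral_mono_AE)
    have "AE y in lborel. y \<noteq> x" using AE_lborel_singleton by auto
    then show "AE y in lborel. ennreal (\<bar>u y\<bar> powr p) * indicator (ball x R) y
        \<le> ennreal (R powr \<alpha>) * ennreal (\<bar>u y\<bar> powr p / norm (x - y) powr \<alpha>)"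
    proof eventually_elim
      case (elim y)
      show ?case
      proof (cases "y \<in> ball x R")
        case True
        then have d: "norm (x - y) < R" "norm (x - y) > 0" using elim by (auto simp: dist_norm)
        then have "norm (x - y) powr \<alpha> \<le> R powr \<alpha>" using assms by (intro powr_mono2) auto
        then have "\<bar>u y\<bar> powr p * norm (x - y) powr \<alpha> \<le> \<bar>u y\<bar> powr p * R powr \<alpha>"
          by (intro mult_left_mono) auto
        then have "\<bar>u y\<bar> powr p \<le> R powr \<alpha> * (\<bar>u y\<bar> powr p / norm (x - y) powr \<alpha>)"
          using d by (simp add: field_simps)
        then show ?thesis using True by (simp add: ennreal_mult[symmetric] ennreal_leI del: ennreal_le_iff)
      qed simp
    qed
  qed
  then show ?thesis by (simp add: riesz_potential_def nn_integral_cmult)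
qed

text \<open>Taking \<open>a * r powr e = \<omega> / 2\<close> balances the two terms; if \<open>a = 0\<close>, letting \<open>r\<close> grow
  contradicts the hypothesis.\<close>

lemma optimise_radius:
  fixes a b \<omega> e d :: real
  assumes \<omega>: "\<omega> > 0" and a: "a \<ge> 0" and b: "b \<ge> 0" and e: "e > 0" and d: "d > 0"
    and le: "\<And>r. r > 0 \<Longrightarrow> \<omega> \<le> a * r powr e + b * r powr (- d)"
  shows "(\<omega> / 2) powr (1 + d / e) \<le> b * a powr (d / e)"
proof (cases "a = 0")
  case True
  have bpos: "b > 0" using le[of 1] \<omega> a b True by auto
  \<comment> \<open>One finite radius is enough for the contradiction: here
    \<open>b * r powr (- d)\<close> equals \<omega> / 2.\<close>
  define r where "r = (2 * b / \<omega>) powr (1 / d)"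
  have r: "r > 0" using bpos \<omega> by (simp add: r_def)
  have "r powr (- d) = \<omega> / (2 * b)" using bpos \<omega> d by (simp add: r_def powr_powr powr_minus)
  then have "\<omega> \<le> \<omega> / 2" using le[OF r] True bpos by simp
  then show ?thesis using \<omega> by simp
next
  case False
  then have apos: "a > 0" using a by simp
  define r where "r = (\<omega> / (2 * a)) powr (1 / e)"
  have r: "r > 0" using apos \<omega> by (simp add: r_def)
  have 1: "r powr e = \<omega> / (2 * a)" using apos \<omega> e by (simp add: r_def powr_powr)
  have "r powr (- d) = (\<omega> / (2 * a)) powr (- (d / e))" by (simp add: r_def powr_powr)
  also have "\<dots> = a powr (d / e) / (\<omega> / 2) powr (d / e)"
  proof -
    have "\<omega> / (2 * a) = (\<omega> / 2) / a" by simp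
    then show ?thesis using apos \<omega> by (simp only: powr_minus powr_divide) simp
  qed
  finally have 2: "r powr (- d) = a powr (d / e) / (\<omega> / 2) powr (d / e)" .
  have "\<omega> / 2 \<le> b * (a powr (d / e) / (\<omega> / 2) powr (d / e))"
  proof -
    have "a * (\<omega> / (2 * a)) = \<omega> / 2" using apos by simp
    then show ?thesis using le[OF r] unfolding 1 2 by linarith
  qed
  then have "\<omega> / 2 * (\<omega> / 2) powr (d / e) \<le> b * a powr (d / e)"
    using \<omega> by (simp add: field_simps)
  then show ?thesis using \<omega> by (simp add: powr_add)
qed

text \<open>Dividing \<open>averaged_pointwise_difference\<close> by r^n and bounding the ball
  integral by a multiple of r^\<alpha> V leaves one term growing like r^(2 s) and one decaying like
  r^(\<alpha> - n); \<open>optimise_radius\<close> then eliminates r. The hypotheses that V and G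
  are finite at x guard against \<open>enn2real\<close>, which sends \<infinity> to 0.\<close>

lemma pointwise_interpolation:
  fixes s \<alpha> :: real and m :: nat
  defines "n \<equiv> real DIM('a::euclidean_space)"
  assumes s: "0 < s" "2 * s < n" and \<alpha>: "0 < \<alpha>" "\<alpha> < n"
    and p: "p = (2 * n - \<alpha>) / (n - 2 * s)" and \<kappa>: "\<kappa> = 2 * s / (n + 2 * s - \<alpha>)"
  shows "\<exists>C>0. \<forall>(u::'a \<Rightarrow> real) x. u \<in> borel_measurable borel \<longrightarrow>
    riesz_potential \<alpha> p u x < \<infinity> \<longrightarrow> diff_square m (n + 2 * s) u x < \<infinity> \<longrightarrow>
    \<bar>u x\<bar> powr (2 * n / (n - 2 * s))
      \<le> C * (\<bar>u x\<bar> powr p * enn2real (riesz_potential \<alpha> p u x)) powr \<kappa>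
          * enn2real (diff_square m (n + 2 * s) u x) powr (1 - \<kappa>)"
proof -
  define \<omega> where "\<omega> = unit_ball_vol n"
  \<comment> \<open>Writing \<open>real m + 1\<close> instead of \<open>real m\<close> keeps A, and
    with it C, positive for m = 0.\<close>
  define A where "A = (real m + 1) * (2 ^ (m + 1)) powr p * (real m + 1) powr \<alpha>"
  define C where "C = 2 / \<omega> * A powr \<kappa> * 4 powr (1 - \<kappa>)"
  have n: "n > 0" by (simp add: n_def)
  have \<omega>: "\<omega> > 0" using n by (simp add: \<omega>_def)
  have A: "A > 0" by (simp add: A_def)
  have \<kappa>01: "0 < \<kappa>" "\<kappa> < 1" using s \<alpha> by (auto simp: \<kappa>)
  have p0: "p > 0" using s \<alpha> by (simp add: p)
  have main: "\<bar>u x\<bar> powr (2 * n / (n - 2 * s))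
      \<le> C * (\<bar>u x\<bar> powr p * enn2real (riesz_potential \<alpha> p u x)) powr \<kappa>
          * enn2real (diff_square m (n + 2 * s) u x) powr (1 - \<kappa>)"
    if [measurable]: "u \<in> borel_measurable borel" and V: "riesz_potential \<alpha> p u x < \<infinity>"
      and G: "diff_square m (n + 2 * s) u x < \<infinity>" for u :: "'a \<Rightarrow> real" and x
  proof (cases "u x = 0")
    case False
    define w where "w = \<bar>u x\<bar>"
    define v where "v = enn2real (riesz_potential \<alpha> p u x)"
    define g where "g = enn2real (diff_square m (n + 2 * s) u x)"
    have w: "w > 0" using False by (simp add: w_def)
    have v: "v \<ge> 0" "riesz_potential \<alpha> p u x = ennreal v" using V by (auto simp: v_def)
    have g: "g \<ge> 0" "diff_square m (n + 2 * s) u x = ennreal g" using G by (auto simp: g_def)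
    have le: "\<omega> \<le> (4 * g / w powr 2) * r powr (2 * s) + (A * v / w powr p) * r powr (- (n - \<alpha>))" if r: "r > 0" for r
    proof -
      have "ennreal (\<omega> * r powr n) \<le> ennreal (4 / (u x)\<^sup>2 * r powr (n + 2 * s)) * diff_square m (n + 2 * s) u x
        + ennreal (real m * (2 ^ (m + 1) / \<bar>u x\<bar>) powr p)
          * (\<integral>\<^sup>+y. ennreal (\<bar>u y\<bar> powr p) * indicator (ball x (real m * r)) y \<partial>lborel)"
        unfolding \<omega>_def n_def using False p0 r s n
        by (intro averaged_pointwise_difference) (auto simp: n_def)
      also have "\<dots> \<le> ennreal (4 / (u x)\<^sup>2 * r powr (n + 2 * s)) * ennreal g
        + ennreal (real m * (2 ^ (m + 1) / \<bar>u x\<bar>) powr p) * (ennreal ((real m * r) powr \<alpha>) * ennreal v)"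
        unfolding g(2)[symmetric] v(2)[symmetric]
        using \<alpha> r by (intro add_left_mono mult_left_mono ball_integral_le_riesz_potential) auto
      also have "\<dots> = ennreal (4 / (u x)\<^sup>2 * r powr (n + 2 * s) * g
          + real m * (2 ^ (m + 1) / \<bar>u x\<bar>) powr p * ((real m * r) powr \<alpha> * v))"
        using v g
        by (subst ennreal_plus, simp, simp, subst ennreal_mult, simp, simp, subst (2) ennreal_mult, simp, simp,
            subst (3) ennreal_mult, simp_all)
      finally have "\<omega> * r powr n \<le> 4 / (u x)\<^sup>2 * r powr (n + 2 * s) * g
          + real m * (2 ^ (m + 1) / \<bar>u x\<bar>) powr p * ((real m * r) powr \<alpha> * v)"
        using v g by (subst (asm) ennreal_le_iff) auto
      also have "real m * (2 ^ (m + 1) / \<bar>u x\<bar>) powr p * ((real m * r) powr \<alpha> * v)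
        \<le> (real m + 1) * (2 ^ (m + 1) / \<bar>u x\<bar>) powr p * (((real m + 1) * r) powr \<alpha> * v)"
        using r v \<alpha> p0 by (intro mult_mono powr_mono2) auto
      also have "\<dots> = A * v / w powr p * r powr \<alpha>"
        using r w by (simp add: A_def w_def powr_mult powr_divide mult_ac)
      also have "4 / (u x)\<^sup>2 * r powr (n + 2 * s) * g = (4 * g / w powr 2) * r powr (n + 2 * s)"
        by (simp add: w_def)
      finally have "\<omega> * r powr n \<le> 4 * g / w powr 2 * r powr (n + 2 * s) + A * v / w powr p * r powr \<alpha>"
        by simp
      then have "\<omega> * r powr n * r powr (- n) \<le> (4 * g / w powr 2 * r powr (n + 2 * s) + A * v / w powr p * r powr \<alpha>) * r powr (- n)"
        by (intro mult_right_mono) auto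
      moreover have "r powr n * r powr (- n) = 1" "r powr (n + 2 * s) * r powr (- n) = r powr (2 * s)"
        "r powr \<alpha> * r powr (- n) = r powr (- (n - \<alpha>))"
        using r by (simp_all add: powr_add[symmetric])
      ultimately show ?thesis by (simp add: algebra_simps)
    qed
    have "(\<omega> / 2) powr (1 + (n - \<alpha>) / (2 * s))
        \<le> (A * v / w powr p) * (4 * g / w powr 2) powr ((n - \<alpha>) / (2 * s))"
      using \<omega> g v A s \<alpha> w by (intro optimise_radius le) auto
    \<comment> \<open>\<kappa> is the reciprocal of \<open>1 + (n - \<alpha>) / (2 * s)\<close>, so
      this power reduces the left-hand side to \<omega> / 2.\<close>
    then have "((\<omega> / 2) powr (1 + (n - \<alpha>) / (2 * s))) powr \<kappa>
        \<le> ((A * v / w powr p) * (4 * g / w powr 2) powr ((n - \<alpha>) / (2 * s))) powr \<kappa>"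
      using \<kappa>01 by (intro powr_mono2) auto
    moreover have "(1 + (n - \<alpha>) / (2 * s)) * \<kappa> = 1" "(n - \<alpha>) / (2 * s) * \<kappa> = 1 - \<kappa>"
    proof -
      have "1 + (n - \<alpha>) / (2 * s) = (n + 2 * s - \<alpha>) / (2 * s)" using s by (simp add: field_simps)
      then show 1: "(1 + (n - \<alpha>) / (2 * s)) * \<kappa> = 1" using s \<alpha> by (simp add: \<kappa>)
      then show "(n - \<alpha>) / (2 * s) * \<kappa> = 1 - \<kappa>" by (simp add: distrib_right)
    qed
    ultimately have "\<omega> / 2 \<le> (A * v / w powr p) powr \<kappa> * (4 * g / w powr 2) powr (1 - \<kappa>)"
      using \<omega> by (simp only: powr_powr powr_mult) simp
    then have "\<omega> / 2 * w powr (2 * n / (n - 2 * s))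
        \<le> (A * v / w powr p) powr \<kappa> * (4 * g / w powr 2) powr (1 - \<kappa>) * w powr (2 * n / (n - 2 * s))"
      by (intro mult_right_mono) auto
    \<comment> \<open>One \<open>p * \<kappa>\<close> and the \<open>2 * (1 - \<kappa>)\<close>
      clear the denominators \<open>w powr p\<close> and \<open>w powr 2\<close>; the other
      \<open>p * \<kappa>\<close> completes v to \<open>w powr p * v\<close>, the density of the
      Coulomb energy.\<close>
    also have "2 * n / (n - 2 * s) = p * \<kappa> + p * \<kappa> + 2 * (1 - \<kappa>)"
    proof -
      have 1: "p - 1 = (n + 2 * s - \<alpha>) / (n - 2 * s)" using s by (simp add: p field_simps)
      have "\<kappa> * (p - 1) = 2 * s / (n - 2 * s)" unfolding 1 \<kappa> using s \<alpha> by simp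
      then have "p * \<kappa> + p * \<kappa> + 2 * (1 - \<kappa>) = 2 * (2 * s / (n - 2 * s)) + 2" by algebra
      also have "\<dots> = 2 * n / (n - 2 * s)" using s by (simp add: field_simps)
      finally show ?thesis by simp
    qed
    also have "(A * v / w powr p) powr \<kappa> * (4 * g / w powr 2) powr (1 - \<kappa>) * w powr (p * \<kappa> + p * \<kappa> + 2 * (1 - \<kappa>))
       = A powr \<kappa> * 4 powr (1 - \<kappa>) * (w powr p * v) powr \<kappa> * g powr (1 - \<kappa>)"
    proof -
      define W Z where "W = w powr (p * \<kappa>)" and "Z = w powr (2 * (1 - \<kappa>))"
      have WZ: "W > 0" "Z > 0" using w by (simp_all add: W_def Z_def)
      have 1: "w powr (p * \<kappa> + p * \<kappa> + 2 * (1 - \<kappa>)) = W * W * Z" by (simp only: powr_add W_def Z_def)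
      have 2: "(A * v / w powr p) powr \<kappa> = A powr \<kappa> * v powr \<kappa> / W"
        by (simp only: powr_mult powr_divide powr_powr W_def)
      have 3: "(4 * g / w powr 2) powr (1 - \<kappa>) = 4 powr (1 - \<kappa>) * g powr (1 - \<kappa>) / Z"
        by (simp only: powr_mult powr_divide powr_powr Z_def)
      have 4: "(w powr p * v) powr \<kappa> = W * v powr \<kappa>" by (simp only: powr_mult powr_powr W_def)
      show ?thesis unfolding 1 2 3 4 using WZ by (simp add: field_simps)
    qed
    finally have "w powr (p * \<kappa> + p * \<kappa> + 2 * (1 - \<kappa>)) \<le> C * (w powr p * v) powr \<kappa> * g powr (1 - \<kappa>)"
      using \<omega> by (simp add: C_def field_simps del: powr_numeral)
    moreover have "2 * n / (n - 2 * s) = p * \<kappa> + p * \<kappa> + 2 * (1 - \<kappa>)" by fact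
    ultimately show ?thesis unfolding w_def v_def g_def by simp
  qed simp
  have "C > 0" using \<omega> A by (simp add: C_def)
  with main show ?thesis by blast
qed

section \<open>Hoelder's inequality for three factors\<close>

lemma weighted_amgm3:
  fixes x y z a b c :: real
  assumes "x \<ge> 0" "y \<ge> 0" "z \<ge> 0" "a > 0" "b > 0" "c > 0" "a + b + c = 1"
  shows "x powr a * y powr b * z powr c \<le> a * x + b * y + c * z"
proof (cases "x = 0 \<or> y = 0 \<or> z = 0")
  case False
  have bc: "b / (b + c) + c / (b + c) = 1" using assms by (simp add: add_divide_distrib[symmetric])
  \<comment> \<open>Young's inequality for two terms is used twice: y and z are first merged into t
    with normalised weights, then t is paired with x.\<close>
  define t where "t = y powr (b / (b + c)) * z powr (c / (b + c))"
  have 1: "t \<le> b / (b + c) * y + c / (b + c) * z"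
    unfolding t_def using assms bc False by (intro Youngs_inequality_0) auto
  have "x powr a * y powr b * z powr c = x powr a * t powr (b + c)"
    using assms by (simp add: t_def powr_mult powr_powr)
  also have "\<dots> \<le> a * x + (b + c) * t"
    using assms False by (intro Youngs_inequality_0) (auto simp: t_def)
  also have "\<dots> \<le> a * x + (b + c) * (b / (b + c) * y + c / (b + c) * z)"
    using 1 assms by (intro add_left_mono mult_left_mono) auto
  also have "\<dots> = a * x + b * y + c * z"
    using assms by (simp add: distrib_left)
  finally show ?thesis .
qed (use assms in auto)

lemma ennreal_combination3:
  assumes "a \<ge> 0" "b \<ge> 0" "c \<ge> 0" "x \<ge> 0" "y \<ge> 0" "z \<ge> 0"
  shows "ennreal (a * x + b * y + c * z) = ennreal a * ennreal x + ennreal b * ennreal y + ennreal c * ennreal z"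
  using assms by (simp add: ennreal_mult ennreal_plus)

text \<open>Weighted AM-GM is applied pointwise after normalising each factor by its bound. The
  bounds may be 0, so e > 0 is added to them and removed by a limit; the powers are continuous at
  base 0 because the exponents are positive.\<close>

lemma Holder3_nn_integral:
  fixes f g h :: "'a \<Rightarrow> real"
  assumes [measurable]: "f \<in> borel_measurable M" "g \<in> borel_measurable M" "h \<in> borel_measurable M"
    and nn: "\<And>x. f x \<ge> 0" "\<And>x. g x \<ge> 0" "\<And>x. h x \<ge> 0"
    and abc: "a > 0" "b > 0" "c > 0" "a + b + c = 1"
    and A: "A \<ge> 0" "(\<integral>\<^sup>+x. ennreal (f x) \<partial>M) \<le> ennreal A"
    and B: "B \<ge> 0" "(\<integral>\<^sup>+x. ennreal (g x) \<partial>M) \<le> ennreal B"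
    and C: "C \<ge> 0" "(\<integral>\<^sup>+x. ennreal (h x) \<partial>M) \<le> ennreal C"
  shows "(\<integral>\<^sup>+x. ennreal (f x powr a * g x powr b * h x powr c) \<partial>M) \<le> ennreal (A powr a * B powr b * C powr c)"
proof -
  have pos: "(\<integral>\<^sup>+x. ennreal (f x powr a * g x powr b * h x powr c) \<partial>M)
      \<le> ennreal ((A + e) powr a * (B + e) powr b * (C + e) powr c)" (is "?I \<le> ennreal ?P") if e: "e > 0" for e
  proof -
    have pos: "A + e > 0" "B + e > 0" "C + e > 0" using A B C e by auto
    have "?I \<le> (\<integral>\<^sup>+x. ennreal (?P * a / (A + e)) * ennreal (f x) + ennreal (?P * b / (B + e)) * ennreal (g x)
        + ennreal (?P * c / (C + e)) * ennreal (h x) \<partial>M)"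
    proof (intro nn_integral_mono)
      fix x
      have "f x powr a * g x powr b * h x powr c
        = ?P * ((f x / (A + e)) powr a * (g x / (B + e)) powr b * (h x / (C + e)) powr c)"
        using pos nn by (simp add: powr_divide)
      also have "\<dots> \<le> ?P * (a * (f x / (A + e)) + b * (g x / (B + e)) + c * (h x / (C + e)))"
        using pos nn abc by (intro mult_left_mono weighted_amgm3) (auto simp: less_imp_le)
      finally have "f x powr a * g x powr b * h x powr c
        \<le> ?P * a / (A + e) * f x + ?P * b / (B + e) * g x + ?P * c / (C + e) * h x"
        by (simp add: algebra_simps)
      then have "ennreal (f x powr a * g x powr b * h x powr c)
        \<le> ennreal (?P * a / (A + e) * f x + ?P * b / (B + e) * g x + ?P * c / (C + e) * h x)"
        by (rule ennreal_leI)
      also have "\<dots> = ennreal (?P * a / (A + e)) * ennreal (f x) + ennreal (?P * b / (B + e)) * ennreal (g x)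
        + ennreal (?P * c / (C + e)) * ennreal (h x)"
        using pos nn abc
        by (intro ennreal_combination3) (simp_all add: less_imp_le)
      finally show "ennreal (f x powr a * g x powr b * h x powr c) \<le> \<dots>" .
    qed
    also have "\<dots> = ennreal (?P * a / (A + e)) * (\<integral>\<^sup>+x. ennreal (f x) \<partial>M)
        + ennreal (?P * b / (B + e)) * (\<integral>\<^sup>+x. ennreal (g x) \<partial>M)
        + ennreal (?P * c / (C + e)) * (\<integral>\<^sup>+x. ennreal (h x) \<partial>M)"
      by (simp add: nn_integral_add nn_integral_cmult)
    also have "\<dots> \<le> ennreal (?P * a / (A + e)) * ennreal (A + e)
        + ennreal (?P * b / (B + e)) * ennreal (B + e)
        + ennreal (?P * c / (C + e)) * ennreal (C + e)"
      using A B C e by (intro add_mono mult_left_mono) (auto intro: order_trans simp: ennreal_leI)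
    also have "\<dots> = ennreal (?P * (a + b + c))"
    proof -
      have "?P * a / (A + e) * (A + e) + ?P * b / (B + e) * (B + e) + ?P * c / (C + e) * (C + e) = ?P * (a + b + c)"
      proof -
        have c: "X / Y * Y = X" if "Y > 0" for X Y :: real using that by simp
        show ?thesis by (simp only: c pos) (simp only: distrib_left)
      qed
      moreover have "ennreal (?P * a / (A + e) * (A + e) + ?P * b / (B + e) * (B + e) + ?P * c / (C + e) * (C + e))
        = ennreal (?P * a / (A + e)) * ennreal (A + e) + ennreal (?P * b / (B + e)) * ennreal (B + e)
        + ennreal (?P * c / (C + e)) * ennreal (C + e)"
        using pos abc by (intro ennreal_combination3) (simp_all add: less_imp_le)
      ultimately show ?thesis by (simp only:)
    qed
    finally show ?thesis using abc by simp
  qed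
  have lim: "((\<lambda>e. (X + e) powr d) \<longlongrightarrow> (X + 0) powr d) (at_right 0)" if "X \<ge> 0" "d > 0" for X d :: real
  proof (rule tendsto_powr')
    show "X + 0 \<noteq> 0 \<or> 0 < d \<and> (\<forall>\<^sub>F e in at_right 0. 0 \<le> X + e)"
      using that by (auto simp: eventually_at_filter)
  qed (intro tendsto_intros)+
  have "((\<lambda>e. ennreal ((A + e) powr a * (B + e) powr b * (C + e) powr c))
      \<longlongrightarrow> ennreal ((A + 0) powr a * (B + 0) powr b * (C + 0) powr c)) (at_right 0)"
    by (intro tendsto_ennrealI tendsto_mult lim A B C abc)
  moreover have "\<forall>\<^sub>F e in at_right 0. (\<integral>\<^sup>+x. ennreal (f x powr a * g x powr b * h x powr c) \<partial>M)
      \<le> ennreal ((A + e) powr a * (B + e) powr b * (C + e) powr c)"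
    by (auto simp: eventually_at_filter intro!: pos always_eventually)
  ultimately show ?thesis
    by (intro tendsto_lowerbound[where F = "at_right (0::real)"]) auto
qed

text \<open>Averaging over a ball of radius \<open>K * norm x\<close> reproduces the left-hand side with a factor of
  order \<open>K powr (2 * s - n)\<close>, which is absorbed for large \<open>K\<close>; this is where \<open>2 * s < n\<close> enters, and
  why the left-hand side must be known to be finite.\<close>

lemma hardy_absorbed:
  fixes s :: real and m :: nat
  defines "n \<equiv> real DIM('a::euclidean_space)"
  assumes s: "0 < s" "2 * s < n"
  shows "\<exists>C>0. \<forall>u::'a \<Rightarrow> real. u \<in> borel_measurable borel \<longrightarrow>
    (\<integral>\<^sup>+x. ennreal ((u x)\<^sup>2 * norm x powr (- (2 * s))) \<partial>lborel) < \<infinity> \<longrightarrow>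
    (\<integral>\<^sup>+x. ennreal ((u x)\<^sup>2 * norm x powr (- (2 * s))) \<partial>lborel)
      \<le> ennreal C * (\<integral>\<^sup>+x. diff_square m (n + 2 * s) u x \<partial>lborel)"
proof -
  define \<omega> where "\<omega> = unit_ball_vol n"
  have n: "n > 0" by (simp add: n_def)
  have \<omega>: "\<omega> > 0" using n by (simp add: \<omega>_def)
  obtain C0 where C0: "C0 > 0" "\<And>\<rho>. \<rho> > 0 \<Longrightarrow>
     (\<integral>\<^sup>+x. ennreal (norm x powr (- n - 2 * s)) * indicator {x. \<rho> \<le> norm x} x \<partial>(lborel :: 'a measure))
    \<le> ennreal (C0 * \<rho> powr (- (2 * s)))"
    using nn_integral_norm_powr_outside_ball[where 'a='a, of "- n - 2 * s"] s by (auto simp: n_def)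
  \<comment> \<open>\<open>A\<close> collects the factors of the shifted values for q = 2, where the
    square of \<open>2 ^ (m + 1)\<close> is \<open>4 ^ (m + 1)\<close>. \<open>T\<close> adds the
    tail constant \<open>C0\<close> and the K-free part of \<open>?L powr (2 * s)\<close>.
    \<open>K\<close> solves \<open>K powr (n - 2 * s) = 2 * T + 1\<close>, so that the reproduced
    fraction of the left-hand side is at most 1/2.\<close>
  define A where "A = real m * 4 ^ (m + 1) / \<omega>"
  define T where "T = A * C0 * (real m + 1) powr (2 * s)"
  define K where "K = (2 * T + 1) powr (1 / (n - 2 * s))"
  have A: "A \<ge> 0" using \<omega> by (simp add: A_def)
  have T: "T \<ge> 0" using A C0 by (simp add: T_def)
  have K: "K \<ge> 1" unfolding K_def using T s by (intro ge_one_powr_ge_zero) auto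
  have "T * K powr (2 * s - n) = T / (2 * T + 1)"
  proof -
    have "K powr (2 * s - n) = inverse (K powr (n - 2 * s))" by (simp add: powr_minus[symmetric])
    also have "K powr (n - 2 * s) = 2 * T + 1" using T s by (simp add: K_def powr_powr)
    finally show ?thesis by (simp add: divide_inverse)
  qed
  also have "\<dots> \<le> 1 / 2" using T by (simp add: field_simps)
  finally have TK: "T * K powr (2 * s - n) \<le> 1 / 2" .
  define B where "B = 4 * K powr (2 * s) / \<omega>"
  have B: "B > 0" using \<omega> K by (simp add: B_def)
  have "(\<integral>\<^sup>+x. ennreal ((u x)\<^sup>2 * norm x powr (- (2 * s))) \<partial>lborel)
      \<le> ennreal (2 * B) * (\<integral>\<^sup>+x. diff_square m (n + 2 * s) u x \<partial>lborel)" (is "?I \<le> _ * ?G")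
    if [measurable]: "u \<in> borel_measurable borel"
      and fin: "(\<integral>\<^sup>+x. ennreal ((u x)\<^sup>2 * norm x powr (- (2 * s))) \<partial>lborel) < \<infinity>" for u :: "'a \<Rightarrow> real"
  proof -
    let ?L = "(real m + 1) * K"
    have L: "?L > 0" using K by (intro mult_pos_pos) auto
    have ptw: "ennreal ((u x)\<^sup>2 * norm x powr (- (2 * s)))
        \<le> ennreal B * diff_square m (n + 2 * s) u x + ennreal (A * K powr (- n))
          * (\<integral>\<^sup>+y. ennreal ((u y)\<^sup>2) * (ennreal (norm x powr (- n - 2 * s)) * indicator {x. norm y / ?L \<le> norm x} x) \<partial>lborel)"
      if x: "x \<noteq> 0" for x
    proof (cases "u x = 0")
      case False
      define r where "r = K * norm x"
      have r: "r > 0" using x K by (simp add: r_def)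
      \<comment> \<open>With \<open>r = K * norm x\<close>, multiplication by c turns the measure
        \<open>\<omega> * r powr n\<close> of the ball into the Hardy density at x.\<close>
      define c where "c = (u x)\<^sup>2 / (\<omega> * K powr n * norm x powr (n + 2 * s))"
      have c: "c > 0" using False x K \<omega> by (simp add: c_def)
      have "ennreal c * ennreal (\<omega> * r powr n) \<le> ennreal c * (ennreal (4 / (u x)\<^sup>2 * r powr (n + 2 * s)) * diff_square m (n + 2 * s) u x
        + ennreal (real m * (2 ^ (m + 1) / \<bar>u x\<bar>) powr 2)
          * (\<integral>\<^sup>+y. ennreal (\<bar>u y\<bar> powr 2) * indicator (ball x (real m * r)) y \<partial>lborel))"
        unfolding \<omega>_def n_def using False r s n
        by (intro mult_left_mono averaged_pointwise_difference) (auto simp: n_def)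
      also have "\<dots> = ennreal (c * (4 / (u x)\<^sup>2 * r powr (n + 2 * s))) * diff_square m (n + 2 * s) u x
        + ennreal (c * (real m * (2 ^ (m + 1) / \<bar>u x\<bar>) powr 2))
          * (\<integral>\<^sup>+y. ennreal (\<bar>u y\<bar> powr 2) * indicator (ball x (real m * r)) y \<partial>lborel)"
        using c by (subst (1 2) ennreal_mult[of c]) (simp_all only: distrib_left mult.assoc, auto)
      also have "c * (4 / (u x)\<^sup>2 * r powr (n + 2 * s)) = B"
        using False x K \<omega> by (simp add: c_def r_def B_def powr_mult powr_add field_simps)
      also have "c * (real m * (2 ^ (m + 1) / \<bar>u x\<bar>) powr 2) = A * K powr (- n) * norm x powr (- n - 2 * s)"
      proof -
        have "(2 ^ (m + 1) / \<bar>u x\<bar>) powr 2 = 4 ^ (m + 1) / (u x)\<^sup>2"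
          using False by (simp add: power_divide power_mult[symmetric] mult.commute[of _ 2] power_mult)
        moreover have "norm x powr (- n - 2 * s) = inverse (norm x powr (n + 2 * s))"
          using powr_minus[of "norm x" "n + 2 * s"] by simp
        ultimately show ?thesis
          using False by (simp add: c_def A_def powr_minus divide_inverse mult_ac)
      qed
      also have "ennreal c * ennreal (\<omega> * r powr n) = ennreal ((u x)\<^sup>2 * norm x powr (- (2 * s)))"
      proof -
        have "c * (\<omega> * r powr n) = (u x)\<^sup>2 * norm x powr (- (2 * s))"
          using False x K \<omega> by (simp add: c_def r_def powr_mult powr_add powr_minus field_simps)
        then show ?thesis using c \<omega> by (simp add: ennreal_mult[symmetric])
      qed
      finally have "ennreal ((u x)\<^sup>2 * norm x powr (- (2 * s)))
        \<le> ennreal B * diff_square m (n + 2 * s) u x + ennreal (A * K powr (- n) * norm x powr (- n - 2 * s))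
          * (\<integral>\<^sup>+y. ennreal (\<bar>u y\<bar> powr 2) * indicator (ball x (real m * r)) y \<partial>lborel)" .
      also have "ennreal (A * K powr (- n) * norm x powr (- n - 2 * s))
          * (\<integral>\<^sup>+y. ennreal (\<bar>u y\<bar> powr 2) * indicator (ball x (real m * r)) y \<partial>lborel)
        = ennreal (A * K powr (- n)) * (\<integral>\<^sup>+y. ennreal (norm x powr (- n - 2 * s)) *
             (ennreal (\<bar>u y\<bar> powr 2) * indicator (ball x (real m * r)) y) \<partial>lborel)"
        using A by (subst nn_integral_cmult) (auto simp: ennreal_mult mult.assoc intro!: borel_measurable_times_ennreal borel_measurable_indicator)
      also have "\<dots> \<le> ennreal (A * K powr (- n))
          * (\<integral>\<^sup>+y. ennreal ((u y)\<^sup>2) * (ennreal (norm x powr (- n - 2 * s)) * indicator {x. norm y / ?L \<le> norm x} x) \<partial>lborel)"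
      proof (intro mult_left_mono nn_integral_mono)
        fix y
        \<comment> \<open>The ball around x is traded for a lower bound on \<open>norm x\<close> in
          terms of \<open>norm y\<close>, so that after exchanging the integrals x runs over the
          complement of a ball. K \<ge> 1 absorbs the extra summand \<open>norm x\<close>.\<close>
        have "norm y \<le> ?L * norm x" if "norm (x - y) < real m * (K * norm x)"
        proof -
          have "norm y \<le> norm x + norm (x - y)" by norm
          also have "\<dots> \<le> K * norm x + real m * (K * norm x)"
            using that K mult_right_mono[of 1 K "norm x"] by simp
          finally show ?thesis by (simp add: algebra_simps)
        qed
        then have "norm y / ?L \<le> norm x" if "norm (x - y) < real m * (K * norm x)"
          using that L by (simp add: pos_divide_le_eq mult_ac)
        then show "ennreal (norm x powr (- n - 2 * s)) * (ennreal (\<bar>u y\<bar> powr 2) * indicator (ball x (real m * r)) y)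
          \<le> ennreal ((u y)\<^sup>2) * (ennreal (norm x powr (- n - 2 * s)) * indicator {x. norm y / ?L \<le> norm x} x)"
          by (auto simp: indicator_def dist_norm r_def mult_ac)
      qed auto
      finally show ?thesis by (simp add: add_left_mono)
    qed simp
    have "?I \<le> (\<integral>\<^sup>+x. ennreal B * diff_square m (n + 2 * s) u x + ennreal (A * K powr (- n))
          * (\<integral>\<^sup>+y. ennreal ((u y)\<^sup>2) * (ennreal (norm x powr (- n - 2 * s)) * indicator {x. norm y / ?L \<le> norm x} x) \<partial>lborel) \<partial>lborel)"
    proof (rule nn_integral_mono_AE)
      have "AE x in lborel. x \<noteq> (0::'a)" using AE_lborel_singleton by auto
      then show "AE x in lborel. ennreal ((u x)\<^sup>2 * norm x powr (- (2 * s))) \<le> ennreal B * diff_square m (n + 2 * s) u x + ennreal (A * K powr (- n))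
          * (\<integral>\<^sup>+y. ennreal ((u y)\<^sup>2) * (ennreal (norm x powr (- n - 2 * s)) * indicator {x. norm y / ?L \<le> norm x} x) \<partial>lborel)"
        by eventually_elim (rule ptw)
    qed
    also have "\<dots> = ennreal B * ?G + ennreal (A * K powr (- n))
          * (\<integral>\<^sup>+x. \<integral>\<^sup>+y. ennreal ((u y)\<^sup>2) * (ennreal (norm x powr (- n - 2 * s)) * indicator {x. norm y / ?L \<le> norm x} x) \<partial>(lborel::'a measure) \<partial>(lborel::'a measure))"
    proof -
      have "(\<lambda>(x::'a, y). ennreal ((u y)\<^sup>2) * (ennreal (norm x powr (- n - 2 * s)) * indicator {x. norm y / ?L \<le> norm x} x))
          \<in> borel_measurable (borel \<Otimes>\<^sub>M lborel)"
        by measurable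
      then have "(\<lambda>x::'a. \<integral>\<^sup>+y. ennreal ((u y)\<^sup>2) * (ennreal (norm x powr (- n - 2 * s)) * indicator {x. norm y / ?L \<le> norm x} x) \<partial>lborel)
          \<in> borel_measurable borel"
        by (intro sigma_finite_measure.borel_measurable_nn_integral sigma_finite_lborel)
      then show ?thesis by (simp add: nn_integral_add nn_integral_cmult)
    qed
    also have "(\<integral>\<^sup>+x. \<integral>\<^sup>+y. ennreal ((u y)\<^sup>2) * (ennreal (norm x powr (- n - 2 * s)) * indicator {x. norm y / ?L \<le> norm x} x) \<partial>(lborel::'a measure) \<partial>(lborel::'a measure))
       = (\<integral>\<^sup>+y. \<integral>\<^sup>+x. ennreal ((u y)\<^sup>2) * (ennreal (norm x powr (- n - 2 * s)) * indicator {x. norm y / ?L \<le> norm x} x) \<partial>(lborel::'a measure) \<partial>(lborel::'a measure))"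
      by (intro lborel_pair.Fubini') measurable
    \<comment> \<open>The integral of \<open>norm x powr (- n - 2 * s)\<close> over norm x \<ge>
      \<open>norm y / ?L\<close> is of order \<open>norm y powr (- (2 * s))\<close>: the Hardy
      density reappears, now at y.\<close>
    also have "\<dots> \<le> (\<integral>\<^sup>+y. ennreal (C0 * ?L powr (2 * s)) * ennreal ((u y)\<^sup>2 * norm y powr (- (2 * s))) \<partial>lborel)"
    proof (rule nn_integral_mono_AE)
      have "AE x in lborel. x \<noteq> (0::'a)" using AE_lborel_singleton by auto
      then show "AE y in lborel. (\<integral>\<^sup>+x. ennreal ((u y)\<^sup>2) * (ennreal (norm x powr (- n - 2 * s)) * indicator {x. norm y / ?L \<le> norm x} x) \<partial>(lborel::'a measure))
         \<le> ennreal (C0 * ?L powr (2 * s)) * ennreal ((u y)\<^sup>2 * norm y powr (- (2 * s)))"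
      proof eventually_elim
        case (elim y)
        have "(\<integral>\<^sup>+x. ennreal ((u y)\<^sup>2) * (ennreal (norm x powr (- n - 2 * s)) * indicator {x. norm y / ?L \<le> norm x} x) \<partial>(lborel::'a measure))
          = ennreal ((u y)\<^sup>2) * (\<integral>\<^sup>+x. ennreal (norm x powr (- n - 2 * s)) * indicator {x. norm y / ?L \<le> norm x} x \<partial>(lborel::'a measure))"
          by (intro nn_integral_cmult) measurable
        also have "\<dots> \<le> ennreal ((u y)\<^sup>2) * ennreal (C0 * (norm y / ?L) powr (- (2 * s)))"
          using elim L by (intro mult_left_mono C0) auto
        also have "\<dots> = ennreal (C0 * ?L powr (2 * s)) * ennreal ((u y)\<^sup>2 * norm y powr (- (2 * s)))"
        proof -
          have 1: "(norm y / ?L) powr (- (2 * s)) = ?L powr (2 * s) * norm y powr (- (2 * s))"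
            by (simp only: powr_divide) (simp only: powr_minus divide_inverse inverse_inverse_eq mult.commute)
          have "(u y)\<^sup>2 * (C0 * (norm y / ?L) powr (- (2 * s))) = C0 * ?L powr (2 * s) * ((u y)\<^sup>2 * norm y powr (- (2 * s)))"
            unfolding 1 by (simp only: mult_ac)
          then show ?thesis using C0(1) by (simp add: ennreal_mult[symmetric] del: powr_eq_0_iff)
        qed
        finally show ?case .
      qed
    qed
    also have "\<dots> = ennreal (C0 * ?L powr (2 * s)) * ?I" by (intro nn_integral_cmult) measurable
    finally have "?I \<le> ennreal B * ?G + ennreal (A * K powr (- n)) * (ennreal (C0 * ?L powr (2 * s)) * ?I)"
      by (simp add: add_left_mono mult_left_mono)
    also have "ennreal (A * K powr (- n)) * (ennreal (C0 * ?L powr (2 * s)) * ?I) = ennreal (T * K powr (2 * s - n)) * ?I"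
    proof -
      have "A * K powr (- n) * (C0 * ?L powr (2 * s)) = T * K powr (2 * s - n)"
        using K by (simp add: T_def powr_mult powr_diff powr_minus divide_inverse mult_ac)
      then show ?thesis using A C0 by (simp add: mult.assoc[symmetric] ennreal_mult[symmetric])
    qed
    also have "\<dots> \<le> ennreal (1 / 2) * ?I" using TK by (intro mult_right_mono ennreal_leI) auto
    finally have *: "?I \<le> ennreal B * ?G + ennreal (1 / 2) * ?I" by (simp add: add_left_mono)
    show ?thesis
    proof (cases "?G = \<infinity>")
      case True
      then show ?thesis using B by (simp add: ennreal_mult_top)
    next
      case False
      then obtain g where g: "g \<ge> 0" "?G = ennreal g" by (cases "?G") auto
      obtain i where i: "i \<ge> 0" "?I = ennreal i" using fin by (cases "?I") auto
      have "ennreal i \<le> ennreal (B * g + 1 / 2 * i)"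
      proof -
        have "ennreal (B * g + 1 / 2 * i + 0 * 0) = ennreal B * ennreal g + ennreal (1 / 2) * ennreal i + ennreal 0 * ennreal 0"
          using B g i by (intro ennreal_combination3) auto
        with *[unfolded g(2) i(2)] show ?thesis by (simp only: ennreal_0 mult_zero_left add_0_right)
      qed
      then have "i \<le> 2 * B * g" using B g i by (subst (asm) ennreal_le_iff) auto
      then show ?thesis using B g i by (simp add: ennreal_mult[symmetric] ennreal_leI)
    qed
  qed
  then show ?thesis using B by (intro exI[of _ "2 * B"]) auto
qed

section \<open>Plancherel\<close>

lemma integral_lborel_affine:
  fixes f :: "'a::euclidean_space \<Rightarrow> 'b::{banach, second_countable_topology}"
  assumes [measurable]: "f \<in> borel_measurable borel" and c: "c \<noteq> 0"
  shows "(LINT x|lborel. f x) = (\<bar>c\<bar> ^ DIM('a)) *\<^sub>R (LINT x|lborel. f (t + c *\<^sub>R x))"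
  by (subst lborel_affine[OF c, of t]) (simp add: integral_density integral_distr)

text \<open>The exponent has the sign used by \<open>char\<close> and by the inversion integral in
  \<open>frac_laplacian_half\<close>, opposite to that of \<open>fourier\<close>. There is no
  normalising factor, so Plancherel carries (2 pi)^n.\<close>

definition ft :: "('a::euclidean_space \<Rightarrow> complex) \<Rightarrow> 'a \<Rightarrow> complex" where
  "ft f x = (LINT y|lborel. f y * iexp (x \<bullet> y))"

text \<open>Normalised to be 1 at the origin rather than to have mass 1, so that the dilates
  \<open>gauss (e *\<^sub>R x)\<close> increase to 1 as e decreases to 0 and can serve as a
  removable weight.\<close>

definition gauss :: "'a::euclidean_space \<Rightarrow> real" where
  "gauss x = exp (- (norm x)\<^sup>2 / 2)"

lemma gauss_continuous [continuous_intros]: "continuous_on A gauss"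
  unfolding gauss_def by (intro continuous_intros) auto

lemma gauss_measurable [measurable]: "gauss \<in> borel_measurable borel"
  by (intro borel_measurable_continuous_onI gauss_continuous)

lemma gauss_nonneg [simp]: "gauss x \<ge> 0" and gauss_le_1 [simp]: "gauss x \<le> 1"
  by (simp_all add: gauss_def)

lemma gauss_eq_prod: "gauss x = (\<Prod>b\<in>Basis. exp (- (x \<bullet> b)\<^sup>2 / 2))"
proof -
  have "(norm x)\<^sup>2 = (\<Sum>b\<in>Basis. (x \<bullet> b)\<^sup>2)"
    by (subst power2_norm_eq_inner, subst euclidean_inner) (simp add: power2_eq_square)
  then show ?thesis
    by (simp add: gauss_def exp_sum[symmetric] sum_negf sum_divide_distrib)
qed

lemma exp_eq_std_normal_density: "exp (- t\<^sup>2 / 2) = sqrt (2 * pi) * std_normal_density t"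
  by (simp add: std_normal_density_def)

lemma integrable_gauss_1: "integrable lborel (\<lambda>t::real. exp (- t\<^sup>2 / 2))"
proof -
  have "integrable lborel std_normal_density"
    using integrable_normal_density[of 1 0] by simp
  then show ?thesis unfolding exp_eq_std_normal_density by (intro integrable_mult_right)
qed

text \<open>This is the characteristic function of the standard normal law, with the normalisation
  of its density undone.\<close>

lemma ft_gauss_1:
  "(CLINT t|lborel. complex_of_real (exp (- t\<^sup>2 / 2)) * iexp (y * t))
    = complex_of_real (sqrt (2 * pi)) * complex_of_real (exp (- y\<^sup>2 / 2))"
proof -
  have "complex_of_real (exp (- y\<^sup>2 / 2)) = (CLINT t|density lborel std_normal_density. iexp (y * t))"
    using fun_cong[OF char_std_normal_distribution, of y] by (simp only: char_def)
  also have "\<dots> = (CLINT t|lborel. std_normal_density t *\<^sub>R iexp (y * t))"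
    by (intro integral_density) auto
  finally have "complex_of_real (sqrt (2 * pi)) * complex_of_real (exp (- y\<^sup>2 / 2))
    = (CLINT t|lborel. complex_of_real (sqrt (2 * pi)) * (std_normal_density t *\<^sub>R iexp (y * t)))"
    by (simp only: integral_mult_right_zero)
  also have "\<dots> = (CLINT t|lborel. complex_of_real (exp (- t\<^sup>2 / 2)) * iexp (y * t))"
    by (intro Bochner_Integration.integral_cong refl)
       (simp only: exp_eq_std_normal_density scaleR_conv_of_real of_real_mult mult.assoc)
  finally show ?thesis ..
qed

text \<open>\<open>lborel\<close> is the image of the product of one-dimensional Lebesgue measures
  over \<open>Basis\<close>; this reduces Gaussian integrals to dimension one.\<close>

lemma lborel_integral_prod:
  fixes f :: "'a::euclidean_space \<Rightarrow> real \<Rightarrow> complex"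
  assumes "\<And>b. b \<in> Basis \<Longrightarrow> integrable lborel (f b)"
  shows "integrable lborel (\<lambda>x::'a. \<Prod>b\<in>Basis. f b (x \<bullet> b))"
    and "(LINT x|lborel. (\<Prod>b\<in>Basis. f b (x \<bullet> b))) = (\<Prod>b\<in>Basis. LINT t|lborel. f b t)"
proof -
  interpret P: product_sigma_finite "\<lambda>_::'a. lborel :: real measure" by standard
  have [measurable]: "f b \<in> borel_measurable borel" if "b \<in> Basis" for b
    using assms[OF that] by auto
  have [measurable]: "(\<lambda>x::'a. \<Prod>b\<in>Basis. f b (x \<bullet> b)) \<in> borel_measurable borel"
    by (intro borel_measurable_prod) measurable
  have inner: "(\<Sum>b\<in>Basis. g b *\<^sub>R b) \<bullet> c = g c" if "c \<in> Basis" for g :: "'a \<Rightarrow> real" and c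
    using that by simp
  have [simp]: "(\<Prod>b\<in>Basis. f b ((\<Sum>b\<in>Basis. x b *\<^sub>R b) \<bullet> b)) = (\<Prod>b\<in>Basis. f b (x b))" for x
    by (intro prod.cong refl) (simp only: inner)
  show "integrable lborel (\<lambda>x::'a. \<Prod>b\<in>Basis. f b (x \<bullet> b))"
    unfolding lborel_eq[where 'a='a] using P.product_integrable_prod[OF finite_Basis assms]
    by (subst integrable_distr_eq) auto
  show "(LINT x|lborel. (\<Prod>b\<in>Basis. f b (x \<bullet> b))) = (\<Prod>b\<in>Basis. LINT t|lborel. f b t)"
    unfolding lborel_eq[where 'a='a] using P.product_integral_prod[OF finite_Basis assms]
    by (subst integral_distr) auto
qed

lemma integrable_iexp:
  fixes f :: "'a::euclidean_space \<Rightarrow> complex"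
  assumes "integrable lborel f"
  shows "integrable lborel (\<lambda>y. f y * iexp (x \<bullet> y))"
  by (rule Bochner_Integration.integrable_bound[OF assms])
    (use borel_measurable_integrable[OF assms] in \<open>auto simp: norm_mult\<close>)

lemma gauss_iexp_eq_prod:
  "complex_of_real (gauss y) * iexp (x \<bullet> y)
    = (\<Prod>b\<in>Basis. complex_of_real (exp (- (y \<bullet> b)\<^sup>2 / 2)) * iexp ((x \<bullet> b) * (y \<bullet> b)))"
proof -
  have "iexp (x \<bullet> y) = (\<Prod>b\<in>Basis. iexp ((x \<bullet> b) * (y \<bullet> b)))"
    by (simp add: euclidean_inner[of x y] sum_distrib_left exp_sum)
  then show ?thesis by (simp add: gauss_eq_prod prod.distrib)
qed

lemma integrable_gauss_iexp_1: "integrable lborel (\<lambda>t::real. complex_of_real (exp (- t\<^sup>2 / 2)) * iexp (y * t))"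
  using integrable_iexp[of "\<lambda>t. complex_of_real (exp (- t\<^sup>2 / 2))" y] integrable_gauss_1 by simp

lemma integrable_gauss: "integrable lborel (\<lambda>x::'a::euclidean_space. gauss x)"
proof -
  have "integrable lborel (\<lambda>y::'a. complex_of_real (gauss y) * iexp (0 \<bullet> y))"
    unfolding gauss_iexp_eq_prod by (intro lborel_integral_prod integrable_gauss_iexp_1)
  then have "integrable lborel (\<lambda>y::'a. Re (complex_of_real (gauss y)))"
    by (intro integrable_Re) simp
  then show ?thesis by simp
qed

lemma ft_gauss: "ft (\<lambda>x::'a::euclidean_space. complex_of_real (gauss x)) x = sqrt (2 * pi) ^ DIM('a) * gauss x"
proof -
  have "ft (\<lambda>x::'a. complex_of_real (gauss x)) x
    = (\<Prod>b\<in>Basis. CLINT t|lborel. complex_of_real (exp (- t\<^sup>2 / 2)) * iexp ((x \<bullet> b) * t))"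
    unfolding ft_def gauss_iexp_eq_prod by (intro lborel_integral_prod integrable_gauss_iexp_1)
  also have "\<dots> = (\<Prod>b\<in>Basis. complex_of_real (sqrt (2 * pi)) * exp (- (x \<bullet> b)\<^sup>2 / 2))"
    by (simp only: ft_gauss_1)
  finally show ?thesis by (simp add: gauss_eq_prod prod.distrib)
qed

lemma cnj_measurable [measurable]: "cnj \<in> borel_measurable borel"
  by (intro borel_measurable_continuous_onI continuous_intros)

lemma ft_measurable:
  assumes [measurable]: "f \<in> borel_measurable borel"
  shows "ft f \<in> borel_measurable borel"
proof -
  have "(\<lambda>(x, y). f y * iexp (x \<bullet> y)) \<in> borel_measurable (borel \<Otimes>\<^sub>M lborel)" by measurable
  then show ?thesis unfolding ft_def[abs_def]
    by (intro sigma_finite_measure.borel_measurable_lebesgue_integral sigma_finite_lborel)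
qed

lemma norm_ft_le: "norm (ft f x) \<le> (LINT y|lborel. norm (f y))"
proof -
  have "norm (ft f x) \<le> (LINT y|lborel. norm (f y * iexp (x \<bullet> y)))"
    unfolding ft_def by (rule integral_norm_bound)
  then show ?thesis by (simp add: norm_mult)
qed

text \<open>Both sides are iterated integrals of f(x) g(y) e^(i x.y), whose kernel is symmetric and
  whose modulus is integrable on the product space.\<close>

lemma ft_multiplication_formula:
  fixes f g :: "'a::euclidean_space \<Rightarrow> complex"
  assumes f: "integrable lborel f" and g: "integrable lborel g"
  shows "(LINT x|lborel. f x * ft g x) = (LINT x|lborel. g x * ft f x)"
proof -
  have [measurable]: "f \<in> borel_measurable borel" "g \<in> borel_measurable borel" using f g by auto
  have "integrable (lborel \<Otimes>\<^sub>M lborel) (\<lambda>(x, y). f x * (g y * iexp (x \<bullet> y)))"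
  proof (rule lborel_pair.Fubini_integrable)
    show "(\<lambda>(x, y). f x * (g y * iexp (x \<bullet> y))) \<in> borel_measurable (lborel \<Otimes>\<^sub>M lborel)" by measurable
    have "(\<lambda>x. LINT y|lborel. norm (case (x, y) of (x, y) \<Rightarrow> f x * (g y * iexp (x \<bullet> y))))
      = (\<lambda>x. norm (f x) * (LINT y|lborel. norm (g y)))"
      by (simp add: norm_mult)
    then show "integrable lborel (\<lambda>x. LINT y|lborel. norm (case (x, y) of (x, y) \<Rightarrow> f x * (g y * iexp (x \<bullet> y))))"
      using f by simp
    show "AE x in lborel. integrable lborel (\<lambda>y. case (x, y) of (x, y) \<Rightarrow> f x * (g y * iexp (x \<bullet> y)))"
      using integrable_iexp[OF g] by (intro AE_I2) simp
  qed
  then have "(LINT y|lborel. LINT x|lborel. f x * (g y * iexp (x \<bullet> y)))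
    = (LINT x|lborel. LINT y|lborel. f x * (g y * iexp (x \<bullet> y)))"
    by (intro lborel_pair.Fubini_integral) simp
  moreover have "(LINT x|lborel. f x * (g y * iexp (x \<bullet> y))) = g y * ft f y" for y
    unfolding ft_def by (subst integral_mult_right_zero[symmetric]) (simp add: mult_ac inner_commute)
  moreover have "(LINT y|lborel. f x * (g y * iexp (x \<bullet> y))) = f x * ft g x" for x
    unfolding ft_def by (rule integral_mult_right_zero)
  ultimately show ?thesis by (simp only:)
qed

lemma integrable_gauss_scaled:
  assumes "e \<noteq> 0"
  shows "integrable lborel (\<lambda>x::'a::euclidean_space. complex_of_real (gauss (e *\<^sub>R x)))"
proof -
  have "ennreal (\<bar>e\<bar> ^ DIM('a)) * (\<integral>\<^sup>+x. ennreal (gauss (0 + e *\<^sub>R x)) \<partial>(lborel :: 'a measure))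
      = (\<integral>\<^sup>+x. ennreal (gauss x) \<partial>(lborel :: 'a measure))"
    using assms by (intro nn_integral_lborel_affine[symmetric]) auto
  also have "\<dots> < \<infinity>" using integrable_gauss[where 'a='a] by (simp add: integrable_iff_bounded)
  finally have "(\<integral>\<^sup>+x. ennreal (gauss (e *\<^sub>R x)) \<partial>(lborel :: 'a measure)) < \<infinity>"
    using assms by (auto simp: ennreal_mult_less_top)
  then show ?thesis by (intro integrableI_bounded) auto
qed

text \<open>Evaluating at \<open>e *\<^sub>R w\<close> prepares for the substitution in the next
  lemma, whose Jacobian e^n cancels the denominator.\<close>

lemma ft_gauss_scaled:
  assumes e: "e > 0"
  shows "ft (\<lambda>x::'a::euclidean_space. complex_of_real (gauss (e *\<^sub>R x))) (e *\<^sub>R w)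
    = complex_of_real (sqrt (2 * pi) ^ DIM('a) * gauss w / e ^ DIM('a))"
proof -
  have "ft (\<lambda>x::'a. complex_of_real (gauss (e *\<^sub>R x))) (e *\<^sub>R w)
    = (\<bar>1 / e\<bar> ^ DIM('a)) *\<^sub>R (LINT x|lborel. complex_of_real (gauss (e *\<^sub>R (0 + (1 / e) *\<^sub>R x)))
         * iexp ((e *\<^sub>R w) \<bullet> (0 + (1 / e) *\<^sub>R x)))"
    unfolding ft_def using e by (intro integral_lborel_affine) auto
  also have "(LINT x|lborel. complex_of_real (gauss (e *\<^sub>R (0 + (1 / e) *\<^sub>R x)))
         * iexp ((e *\<^sub>R w) \<bullet> (0 + (1 / e) *\<^sub>R x))) = ft (\<lambda>x. complex_of_real (gauss x)) w"
    unfolding ft_def using e by simp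
  finally show ?thesis using e by (simp add: ft_gauss scaleR_conv_of_real power_divide)
qed

text \<open>The square is split as \<open>cnj (ft F x) * ft F x\<close>. The multiplication formula
  first moves one transform onto the weight times the conjugate, integrable because of the weight,
  and is then applied again inside. What remains is the transform of the weight, a Gaussian of width
  e, averaging \<open>cnj F\<close> around \<xi>.\<close>

lemma gaussian_weighted_ft_energy:
  fixes F :: "'a::euclidean_space \<Rightarrow> complex"
  assumes F: "integrable lborel F" and e: "e > 0"
  shows "(CLINT x|lborel. gauss (e *\<^sub>R x) * (cmod (ft F x))\<^sup>2)
    = (CLINT \<xi>|lborel. F \<xi> * (CLINT w|lborel. complex_of_real (sqrt (2 * pi) ^ DIM('a)) * complex_of_real (gauss w) * cnj (F (\<xi> - e *\<^sub>R w))))"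
proof -
  have [measurable]: "F \<in> borel_measurable borel" using F by auto
  note [measurable] = ft_measurable[OF this]
  define g :: "'a \<Rightarrow> complex" where "g x = complex_of_real (gauss (e *\<^sub>R x))" for x
  have g: "integrable lborel g" unfolding g_def[abs_def] using e by (intro integrable_gauss_scaled) auto
  have gm [measurable]: "g \<in> borel_measurable borel" using g by auto
  define B where "B = (LINT y|lborel. norm (F y))"
  \<comment> \<open>The transform of F' is the conjugate of \<open>ft F\<close>, which makes the
    second application of the multiplication formula possible.\<close>
  define F' where "F' \<eta> = cnj (F (- \<eta>))" for \<eta>
  have F'm [measurable]: "F' \<in> borel_measurable borel" unfolding F'_def by measurable
  have F': "integrable lborel F'"
  proof (rule integrableI_bounded)
    have "(\<integral>\<^sup>+x. ennreal (norm (F x)) \<partial>lborel) = (\<integral>\<^sup>+x. ennreal (norm (F' x)) \<partial>lborel)"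
      using nn_integral_lborel_affine[of "\<lambda>x. ennreal (norm (F x))" "-1" 0] by (simp add: F'_def)
    then show "(\<integral>\<^sup>+x. ennreal (norm (F' x)) \<partial>lborel) < \<infinity>" using F by (simp add: integrable_iff_bounded)
  qed simp
  have cnj_ft: "cnj (ft F x) = ft F' x" for x
  proof -
    have "cnj (ft F x) = (LINT y|lborel. cnj (F y * iexp (x \<bullet> y)))"
      unfolding ft_def by (rule Bochner_Integration.integral_cnj[symmetric])
    also have "\<dots> = (\<bar>-1\<bar> ^ DIM('a)) *\<^sub>R (LINT y|lborel. cnj (F (0 + (-1) *\<^sub>R y) * iexp (x \<bullet> (0 + (-1) *\<^sub>R y))))"
      by (intro integral_lborel_affine) auto
    also have "\<dots> = ft F' x" unfolding ft_def by (simp add: F'_def exp_cnj)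
    finally show ?thesis .
  qed
  have int1: "integrable lborel (\<lambda>x. g x * cnj (ft F x))"
  proof (rule Bochner_Integration.integrable_bound)
    show "integrable lborel (\<lambda>x. complex_of_real B * g x)" using g by simp
    show "AE x in lborel. norm (g x * cnj (ft F x)) \<le> norm (complex_of_real B * g x)"
    proof (intro AE_I2)
      fix x
      have "norm (ft F x) \<le> \<bar>B\<bar>" using norm_ft_le[of F x] unfolding B_def by linarith
      then show "norm (g x * cnj (ft F x)) \<le> norm (complex_of_real B * g x)"
        by (simp add: norm_mult mult.commute[of "norm (g x)"] mult_right_mono)
    qed
  qed simp
  have "(CLINT x|lborel. gauss (e *\<^sub>R x) * (cmod (ft F x))\<^sup>2) = (LINT x|lborel. (g x * cnj (ft F x)) * ft F x)"
    by (intro Bochner_Integration.integral_cong refl)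
      (simp add: g_def complex_norm_square[symmetric] mult.assoc mult.commute[of "cnj _"] del: complex_norm_square)
  also have "\<dots> = (LINT \<xi>|lborel. F \<xi> * ft (\<lambda>x. g x * cnj (ft F x)) \<xi>)"
    by (rule ft_multiplication_formula[OF int1 F])
  also have "(\<lambda>\<xi>. ft (\<lambda>x. g x * cnj (ft F x)) \<xi>)
    = (\<lambda>\<xi>. CLINT w|lborel. complex_of_real (sqrt (2 * pi) ^ DIM('a)) * complex_of_real (gauss w) * cnj (F (\<xi> - e *\<^sub>R w)))"
  proof
    fix \<xi>
    have "ft (\<lambda>x. g x * cnj (ft F x)) \<xi> = (LINT x|lborel. (g x * iexp (\<xi> \<bullet> x)) * ft F' x)"
      unfolding cnj_ft unfolding ft_def[of "\<lambda>x. g x * ft F' x"] by (simp add: mult_ac)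
    also have "\<dots> = (LINT \<eta>|lborel. F' \<eta> * ft (\<lambda>x. g x * iexp (\<xi> \<bullet> x)) \<eta>)"
      by (rule ft_multiplication_formula[OF integrable_iexp[OF g] F'])
    also have "\<dots> = (LINT \<eta>|lborel. F' \<eta> * ft g (\<xi> + \<eta>))"
      unfolding ft_def by (simp add: mult.assoc exp_add[symmetric] distrib_left[symmetric] inner_add_left)
    \<comment> \<open>The substitution \<eta> = -\<xi> + e w recentres the narrow Gaussian and
      rescales it to a fixed one, so that e survives only in the argument of F.\<close>
    also have "\<dots> = (\<bar>e\<bar> ^ DIM('a)) *\<^sub>R (LINT w|lborel. F' (- \<xi> + e *\<^sub>R w) * ft g (\<xi> + (- \<xi> + e *\<^sub>R w)))"
      using e ft_measurable[OF gm] by (intro integral_lborel_affine) (measurable, auto)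
    also have "\<dots> = (LINT w|lborel. (\<bar>e\<bar> ^ DIM('a)) *\<^sub>R (F' (- \<xi> + e *\<^sub>R w) * ft g (\<xi> + (- \<xi> + e *\<^sub>R w))))"
      by (rule Bochner_Integration.integral_scaleR_right[symmetric])
    also have "\<dots> = (CLINT w|lborel. complex_of_real (sqrt (2 * pi) ^ DIM('a)) * complex_of_real (gauss w) * cnj (F (\<xi> - e *\<^sub>R w)))"
      using e unfolding g_def
      by (intro Bochner_Integration.integral_cong refl)
        (simp add: ft_gauss_scaled F'_def scaleR_conv_of_real)
    finally show "ft (\<lambda>x. g x * cnj (ft F x)) \<xi> = \<dots>" .
  qed
  finally show ?thesis .
qed

text \<open>The Gaussian weight makes Fubini applicable to the left-hand side. Continuity and boundedness
  of \<open>F\<close> let the weight be removed by dominated convergence, without density arguments in \<open>L\<^sup>2\<close>.\<close>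

theorem plancherel:
  fixes F :: "'a::euclidean_space \<Rightarrow> complex"
  assumes F: "integrable lborel F" and cont: "continuous_on UNIV F" and bdd: "\<And>x. norm (F x) \<le> B"
  shows "(\<integral>\<^sup>+x. ennreal ((cmod (ft F x))\<^sup>2) \<partial>lborel)
    = ennreal ((2 * pi) ^ DIM('a)) * (\<integral>\<^sup>+x. ennreal ((cmod (F x))\<^sup>2) \<partial>lborel)"
proof -
  have [measurable]: "F \<in> borel_measurable borel" using F by auto
  note [measurable] = ft_measurable[OF this]
  have B: "B \<ge> 0" using bdd[of 0] norm_ge_zero order_trans by blast
  define e where "e k = 1 / real (Suc k)" for k
  have e: "e k > 0" for k by (simp add: e_def)
  have e_lim: "e \<longlonglongrightarrow> 0" unfolding e_def using LIMSEQ_inverse_real_of_nat by (simp only: inverse_eq_divide)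
  let ?c = "complex_of_real (sqrt (2 * pi) ^ DIM('a))"
  define I where "I k \<xi> = (CLINT w|lborel. complex_of_real (sqrt (2 * pi) ^ DIM('a)) * complex_of_real (gauss w) * cnj (F (\<xi> - e k *\<^sub>R w)))" for k \<xi>
  have gauss_int: "(CLINT w|lborel. complex_of_real (gauss (w::'a))) = ?c"
    using ft_gauss[of "0::'a"] by (simp add: ft_def gauss_def)
  have dom: "integrable lborel (\<lambda>w::'a. sqrt (2 * pi) ^ DIM('a) * B * gauss w)"
    using integrable_gauss[where 'a='a] by simp
  have bnd: "norm (complex_of_real (sqrt (2 * pi) ^ DIM('a)) * complex_of_real (gauss w) * cnj (F z))
      \<le> sqrt (2 * pi) ^ DIM('a) * B * gauss w" for w z :: 'a
    using mult_left_mono[OF bdd[of z], of "sqrt (2 * pi) ^ DIM('a) * gauss w"]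
    by (simp add: norm_mult norm_power mult_ac)
  \<comment> \<open>I k averages \<open>cnj F\<close> around \<xi> at scale e k. Continuity of F
    gives the pointwise limit, boundedness the dominating multiple of the Gaussian.\<close>
  have I_lim: "(\<lambda>k. I k \<xi>) \<longlonglongrightarrow> ?c * ?c * cnj (F \<xi>)" for \<xi>
  proof -
    have "(\<lambda>k. I k \<xi>) \<longlonglongrightarrow> (CLINT w|lborel. ?c * complex_of_real (gauss (w::'a)) * cnj (F \<xi>))"
      unfolding I_def
    proof (rule integral_dominated_convergence[OF _ _ dom])
      show "AE w in lborel. (\<lambda>k. complex_of_real (sqrt (2 * pi) ^ DIM('a)) * complex_of_real (gauss w) * cnj (F (\<xi> - e k *\<^sub>R w)))
         \<longlonglongrightarrow> ?c * complex_of_real (gauss (w::'a)) * cnj (F \<xi>)"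
      proof (intro AE_I2)
        fix w :: 'a
        have "isCont F \<xi>" using cont by (simp add: continuous_on_eq_continuous_at)
        moreover have "(\<lambda>k. \<xi> - e k *\<^sub>R w) \<longlonglongrightarrow> \<xi> - 0 *\<^sub>R w" by (intro tendsto_intros e_lim)
        ultimately have "(\<lambda>k. F (\<xi> - e k *\<^sub>R w)) \<longlonglongrightarrow> F \<xi>" by (intro isCont_tendsto_compose[of \<xi> F]) auto
        then show "(\<lambda>k. complex_of_real (sqrt (2 * pi) ^ DIM('a)) * complex_of_real (gauss w) * cnj (F (\<xi> - e k *\<^sub>R w)))
         \<longlonglongrightarrow> ?c * complex_of_real (gauss w) * cnj (F \<xi>)"
          by (intro tendsto_intros)
      qed
    qed (use bnd in auto)
    also have "(CLINT w|lborel. ?c * complex_of_real (gauss (w::'a)) * cnj (F \<xi>)) = ?c * ?c * cnj (F \<xi>)"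
      by (simp add: gauss_int[simplified])
    finally show ?thesis .
  qed
  have I_bnd: "norm (I k \<xi>) \<le> (sqrt (2 * pi) ^ DIM('a))\<^sup>2 * B" for k \<xi>
  proof -
    have "norm (I k \<xi>) \<le> (LINT w|lborel. norm (complex_of_real (sqrt (2 * pi) ^ DIM('a)) * complex_of_real (gauss w) * cnj (F (\<xi> - e k *\<^sub>R w))))"
      unfolding I_def by (rule order_trans[OF integral_norm_bound]) simp
    also have "\<dots> \<le> (LINT w|lborel. sqrt (2 * pi) ^ DIM('a) * B * gauss (w::'a))"
      by (intro Bochner_Integration.integral_mono Bochner_Integration.integrable_bound[OF dom] dom)
         (use bnd B in \<open>auto intro!: AE_I2\<close>)
    also have "\<dots> = sqrt (2 * pi) ^ DIM('a) * B * sqrt (2 * pi) ^ DIM('a)"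
    proof -
      have "complex_of_real (LINT w|lborel. gauss (w::'a)) = complex_of_real (sqrt (2 * pi) ^ DIM('a))"
        using gauss_int by (simp only: integral_complex_of_real)
      then show ?thesis by (simp only: of_real_eq_iff integral_mult_right_zero)
    qed
    finally show ?thesis by (simp add: power2_eq_square mult_ac)
  qed
  have I_meas [measurable]: "I k \<in> borel_measurable borel" for k
  proof -
    have "(\<lambda>(\<xi>, w). complex_of_real (sqrt (2 * pi) ^ DIM('a)) * gauss w * cnj (F (\<xi> - e k *\<^sub>R w))) \<in> borel_measurable (borel \<Otimes>\<^sub>M lborel)"
      by measurable
    then show ?thesis unfolding I_def[abs_def]
      by (intro sigma_finite_measure.borel_measurable_lebesgue_integral sigma_finite_lborel) simp
  qed
  have J_lim: "(\<lambda>k. CLINT \<xi>|lborel. F \<xi> * I k \<xi>) \<longlonglongrightarrow> (CLINT \<xi>|lborel. F \<xi> * (?c * ?c * cnj (F \<xi>)))"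
  proof (rule integral_dominated_convergence)
    show "integrable lborel (\<lambda>\<xi>. norm (F \<xi>) * ((sqrt (2 * pi) ^ DIM('a))\<^sup>2 * B))" using F by simp
    show "AE \<xi> in lborel. norm (F \<xi> * I k \<xi>) \<le> norm (F \<xi>) * ((sqrt (2 * pi) ^ DIM('a))\<^sup>2 * B)" for k
      using I_bnd by (auto simp: norm_mult intro!: AE_I2 mult_left_mono)
    show "AE \<xi> in lborel. (\<lambda>k. F \<xi> * I k \<xi>) \<longlonglongrightarrow> F \<xi> * (?c * ?c * cnj (F \<xi>))"
      by (intro AE_I2 tendsto_intros I_lim)
  qed auto
  define S where "S = (LINT \<xi>|lborel. (2 * pi) ^ DIM('a) * (cmod (F \<xi>))\<^sup>2)"
  \<comment> \<open>One factor \<open>sqrt (2 * pi) ^ DIM('a)\<close> is the constant in the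
    transform of the Gaussian, the other the mass of the Gaussian.\<close>
  have cc: "?c * ?c = complex_of_real ((2 * pi) ^ DIM('a))"
    by (simp only: of_real_mult[symmetric] power_mult_distrib[symmetric] real_sqrt_mult_self) simp
  have "(CLINT \<xi>|lborel. F \<xi> * (?c * ?c * cnj (F \<xi>))) = (CLINT \<xi>|lborel. complex_of_real ((2 * pi) ^ DIM('a) * (cmod (F \<xi>))\<^sup>2))"
    unfolding cc by (intro Bochner_Integration.integral_cong refl) (simp add: complex_norm_square mult_ac del: of_real_power)
  then have S_eq: "(CLINT \<xi>|lborel. F \<xi> * (?c * ?c * cnj (F \<xi>))) = complex_of_real S"
    unfolding S_def by (simp only: integral_complex_of_real)
  define R where "R k = (LINT x|lborel. gauss (e k *\<^sub>R x) * (cmod (ft F x))\<^sup>2)" for k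
  have "complex_of_real (R k) = (CLINT \<xi>|lborel. F \<xi> * I k \<xi>)" for k
    unfolding R_def I_def gaussian_weighted_ft_energy[OF F e, symmetric]
    by (simp only: integral_complex_of_real[symmetric])
  with J_lim S_eq have "(\<lambda>k. complex_of_real (R k)) \<longlonglongrightarrow> complex_of_real S" by simp
  then have R_lim: "R \<longlonglongrightarrow> S" by (simp only: tendsto_of_real_iff)
  have R_nn: "(\<integral>\<^sup>+x. ennreal (gauss (e k *\<^sub>R x) * (cmod (ft F x))\<^sup>2) \<partial>lborel) = ennreal (R k)" for k
    unfolding R_def
  proof (rule nn_integral_eq_integral)
    define D where "D = (LINT y|lborel. norm (F y))"
    show "integrable lborel (\<lambda>x. gauss (e k *\<^sub>R x) * (cmod (ft F x))\<^sup>2)"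
    proof (rule Bochner_Integration.integrable_bound)
      show "integrable lborel (\<lambda>x. D\<^sup>2 *\<^sub>R complex_of_real (gauss (e k *\<^sub>R x :: 'a)))"
        using integrable_gauss_scaled[of "e k", where 'a='a] e[of k] by (intro integrable_scaleR_right) auto
      show "AE x in lborel. norm (gauss (e k *\<^sub>R x) * (cmod (ft F x))\<^sup>2) \<le> norm (D\<^sup>2 *\<^sub>R complex_of_real (gauss (e k *\<^sub>R x)))"
      proof (intro AE_I2)
        fix x
        have "(cmod (ft F x))\<^sup>2 \<le> D\<^sup>2" unfolding D_def by (intro power_mono norm_ft_le) auto
        then show "norm (gauss (e k *\<^sub>R x) * (cmod (ft F x))\<^sup>2) \<le> norm (D\<^sup>2 *\<^sub>R complex_of_real (gauss (e k *\<^sub>R x)))"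
          by (simp add: abs_mult mult.commute[of "gauss _"] mult_right_mono)
      qed
    qed simp
  qed (simp add: AE_I2)
  have mono: "gauss (e k *\<^sub>R x) \<le> gauss (e (Suc k) *\<^sub>R x)" for k and x :: 'a
  proof -
    have "norm (e (Suc k) *\<^sub>R x) \<le> norm (e k *\<^sub>R x)"
      by (simp add: e_def) (intro mult_right_mono divide_left_mono; simp)
    then have "(norm (e (Suc k) *\<^sub>R x))\<^sup>2 \<le> (norm (e k *\<^sub>R x))\<^sup>2" by (intro power_mono) auto
    then show ?thesis by (simp add: gauss_def)
  qed
  \<comment> \<open>On this side the convergence is monotone, so square integrability of
    \<open>ft F\<close> is a conclusion and not an assumption.\<close>
  have "(\<lambda>k. \<integral>\<^sup>+x. ennreal (gauss (e k *\<^sub>R x) * (cmod (ft F x))\<^sup>2) \<partial>lborel) \<longlonglongrightarrow> (\<integral>\<^sup>+x. ennreal ((cmod (ft F x))\<^sup>2) \<partial>lborel)"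
  proof (rule nn_integral_LIMSEQ)
    show "incseq (\<lambda>k x. ennreal (gauss (e k *\<^sub>R x) * (cmod (ft F x))\<^sup>2))"
      by (intro incseq_SucI le_funI ennreal_leI mult_right_mono mono) auto
    fix x :: 'a
    have "(\<lambda>k. gauss (e k *\<^sub>R x) * (cmod (ft F x))\<^sup>2) \<longlonglongrightarrow> gauss (0 *\<^sub>R x) * (cmod (ft F x))\<^sup>2"
      by (intro tendsto_intros continuous_on_tendsto_compose[OF gauss_continuous[of UNIV]] e_lim) auto
    then show "(\<lambda>k. ennreal (gauss (e k *\<^sub>R x) * (cmod (ft F x))\<^sup>2)) \<longlonglongrightarrow> ennreal ((cmod (ft F x))\<^sup>2)"
      by (intro tendsto_ennrealI) (simp add: gauss_def)
  qed simp
  then have "(\<lambda>k. ennreal (R k)) \<longlonglongrightarrow> (\<integral>\<^sup>+x. ennreal ((cmod (ft F x))\<^sup>2) \<partial>lborel)" by (simp only: R_nn)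
  moreover have "(\<lambda>k. ennreal (R k)) \<longlonglongrightarrow> ennreal S" by (intro tendsto_ennrealI R_lim)
  ultimately have "(\<integral>\<^sup>+x. ennreal ((cmod (ft F x))\<^sup>2) \<partial>lborel) = ennreal S" by (rule LIMSEQ_unique)
  also have "ennreal S = (\<integral>\<^sup>+x. ennreal ((2 * pi) ^ DIM('a) * (cmod (F x))\<^sup>2) \<partial>lborel)"
    unfolding S_def
  proof (rule nn_integral_eq_integral[symmetric])
    show "integrable lborel (\<lambda>x. (2 * pi) ^ DIM('a) * (cmod (F x))\<^sup>2)"
    proof (rule Bochner_Integration.integrable_bound)
      show "integrable lborel (\<lambda>x. ((2 * pi) ^ DIM('a) * B) *\<^sub>R F x)" using F by simp
      show "AE x in lborel. norm ((2 * pi) ^ DIM('a) * (cmod (F x))\<^sup>2) \<le> norm (((2 * pi) ^ DIM('a) * B) *\<^sub>R F x)"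
        using bdd B by (auto simp: norm_mult abs_mult power2_eq_square mult.assoc intro!: AE_I2 mult_left_mono mult_right_mono)
    qed simp
  qed (auto intro!: AE_I2)
  also have "\<dots> = ennreal ((2 * pi) ^ DIM('a)) * (\<integral>\<^sup>+x. ennreal ((cmod (F x))\<^sup>2) \<partial>lborel)"
    by (simp add: ennreal_mult nn_integral_cmult)
  finally show ?thesis .
qed

section \<open>The norm of the completion\<close>

lemma test_function_differentiable:
  assumes "\<phi> \<in> test_functions" shows "\<phi> differentiable (at x)"
  using assms unfolding test_functions_def smooth_def by (auto dest!: spec[of _ "[]"])

lemma test_function_continuous:
  assumes "\<phi> \<in> test_functions" shows "continuous_on A \<phi>"
  using test_function_differentiable[OF assms]
  by (intro continuous_at_imp_continuous_on) (auto intro: differentiable_imp_continuous_within)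

lemma test_function_measurable:
  assumes "\<phi> \<in> test_functions" shows "\<phi> \<in> borel_measurable borel"
  by (intro borel_measurable_continuous_onI test_function_continuous[OF assms])

lemma test_function_support:
  assumes "\<phi> \<in> test_functions"
  obtains R where "R > 0" "\<And>x. norm x \<ge> R \<Longrightarrow> \<phi> x = 0"
proof -
  have "bounded (closure {x. \<phi> x \<noteq> 0})" using assms by (simp add: test_functions_def compact_imp_bounded)
  then obtain R where R: "R > 0" "\<And>x. x \<in> closure {x. \<phi> x \<noteq> 0} \<Longrightarrow> norm x < R"
    by (auto simp: bounded_pos_less)
  have "\<phi> x = 0" if "norm x \<ge> R" for x
    using R(2)[of x] closure_subset[of "{x. \<phi> x \<noteq> 0}"] that by fastforce
  with R that show ?thesis by blast
qed

lemma test_function_bounded: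
  assumes "\<phi> \<in> test_functions"
  obtains B where "B \<ge> 0" "\<And>x. \<bar>\<phi> x\<bar> \<le> B"
proof -
  obtain R where R: "R > 0" "\<And>x. norm x \<ge> R \<Longrightarrow> \<phi> x = 0" using test_function_support[OF assms] by blast
  have "compact (\<phi> ` cball 0 R)" by (intro compact_continuous_image test_function_continuous[OF assms] compact_cball)
  then obtain B where B: "B > 0" "\<And>x. norm x \<le> R \<Longrightarrow> \<bar>\<phi> x\<bar> \<le> B"
    by (auto dest!: compact_imp_bounded simp: bounded_pos)
  have "\<bar>\<phi> x\<bar> \<le> B" for x using B R by (cases "norm x \<le> R") auto
  with B that show ?thesis by (meson less_imp_le)
qed

lemma integrable_indicator_ball: "integrable lborel (\<lambda>x::'a::euclidean_space. c * indicator (ball 0 R) x :: real)"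
  using emeasure_bounded_finite[of "ball (0::'a) R"]
  by (intro integrable_mult_right integrable_real_indicator) auto

lemma test_function_integrable:
  assumes "\<phi> \<in> test_functions" shows "integrable lborel \<phi>"
proof -
  obtain R where R: "R > 0" "\<And>x. norm x \<ge> R \<Longrightarrow> \<phi> x = 0" using test_function_support[OF assms] by blast
  obtain B where B: "B \<ge> 0" "\<And>x. \<bar>\<phi> x\<bar> \<le> B" using test_function_bounded[OF assms] by blast
  show ?thesis
  proof (rule Bochner_Integration.integrable_bound[OF integrable_indicator_ball[of B R]])
    show "AE x in lborel. norm (\<phi> x) \<le> norm (B * indicator (ball 0 R) x :: real)"
      using R B by (intro AE_I2) (auto simp: indicator_def)
  qed (use test_function_measurable[OF assms] in simp)
qed

lemma test_function_translate_integrable: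
  fixes \<phi> :: "real ^ 'n::finite \<Rightarrow> real"
  assumes \<phi>: "\<phi> \<in> test_functions"
  shows "integrable lborel (\<lambda>y. complex_of_real (\<phi> (y + h)))"
proof -
  note [measurable] = test_function_measurable[OF \<phi>]
  have "integrable lborel (\<lambda>y. complex_of_real (\<phi> y))" using test_function_integrable[OF \<phi>] by simp
  then show ?thesis
    by (subst (asm) lborel_distr_plus[of h, symmetric]) (simp add: integrable_distr_eq add.commute)
qed

lemma partial_deriv_test_function:
  assumes "\<phi> \<in> test_functions" shows "partial_deriv i \<phi> \<in> test_functions"
proof -
  \<comment> \<open>\<open>foldr\<close> applies the last index of the list first, so an initial
    derivative in direction i is appended at the end.\<close>
  have "foldr partial_deriv is (partial_deriv i \<phi>) differentiable (at x)" for "is" x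
    using assms unfolding test_functions_def smooth_def by (auto dest!: spec[of _ "is @ [i]"])
  then have "smooth (partial_deriv i \<phi>)" by (simp add: smooth_def)
  moreover have "{x. partial_deriv i \<phi> x \<noteq> 0} \<subseteq> closure {x. \<phi> x \<noteq> 0}"
  proof safe
    fix x assume nz: "partial_deriv i \<phi> x \<noteq> 0"
    show "x \<in> closure {x. \<phi> x \<noteq> 0}"
    proof (rule ccontr)
      assume x: "x \<notin> closure {x. \<phi> x \<noteq> 0}"
      have "(\<phi> has_derivative (\<lambda>_. 0)) (at x)"
      proof (rule has_derivative_transform_within_open)
        show "((\<lambda>_. 0) has_derivative (\<lambda>_. 0)) (at x)" by (rule has_derivative_const)
        show "open (- closure {x. \<phi> x \<noteq> 0})" by (intro open_Compl closed_closure)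
        show "x \<in> - closure {x. \<phi> x \<noteq> 0}" using x by simp
        show "0 = \<phi> y" if "y \<in> - closure {x. \<phi> x \<noteq> 0}" for y
          using that closure_subset[of "{x. \<phi> x \<noteq> 0}"] by auto
      qed
      then have "frechet_derivative \<phi> (at x) = (\<lambda>_. 0)" by (rule frechet_derivative_at[symmetric])
      with nz show False by (simp add: partial_deriv_def)
    qed
  qed
  then have "closure {x. partial_deriv i \<phi> x \<noteq> 0} \<subseteq> closure {x. \<phi> x \<noteq> 0}"
    by (rule closure_minimal) simp
  then have "compact (closure {x. partial_deriv i \<phi> x \<noteq> 0})"
    using assms compact_Int_closed[of "closure {x. \<phi> x \<noteq> 0}" "closure {x. partial_deriv i \<phi> x \<noteq> 0}"]
    by (simp add: test_functions_def Int_absorb1)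
  ultimately show ?thesis by (simp add: test_functions_def)
qed

lemma partial_deriv_has_derivative:
  assumes "\<phi> \<in> test_functions"
  shows "((\<lambda>t. \<phi> (y + t *\<^sub>R axis i 1)) has_field_derivative partial_deriv i \<phi> (y + t *\<^sub>R axis i 1)) (at t)"
proof -
  let ?D = "frechet_derivative \<phi> (at (y + t *\<^sub>R axis i 1))"
  have D: "(\<phi> has_derivative ?D) (at (y + t *\<^sub>R axis i 1))"
    using test_function_differentiable[OF assms] by (simp add: frechet_derivative_works)
  have "((\<lambda>t. y + t *\<^sub>R axis i 1) has_derivative (\<lambda>h. h *\<^sub>R axis i 1)) (at t)"
    by (auto intro!: derivative_eq_intros)
  then have "((\<lambda>t. \<phi> (y + t *\<^sub>R axis i 1)) has_derivative (\<lambda>h. ?D (h *\<^sub>R axis i 1))) (at t)"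
    by (rule has_derivative_compose) (rule D)
  moreover have "?D (h *\<^sub>R axis i 1) = h * partial_deriv i \<phi> (y + t *\<^sub>R axis i 1)" for h
    using has_derivative_linear[OF D] by (simp add: linear_cmul partial_deriv_def)
  moreover have "(\<lambda>h. h * c) = (*) c" for c :: real by (simp add: fun_eq_iff)
  ultimately show ?thesis by (simp add: has_field_derivative_def)
qed

lemma ft_translate:
  fixes f :: "'a::euclidean_space \<Rightarrow> complex"
  assumes [measurable]: "f \<in> borel_measurable borel"
  shows "ft (\<lambda>y. f (y + h)) x = iexp (- (x \<bullet> h)) * ft f x"
proof -
  have "ft f x = (\<bar>1\<bar> ^ DIM('a)) *\<^sub>R (LINT y|lborel. f (h + 1 *\<^sub>R y) * iexp (x \<bullet> (h + 1 *\<^sub>R y)))"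
    unfolding ft_def by (intro integral_lborel_affine) auto
  also have "\<dots> = iexp (x \<bullet> h) * ft (\<lambda>y. f (y + h)) x"
    unfolding ft_def
    by (subst integral_mult_right_zero[symmetric])
       (simp add: inner_add_right exp_add distrib_left add.commute mult_ac)
  finally show ?thesis by (simp add: mult.assoc[symmetric] exp_add[symmetric])
qed

text \<open>Difference quotients along \<open>axis i 1\<close> transform exactly, which replaces integration by parts.\<close>

lemma ft_partial_deriv:
  assumes \<phi>: "\<phi> \<in> test_functions"
  shows "ft (\<lambda>y. complex_of_real (partial_deriv i \<phi> y)) x = - \<i> * complex_of_real (x $ i) * ft (\<lambda>y. complex_of_real (\<phi> y)) x"
proof -
  note [measurable] = test_function_measurable[OF \<phi>] test_function_measurable[OF partial_deriv_test_function[OF \<phi>]]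
  obtain R where R: "R > 0" "\<And>x. norm x \<ge> R \<Longrightarrow> \<phi> x = 0" using test_function_support[OF \<phi>] by blast
  obtain B where B: "B \<ge> 0" "\<And>x. \<bar>partial_deriv i \<phi> x\<bar> \<le> B"
    using test_function_bounded[OF partial_deriv_test_function[OF \<phi>]] by blast
  define e where "e k = 1 / real (Suc k)" for k
  have e: "e k > 0" "e k \<le> 1" for k by (simp_all add: e_def)
  have e_lim: "e \<longlonglongrightarrow> 0" unfolding e_def using LIMSEQ_inverse_real_of_nat by (simp only: inverse_eq_divide)
  define D where "D k y = (\<phi> (y + e k *\<^sub>R axis i 1) - \<phi> y) / e k" for k y
  \<comment> \<open>The mean value inequality bounds the quotients by B, and e k \<le> 1 keeps their
    supports in the ball of radius R + 1. Together these give one dominating function for all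
    k.\<close>
  have D_bd: "\<bar>D k y\<bar> \<le> B" for k y
  proof -
    have "norm (\<phi> (y + e k *\<^sub>R axis i 1) - \<phi> (y + 0 *\<^sub>R axis i 1)) \<le> B * norm (e k - 0)"
      by (rule field_differentiable_bound[of UNIV "\<lambda>t. \<phi> (y + t *\<^sub>R axis i 1)"])
         (use B partial_deriv_has_derivative[OF \<phi>] in auto)
    then show ?thesis using e[of k] by (simp add: D_def field_simps)
  qed
  have D_supp: "D k y = 0" if "norm y \<ge> R + 1" for k y
  proof -
    have "norm (e k *\<^sub>R axis i 1 :: real ^ 'a) \<le> 1" using e[of k] by (simp add: norm_axis_1)
    then have "norm (y + e k *\<^sub>R axis i 1) \<ge> R" using that norm_diff_ineq[of y "e k *\<^sub>R axis i 1"] by linarith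
    with R(2)[of y] R(2)[of "y + e k *\<^sub>R axis i 1"] that show ?thesis by (simp add: D_def)
  qed
  have D_le: "\<bar>D k y\<bar> \<le> B * indicator (ball 0 (R + 1)) y" for k y
    using D_bd[of k y] D_supp[of y k] by (auto simp: indicator_def)
  have D_lim: "(\<lambda>k. D k y) \<longlonglongrightarrow> partial_deriv i \<phi> y" for y
  proof -
    have "((\<lambda>t. (\<phi> (y + t *\<^sub>R axis i 1) - \<phi> (y + 0 *\<^sub>R axis i 1)) / (t - 0)) \<longlongrightarrow> partial_deriv i \<phi> (y + 0 *\<^sub>R axis i 1)) (at 0)"
      using partial_deriv_has_derivative[OF \<phi>, of y i 0] unfolding has_field_derivative_iff by simp
    moreover have "filterlim e (at 0) sequentially" using e_lim e by (simp add: filterlim_at less_imp_neq[symmetric])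
    ultimately have "(\<lambda>k. (\<phi> (y + e k *\<^sub>R axis i 1) - \<phi> (y + 0 *\<^sub>R axis i 1)) / (e k - 0)) \<longlonglongrightarrow> partial_deriv i \<phi> (y + 0 *\<^sub>R axis i 1)"
      by (rule filterlim_compose)
    then show ?thesis by (simp add: D_def)
  qed
  have "(\<lambda>k. ft (\<lambda>y. complex_of_real (D k y)) x) \<longlonglongrightarrow> ft (\<lambda>y. complex_of_real (partial_deriv i \<phi> y)) x"
    unfolding ft_def
  proof (rule integral_dominated_convergence[OF _ _ integrable_indicator_ball[of B "R + 1"]])
    show "AE y in lborel. (\<lambda>k. complex_of_real (D k y) * iexp (x \<bullet> y)) \<longlonglongrightarrow> complex_of_real (partial_deriv i \<phi> y) * iexp (x \<bullet> y)"
      by (intro AE_I2 tendsto_intros D_lim)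
    show "AE y in lborel. norm (complex_of_real (D k y) * iexp (x \<bullet> y)) \<le> B * indicator (ball 0 (R + 1)) y" for k
      using D_le by (intro AE_I2) (simp add: norm_mult)
  qed (simp_all add: D_def)
  moreover have "ft (\<lambda>y. complex_of_real (D k y)) x
      = (iexp (- (x $ i) * e k) - 1) / e k * ft (\<lambda>y. complex_of_real (\<phi> y)) x" for k
  proof -
    let ?f = "\<lambda>y. complex_of_real (\<phi> y)"
    have int: "integrable lborel ?f" using test_function_integrable[OF \<phi>] by simp
    have "integrable lborel (\<lambda>y. ?f (y + e k *\<^sub>R axis i 1))"
      by (rule test_function_translate_integrable[OF \<phi>])
    then have "ft (\<lambda>y. ?f (y + e k *\<^sub>R axis i 1)) x - ft ?f x
        = (LINT y|lborel. ?f (y + e k *\<^sub>R axis i 1) * iexp (x \<bullet> y) - ?f y * iexp (x \<bullet> y))"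
      unfolding ft_def by (intro Bochner_Integration.integral_diff[symmetric] integrable_iexp int)
    also have "\<dots> = (LINT y|lborel. complex_of_real (e k) * (complex_of_real (D k y) * iexp (x \<bullet> y)))"
      using e(1)[of k] by (intro Bochner_Integration.integral_cong refl) (simp add: D_def field_simps)
    also have "\<dots> = e k * ft (\<lambda>y. complex_of_real (D k y)) x"
      unfolding ft_def by (rule integral_mult_right_zero)
    finally have "e k * ft (\<lambda>y. complex_of_real (D k y)) x = (iexp (- (x $ i) * e k) - 1) * ft ?f x"
      by (subst (asm) ft_translate) (simp_all add: inner_axis algebra_simps)
    then show ?thesis using e(1)[of k] by (simp add: field_simps)
  qed
  \<comment> \<open>The factors are difference quotients at 0 of z \<mapsto> exp (-i x_i z), so they
    tend to its derivative.\<close>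
  moreover have "(\<lambda>k. (iexp (- (x $ i) * e k) - 1) / e k * ft (\<lambda>y. complex_of_real (\<phi> y)) x)
     \<longlonglongrightarrow> - \<i> * complex_of_real (x $ i) * ft (\<lambda>y. complex_of_real (\<phi> y)) x"
  proof (rule tendsto_mult_right)
    let ?c = "- \<i> * complex_of_real (x $ i)"
    have "((\<lambda>z. exp (?c * z)) has_field_derivative ?c) (at 0)"
      by (auto intro!: derivative_eq_intros)
    then have "((\<lambda>z. (exp (?c * z) - 1) / z) \<longlongrightarrow> ?c) (at 0)"
      unfolding has_field_derivative_iff by simp
    moreover have "filterlim (\<lambda>k. complex_of_real (e k)) (at 0) sequentially"
      using e_lim e tendsto_of_real[OF e_lim, where 'a=complex] by (simp add: filterlim_at less_imp_neq[symmetric])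
    ultimately have "(\<lambda>k. (exp (?c * complex_of_real (e k)) - 1) / complex_of_real (e k)) \<longlonglongrightarrow> ?c"
      by (rule filterlim_compose)
    then show "(\<lambda>k. (iexp (- (x $ i) * e k) - 1) / e k) \<longlonglongrightarrow> ?c" by (simp add: mult.assoc)
  qed
  ultimately show ?thesis by (simp add: LIMSEQ_unique)
qed

text \<open>Each factor x_i is exchanged for a derivative of \<phi>, which is again a test function;
  hence the induction over M for arbitrary \<phi>. The case M = 0 is the bound by the integral of
  the modulus.\<close>

lemma ft_test_function_decay_component:
  assumes "\<phi> \<in> test_functions"
  shows "\<exists>C. \<forall>x. \<bar>x $ i\<bar> ^ M * cmod (ft (\<lambda>y. complex_of_real (\<phi> y)) x) \<le> C"
  using assms
proof (induction M arbitrary: \<phi>)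
  case 0
  show ?case using norm_ft_le[of "\<lambda>y. complex_of_real (\<phi> y)"] by auto
next
  case (Suc M)
  obtain C where C: "\<And>x. \<bar>x $ i\<bar> ^ M * cmod (ft (\<lambda>y. complex_of_real (partial_deriv i \<phi> y)) x) \<le> C"
    using Suc.IH[OF partial_deriv_test_function[OF Suc.prems]] by blast
  have "\<bar>x $ i\<bar> ^ Suc M * cmod (ft (\<lambda>y. complex_of_real (\<phi> y)) x) \<le> C" for x
    using C[of x] by (simp add: ft_partial_deriv[OF Suc.prems] norm_mult mult_ac)
  then show ?case by blast
qed

text \<open>\<open>norm x\<close> is at most CARD('n) times the largest coordinate. Which coordinate
  that is depends on x, and summing the constants over all coordinates removes this
  dependence.\<close>

lemma ft_test_function_decay:
  fixes \<phi> :: "real ^ 'n::finite \<Rightarrow> real"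
  assumes "\<phi> \<in> test_functions"
  shows "\<exists>C. \<forall>x. norm x ^ M * cmod (ft (\<lambda>y. complex_of_real (\<phi> y)) x) \<le> C"
proof -
  let ?F = "ft (\<lambda>y. complex_of_real (\<phi> y))"
  obtain C where C: "\<And>i x. \<bar>x $ i\<bar> ^ M * cmod (?F x) \<le> C i"
    using ft_test_function_decay_component[OF assms, of _ M] by metis
  have C0: "C i \<ge> 0" for i by (rule order_trans[OF _ C[of 0 i]]) simp
  have "norm x ^ M * cmod (?F x) \<le> real CARD('n) ^ M * (\<Sum>i\<in>UNIV. C i)" for x
  proof -
    obtain i where i: "\<And>j. \<bar>x $ j\<bar> \<le> \<bar>x $ i\<bar>"
    proof -
      have "Max (range (\<lambda>j. \<bar>x $ j\<bar>)) \<in> range (\<lambda>j. \<bar>x $ j\<bar>)" by (intro Max_in) auto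
      then obtain i where "Max (range (\<lambda>j. \<bar>x $ j\<bar>)) = \<bar>x $ i\<bar>" by blast
      moreover have "\<bar>x $ j\<bar> \<le> Max (range (\<lambda>j. \<bar>x $ j\<bar>))" for j by (intro Max_ge) auto
      ultimately show ?thesis using that by metis
    qed
    have "norm x \<le> (\<Sum>j\<in>UNIV. \<bar>x $ j\<bar>)" by (rule norm_le_l1_cart)
    also have "\<dots> \<le> real CARD('n) * \<bar>x $ i\<bar>" using sum_bounded_above[of UNIV "\<lambda>j. \<bar>x $ j\<bar>" "\<bar>x $ i\<bar>"] i by simp
    finally have "norm x ^ M \<le> (real CARD('n) * \<bar>x $ i\<bar>) ^ M" by (intro power_mono) auto
    then have "norm x ^ M * cmod (?F x) \<le> (real CARD('n) * \<bar>x $ i\<bar>) ^ M * cmod (?F x)" by (intro mult_right_mono) auto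
    also have "\<dots> = real CARD('n) ^ M * (\<bar>x $ i\<bar> ^ M * cmod (?F x))" by (simp add: power_mult_distrib)
    also have "\<dots> \<le> real CARD('n) ^ M * C i" by (intro mult_left_mono C) auto
    also have "C i \<le> (\<Sum>i\<in>UNIV. C i)" using C0 by (intro member_le_sum) auto
    finally show ?thesis by (simp add: mult_left_mono)
  qed
  then show ?thesis by blast
qed

text \<open>The integral is split at norm h = 1 / norm \<xi>. Inside, Cauchy-Schwarz leaves the
  power 2 m - n - 2 s of norm h, integrable at 0 because m > s. Outside, the minimum is at most 2
  and the tail converges because s > 0. Both parts scale like
  \<open>norm \<xi> powr (2 * s)\<close>, the square of the symbol of the fractional
  Laplacian.\<close>

lemma truncated_multiplier_integral:
  fixes s :: real and m :: nat
  assumes s: "0 < s" "s < real m"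
  shows "\<exists>C>0. \<forall>\<xi>::'a::euclidean_space.
    (\<integral>\<^sup>+h. ennreal ((min 2 \<bar>\<xi> \<bullet> h\<bar>) ^ (2 * m) * norm h powr (- (real DIM('a) + 2 * s))) \<partial>lborel)
      \<le> ennreal (C * norm \<xi> powr (2 * s))"
proof -
  let ?n = "real DIM('a)"
  define b where "b = 2 * real m - ?n - 2 * s"
  obtain C1 where C1: "C1 > 0" "\<And>\<rho>. \<rho> > 0 \<Longrightarrow>
     (\<integral>\<^sup>+x. ennreal (norm x powr b) * indicator {x. norm x < \<rho>} x \<partial>(lborel :: 'a measure))
    \<le> ennreal (C1 * \<rho> powr (2 * real m - 2 * s))"
    using nn_integral_norm_powr_ball[where 'a='a, of b] s by (auto simp: b_def algebra_simps)
  obtain C2 where C2: "C2 > 0" "\<And>\<rho>. \<rho> > 0 \<Longrightarrow>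
     (\<integral>\<^sup>+x. ennreal (norm x powr (- (?n + 2 * s))) * indicator {x. \<rho> \<le> norm x} x \<partial>(lborel :: 'a measure))
    \<le> ennreal (C2 * \<rho> powr (- (2 * s)))"
    using nn_integral_norm_powr_outside_ball[where 'a='a, of "- (?n + 2 * s)"] s by auto
  have "(\<integral>\<^sup>+h. ennreal ((min 2 \<bar>\<xi> \<bullet> h\<bar>) ^ (2 * m) * norm h powr (- (?n + 2 * s))) \<partial>lborel)
      \<le> ennreal ((C1 + 2 ^ (2 * m) * C2) * norm \<xi> powr (2 * s))" (is "?I \<le> _") for \<xi> :: 'a
  proof (cases "\<xi> = 0")
    case True
    then show ?thesis using s by (simp add: power_0_left)
  next
    case False
    define \<rho> where "\<rho> = 1 / norm \<xi>"
    have \<rho>: "\<rho> > 0" using False by (simp add: \<rho>_def)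
    have "?I \<le> (\<integral>\<^sup>+h. ennreal (norm \<xi> ^ (2 * m)) * (ennreal (norm h powr b) * indicator {h. norm h < \<rho>} h)
       + ennreal (2 ^ (2 * m)) * (ennreal (norm h powr (- (?n + 2 * s))) * indicator {h. \<rho> \<le> norm h} h) \<partial>(lborel :: 'a measure))"
    proof (intro nn_integral_mono)
      fix h :: 'a
      show "ennreal ((min 2 \<bar>\<xi> \<bullet> h\<bar>) ^ (2 * m) * norm h powr (- (?n + 2 * s)))
        \<le> ennreal (norm \<xi> ^ (2 * m)) * (ennreal (norm h powr b) * indicator {h. norm h < \<rho>} h)
       + ennreal (2 ^ (2 * m)) * (ennreal (norm h powr (- (?n + 2 * s))) * indicator {h. \<rho> \<le> norm h} h)"
      proof (cases "norm h < \<rho>")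
        case True
        show ?thesis
        proof (cases "h = 0")
          case False
          have "min 2 \<bar>\<xi> \<bullet> h\<bar> \<le> norm \<xi> * norm h" using Cauchy_Schwarz_ineq2[of \<xi> h] by linarith
          then have "(min 2 \<bar>\<xi> \<bullet> h\<bar>) ^ (2 * m) \<le> (norm \<xi> * norm h) ^ (2 * m)" by (intro power_mono) auto
          also have "\<dots> = norm \<xi> ^ (2 * m) * norm h powr (2 * real m)"
            using False powr_realpow[of "norm h" "2 * m"] by (simp add: power_mult_distrib)
          finally have "(min 2 \<bar>\<xi> \<bullet> h\<bar>) ^ (2 * m) * norm h powr (- (?n + 2 * s))
              \<le> norm \<xi> ^ (2 * m) * norm h powr (2 * real m) * norm h powr (- (?n + 2 * s))"
            by (intro mult_right_mono) auto
          also have "\<dots> = norm \<xi> ^ (2 * m) * norm h powr b"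
            by (simp add: mult.assoc powr_add[symmetric] b_def algebra_simps)
          finally show ?thesis using True by (simp add: ennreal_mult[symmetric] ennreal_leI)
        qed simp
      next
        case nlt: False
        have "(min 2 \<bar>\<xi> \<bullet> h\<bar>) ^ (2 * m) \<le> 2 ^ (2 * m)" by (intro power_mono) auto
        then have "(min 2 \<bar>\<xi> \<bullet> h\<bar>) ^ (2 * m) * norm h powr (- (?n + 2 * s)) \<le> 2 ^ (2 * m) * norm h powr (- (?n + 2 * s))"
          by (intro mult_right_mono) auto
        then have "ennreal ((min 2 \<bar>\<xi> \<bullet> h\<bar>) ^ (2 * m) * norm h powr (- (?n + 2 * s)))
           \<le> ennreal (2 ^ (2 * m)) * ennreal (norm h powr (- (?n + 2 * s)))"
          by (subst ennreal_mult[symmetric]) (auto intro: ennreal_leI)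
        then show ?thesis using nlt by simp
      qed
    qed
    also have "\<dots> = ennreal (norm \<xi> ^ (2 * m)) * (\<integral>\<^sup>+h. ennreal (norm h powr b) * indicator {h. norm h < \<rho>} h \<partial>(lborel :: 'a measure))
       + ennreal (2 ^ (2 * m)) * (\<integral>\<^sup>+h. ennreal (norm h powr (- (?n + 2 * s))) * indicator {h. \<rho> \<le> norm h} h \<partial>(lborel :: 'a measure))"
      by (simp add: nn_integral_add nn_integral_cmult)
    also have "\<dots> \<le> ennreal (norm \<xi> ^ (2 * m)) * ennreal (C1 * \<rho> powr (2 * real m - 2 * s))
       + ennreal (2 ^ (2 * m)) * ennreal (C2 * \<rho> powr (- (2 * s)))"
      by (intro add_mono mult_left_mono C1 C2 \<rho>) auto
    also have "\<dots> = ennreal (norm \<xi> ^ (2 * m) * (C1 * \<rho> powr (2 * real m - 2 * s)) + 2 ^ (2 * m) * (C2 * \<rho> powr (- (2 * s))))"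
      using C1 C2 by (simp add: ennreal_mult[symmetric] ennreal_plus[symmetric] del: ennreal_plus)
    also have "norm \<xi> ^ (2 * m) * (C1 * \<rho> powr (2 * real m - 2 * s)) + 2 ^ (2 * m) * (C2 * \<rho> powr (- (2 * s)))
       = (C1 + 2 ^ (2 * m) * C2) * norm \<xi> powr (2 * s)"
    proof -
      have 1: "\<rho> powr a = norm \<xi> powr (- a)" for a using False by (simp add: \<rho>_def powr_divide powr_minus_divide)
      have 2: "norm \<xi> ^ (2 * m) = norm \<xi> powr (2 * real m)" using False powr_realpow[of "norm \<xi>" "2 * m"] by simp
      have 3: "norm \<xi> powr (2 * real m) * norm \<xi> powr (- (2 * real m - 2 * s)) = norm \<xi> powr (2 * s)"
        by (simp add: powr_add[symmetric])
      have "norm \<xi> powr (2 * real m) * (C1 * norm \<xi> powr (- (2 * real m - 2 * s))) = C1 * norm \<xi> powr (2 * s)"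
        using 3 by (simp only: mult.left_commute[of _ C1])
      then show ?thesis unfolding 1 2 by (simp add: distrib_right)
    qed
    finally show ?thesis .
  qed
  moreover have "C1 + 2 ^ (2 * m) * C2 > 0" using C1 C2 by (simp add: add_pos_pos)
  ultimately show ?thesis by blast
qed

lemma ft_continuous:
  assumes f: "integrable lborel f"
  shows "continuous_on UNIV (ft f)"
proof (rule continuous_at_imp_continuous_on, rule ballI)
  fix x
  have [measurable]: "f \<in> borel_measurable borel" using f by auto
  show "isCont (ft f) x"
    unfolding isCont_def tendsto_at_iff_sequentially comp_def
  proof (intro allI impI)
    fix X assume X: "X \<longlonglongrightarrow> x"
    show "(\<lambda>k. ft f (X k)) \<longlonglongrightarrow> ft f x" unfolding ft_def
    proof (rule integral_dominated_convergence)
      show "integrable lborel (\<lambda>y. norm (f y))" using f by simp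
      show "AE y in lborel. (\<lambda>k. f y * iexp (X k \<bullet> y)) \<longlonglongrightarrow> f y * iexp (x \<bullet> y)"
        by (intro AE_I2 tendsto_intros X)
    qed (auto simp: norm_mult)
  qed
qed

section \<open>The fractional Laplacian of a test function\<close>

definition ft_test :: "(real ^ 'n::finite \<Rightarrow> real) \<Rightarrow> real ^ 'n \<Rightarrow> complex" where
  "ft_test \<phi> = ft (\<lambda>y. complex_of_real (\<phi> y))"

text \<open>The integrand of \<open>frac_laplacian_half\<close> without its exponential. Continuity,
  boundedness and integrability, proved below, are the hypotheses of
  \<open>plancherel\<close>.\<close>

definition weighted_fourier :: "real \<Rightarrow> (real ^ 'n::finite \<Rightarrow> real) \<Rightarrow> real ^ 'n \<Rightarrow> complex" where
  "weighted_fourier s \<phi> \<xi> = complex_of_real (norm \<xi> powr s) * fourier \<phi> \<xi>"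

text \<open>\<phi> is real, so reversing the sign of the exponent conjugates the transform; moduli
  are unaffected.\<close>

lemma fourier_eq_cnj_ft:
  assumes \<phi>: "\<phi> \<in> test_functions"
  shows "fourier \<phi> \<xi> = cnj (ft_test \<phi> \<xi>)"
proof -
  note [measurable] = test_function_measurable[OF \<phi>]
  have "fourier \<phi> \<xi> = (LINT x|lborel. complex_of_real (\<phi> x) * exp (- \<i> * complex_of_real (x \<bullet> \<xi>)))"
    unfolding fourier_def by (intro integral_completion) measurable
  also have "\<dots> = (LINT x|lborel. cnj (complex_of_real (\<phi> x) * iexp (\<xi> \<bullet> x)))"
    by (intro Bochner_Integration.integral_cong refl) (simp add: exp_cnj inner_commute)
  also have "\<dots> = cnj (ft_test \<phi> \<xi>)"
    unfolding ft_test_def ft_def by (rule Bochner_Integration.integral_cnj)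
  finally show ?thesis .
qed

lemma fourier_diff:
  assumes \<phi>: "\<phi> \<in> test_functions" and \<psi>: "\<psi> \<in> test_functions"
  shows "fourier (\<lambda>x. \<phi> x - \<psi> x) \<xi> = fourier \<phi> \<xi> - fourier \<psi> \<xi>"
proof -
  have int: "integrable lebesgue (\<lambda>x. complex_of_real (f x) * exp (- \<i> * complex_of_real (x \<bullet> \<xi>)))" if "f \<in> test_functions" for f
  proof -
    note [measurable] = test_function_measurable[OF that]
    have "integrable lborel (\<lambda>x. complex_of_real (f x) * exp (- \<i> * complex_of_real (x \<bullet> \<xi>)))"
    proof (rule Bochner_Integration.integrable_bound)
      show "integrable lborel f" by (rule test_function_integrable[OF that])
      show "AE x in lborel. norm (complex_of_real (f x) * exp (- \<i> * complex_of_real (x \<bullet> \<xi>))) \<le> norm (f x)"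
        by (intro AE_I2) (simp add: norm_mult)
    qed simp
    then show ?thesis by (subst integrable_completion) measurable
  qed
  show ?thesis unfolding fourier_def
    by (subst Bochner_Integration.integral_diff[symmetric], rule int[OF \<phi>], rule int[OF \<psi>])
      (simp add: left_diff_distrib)
qed

lemma ft_test_continuous: "\<phi> \<in> test_functions \<Longrightarrow> continuous_on UNIV (ft_test \<phi>)"
  unfolding ft_test_def using test_function_integrable[of \<phi>] by (intro ft_continuous) simp

lemma ft_test_measurable: "\<phi> \<in> test_functions \<Longrightarrow> ft_test \<phi> \<in> borel_measurable borel"
  by (intro borel_measurable_continuous_onI ft_test_continuous)

lemma weighted_fourier_continuous:
  assumes \<phi>: "\<phi> \<in> test_functions" and s: "s > 0"
  shows "continuous_on UNIV (weighted_fourier s \<phi>)"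
proof -
  have "continuous_on UNIV (\<lambda>\<xi>. complex_of_real (norm \<xi> powr s) * cnj (ft_test \<phi> \<xi>))"
    using s by (intro continuous_intros ft_test_continuous[OF \<phi>] continuous_on_powr') auto
  then show ?thesis by (simp add: weighted_fourier_def[abs_def] fourier_eq_cnj_ft[OF \<phi>])
qed

lemma weighted_fourier_bounds:
  fixes \<phi> :: "real ^ 'n::finite \<Rightarrow> real"
  assumes \<phi>: "\<phi> \<in> test_functions" and s: "s > 0"
  obtains C where "C \<ge> 0" "\<And>\<xi>. cmod (weighted_fourier s \<phi> \<xi>) \<le> C"
    "\<And>\<xi>. norm \<xi> \<ge> 1 \<Longrightarrow> cmod (weighted_fourier s \<phi> \<xi>) \<le> C * norm \<xi> powr (- (real CARD('n) + 1))"
proof -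
  \<comment> \<open>Of the decay of order M, the power s compensates the weight, and at least
    CARD('n) + 1 is left, enough for integrability at infinity.\<close>
  define M where "M = nat \<lceil>s + real CARD('n) + 1\<rceil>"
  have M: "real M \<ge> s + real CARD('n) + 1" using s by (simp add: M_def)
  obtain C0 where C0: "\<And>x. norm x ^ 0 * cmod (ft_test \<phi> x) \<le> C0"
    using ft_test_function_decay[OF \<phi>, of 0] unfolding ft_test_def by blast
  obtain CM where CM: "\<And>x. norm x ^ M * cmod (ft_test \<phi> x) \<le> CM"
    using ft_test_function_decay[OF \<phi>, of M] unfolding ft_test_def by blast
  have nn: "C0 \<ge> 0" "CM \<ge> 0" using order_trans[OF _ C0[of 0]] order_trans[OF _ CM[of 0]] by auto
  have far: "cmod (weighted_fourier s \<phi> \<xi>) \<le> (C0 + CM) * norm \<xi> powr (- (real CARD('n) + 1))" if "norm \<xi> \<ge> 1" for \<xi>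
  proof -
    have "norm \<xi> powr s = norm \<xi> powr (s - real M) * norm \<xi> ^ M"
    proof -
      have "norm \<xi> ^ M = norm \<xi> powr real M" using that by (intro powr_realpow[symmetric]) auto
      then show ?thesis by (simp add: powr_add[symmetric])
    qed
    then have "cmod (weighted_fourier s \<phi> \<xi>) = norm \<xi> powr (s - real M) * (norm \<xi> ^ M * cmod (ft_test \<phi> \<xi>))"
      by (simp add: weighted_fourier_def fourier_eq_cnj_ft[OF \<phi>] norm_mult norm_power)
    also have "\<dots> \<le> norm \<xi> powr (- (real CARD('n) + 1)) * CM"
      using M that nn by (intro mult_mono CM powr_mono) auto
    also have "\<dots> \<le> (C0 + CM) * norm \<xi> powr (- (real CARD('n) + 1))"
      using nn by (simp add: mult.commute mult_right_mono)
    finally show ?thesis .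
  qed
  have "cmod (weighted_fourier s \<phi> \<xi>) \<le> C0 + CM" for \<xi>
  proof (cases "norm \<xi> \<ge> 1")
    case True
    have "norm \<xi> powr (- (real CARD('n) + 1)) \<le> norm \<xi> powr 0" using True by (intro powr_mono) auto
    also have "\<dots> = 1" using True by auto
    finally have "(C0 + CM) * norm \<xi> powr (- (real CARD('n) + 1)) \<le> (C0 + CM) * 1"
      using nn by (intro mult_left_mono) auto
    with far[OF True] show ?thesis by simp
  next
    case False
    have "norm \<xi> powr s \<le> 1" using False s by (intro powr_le1) auto
    then have "norm \<xi> powr s * cmod (ft_test \<phi> \<xi>) \<le> 1 * C0" using C0[of \<xi>] by (intro mult_mono) auto
    then show ?thesis using nn by (simp add: weighted_fourier_def fourier_eq_cnj_ft[OF \<phi>] norm_mult)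
  qed
  with far nn that[of "C0 + CM"] show ?thesis by simp
qed

lemma weighted_fourier_integrable:
  fixes \<phi> :: "real ^ 'n::finite \<Rightarrow> real"
  assumes \<phi>: "\<phi> \<in> test_functions" and s: "s > 0"
  shows "integrable lborel (weighted_fourier s \<phi>)"
proof (rule integrableI_bounded)
  let ?b = "- (real CARD('n) + 1)"
  show "weighted_fourier s \<phi> \<in> borel_measurable lborel"
    using borel_measurable_continuous_onI[OF weighted_fourier_continuous[OF \<phi> s]] by simp
  obtain C where C: "C \<ge> 0" "\<And>\<xi>. cmod (weighted_fourier s \<phi> \<xi>) \<le> C"
    "\<And>\<xi>. norm \<xi> \<ge> 1 \<Longrightarrow> cmod (weighted_fourier s \<phi> \<xi>) \<le> C * norm \<xi> powr ?b"
    using weighted_fourier_bounds[OF \<phi> s] by blast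
  obtain D where D: "(\<integral>\<^sup>+x. ennreal (norm x powr ?b) * indicator {x. 1 \<le> norm x} x \<partial>(lborel :: (real ^ 'n) measure)) \<le> ennreal (D * 1 powr (?b + real DIM(real ^ 'n)))"
  proof -
    have b: "?b + real DIM(real ^ 'n) < 0" by simp
    show ?thesis using nn_integral_norm_powr_outside_ball[OF b] that zero_less_one by blast
  qed
  have "(\<integral>\<^sup>+\<xi>. ennreal (norm (weighted_fourier s \<phi> \<xi>)) \<partial>lborel)
    \<le> (\<integral>\<^sup>+\<xi>. ennreal C * indicator (ball 0 1) \<xi> + ennreal C * (ennreal (norm \<xi> powr ?b) * indicator {x. 1 \<le> norm x} \<xi>) \<partial>(lborel :: (real ^ 'n) measure))"
    using C by (intro nn_integral_mono) (auto simp: indicator_def ennreal_mult[symmetric] intro!: ennreal_leI)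
  also have "\<dots> = ennreal C * emeasure lborel (ball (0 :: real ^ 'n) 1)
      + ennreal C * (\<integral>\<^sup>+x. ennreal (norm x powr ?b) * indicator {x. 1 \<le> norm x} x \<partial>(lborel :: (real ^ 'n) measure))"
    by (subst nn_integral_add) (auto simp: nn_integral_cmult nn_integral_cmult_indicator intro!: borel_measurable_times_ennreal borel_measurable_indicator)
  also have "\<dots> < \<infinity>"
    using emeasure_bounded_finite[of "ball (0 :: real ^ 'n) 1"] le_less_trans[OF D ennreal_less_top]
    by (auto simp: ennreal_mult_less_top)
  finally show "(\<integral>\<^sup>+\<xi>. ennreal (norm (weighted_fourier s \<phi> \<xi>)) \<partial>lborel) < \<infinity>" .
qed

lemma frac_laplacian_half_eq_ft:
  fixes \<phi> :: "real ^ 'n::finite \<Rightarrow> real"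
  assumes \<phi>: "\<phi> \<in> test_functions" and s: "s > 0"
  shows "frac_laplacian_half s \<phi> x = ft (weighted_fourier s \<phi>) x / complex_of_real ((2 * pi) ^ CARD('n))"
proof -
  have [measurable]: "weighted_fourier s \<phi> \<in> borel_measurable borel"
    by (intro borel_measurable_continuous_onI weighted_fourier_continuous[OF \<phi> s])
  have "(LINT \<xi>|lebesgue. weighted_fourier s \<phi> \<xi> * iexp (x \<bullet> \<xi>)) = ft (weighted_fourier s \<phi>) x"
    unfolding ft_def by (intro integral_completion) measurable
  then show ?thesis by (simp add: frac_laplacian_half_def weighted_fourier_def)
qed

lemma frac_laplacian_half_measurable:
  assumes "\<phi> \<in> test_functions" "s > 0"
  shows "frac_laplacian_half s \<phi> \<in> borel_measurable borel"
proof -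
  have [measurable]: "ft (weighted_fourier s \<phi>) \<in> borel_measurable borel"
    using borel_measurable_integrable[OF weighted_fourier_integrable[OF assms]] by (intro ft_measurable) simp
  show ?thesis unfolding frac_laplacian_half_eq_ft[OF assms, abs_def] by measurable
qed

text \<open>The Cauchy condition in \<open>D_approx\<close> takes the norm of a difference;
  linearity brings it back to the two test functions, where integrability is known.\<close>

lemma frac_laplacian_half_diff:
  fixes \<phi> :: "real ^ 'n::finite \<Rightarrow> real"
  assumes \<phi>: "\<phi> \<in> test_functions" and \<psi>: "\<psi> \<in> test_functions" and s: "s > 0"
  shows "frac_laplacian_half s (\<lambda>x. \<phi> x - \<psi> x) x = frac_laplacian_half s \<phi> x - frac_laplacian_half s \<psi> x"
proof -
  have int: "integrable lebesgue (\<lambda>\<xi>. weighted_fourier s f \<xi> * iexp (x \<bullet> \<xi>))" if "f \<in> test_functions" for f :: "real ^ 'n \<Rightarrow> real"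
  proof -
    have i: "integrable lborel (\<lambda>\<xi>. weighted_fourier s f \<xi> * iexp (x \<bullet> \<xi>))"
      by (intro integrable_iexp weighted_fourier_integrable that s)
    then show ?thesis by (subst integrable_completion) auto
  qed
  have "(LINT \<xi>|lebesgue. complex_of_real (norm \<xi> powr s) * fourier (\<lambda>x. \<phi> x - \<psi> x) \<xi> * iexp (x \<bullet> \<xi>))
    = (LINT \<xi>|lebesgue. weighted_fourier s \<phi> \<xi> * iexp (x \<bullet> \<xi>) - weighted_fourier s \<psi> \<xi> * iexp (x \<bullet> \<xi>))"
    by (simp add: fourier_diff[OF \<phi> \<psi>] weighted_fourier_def algebra_simps)
  also have "\<dots> = (LINT \<xi>|lebesgue. weighted_fourier s \<phi> \<xi> * iexp (x \<bullet> \<xi>)) - (LINT \<xi>|lebesgue. weighted_fourier s \<psi> \<xi> * iexp (x \<bullet> \<xi>))"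
    by (intro Bochner_Integration.integral_diff int \<phi> \<psi>)
  finally show ?thesis
    unfolding frac_laplacian_half_def by (simp add: weighted_fourier_def diff_divide_distrib)
qed

lemma ennreal_cancel_square: "c > 0 \<Longrightarrow> ennreal (1 / c\<^sup>2) * (ennreal c * X) = ennreal (1 / c) * X"
  by (simp add: mult.assoc[symmetric] ennreal_mult[symmetric] power2_eq_square)

text \<open>Plancherel contributes (2 pi)^n, while the inversion integral is divided by (2 pi)^n
  before squaring; one inverse power remains. Finiteness holds because a bounded integrable function
  is square integrable.\<close>

lemma frac_laplacian_half_energy:
  fixes \<phi> :: "real ^ 'n::finite \<Rightarrow> real"
  assumes \<phi>: "\<phi> \<in> test_functions" and s: "s > 0"
  shows "(\<integral>\<^sup>+x. ennreal ((cmod (frac_laplacian_half s \<phi> x))\<^sup>2) \<partial>lborel)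
    = ennreal (1 / (2 * pi) ^ CARD('n)) * (\<integral>\<^sup>+\<xi>. ennreal ((norm \<xi> powr s * cmod (ft_test \<phi> \<xi>))\<^sup>2) \<partial>lborel)"
    and "(\<integral>\<^sup>+x. ennreal ((cmod (frac_laplacian_half s \<phi> x))\<^sup>2) \<partial>lborel) < \<infinity>"
proof -
  let ?c = "(2 * pi) ^ CARD('n)"
  note int = weighted_fourier_integrable[OF \<phi> s]
  have m: "weighted_fourier s \<phi> \<in> borel_measurable borel"
    using borel_measurable_integrable[OF int] by simp
  note [measurable] = m ft_measurable[OF m]
  obtain C where C: "C \<ge> 0" "\<And>\<xi>. cmod (weighted_fourier s \<phi> \<xi>) \<le> C"
    "\<And>\<xi>. norm \<xi> \<ge> 1 \<Longrightarrow> cmod (weighted_fourier s \<phi> \<xi>) \<le> C * norm \<xi> powr (- (real CARD('n) + 1))"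
    using weighted_fourier_bounds[OF \<phi> s] by blast
  have "(\<integral>\<^sup>+x. ennreal ((cmod (frac_laplacian_half s \<phi> x))\<^sup>2) \<partial>lborel)
     = (\<integral>\<^sup>+x. ennreal (1 / ?c\<^sup>2) * ennreal ((cmod (ft (weighted_fourier s \<phi>) x))\<^sup>2) \<partial>lborel)"
  proof (intro nn_integral_cong)
    fix x
    have "cmod (complex_of_real ?c) = ?c" by (simp only: norm_of_real) simp
    then have "(cmod (frac_laplacian_half s \<phi> x))\<^sup>2 = 1 / ?c\<^sup>2 * (cmod (ft (weighted_fourier s \<phi>) x))\<^sup>2"
      by (simp only: frac_laplacian_half_eq_ft[OF \<phi> s] norm_divide power_divide) simp
    then show "ennreal ((cmod (frac_laplacian_half s \<phi> x))\<^sup>2) = ennreal (1 / ?c\<^sup>2) * ennreal ((cmod (ft (weighted_fourier s \<phi>) x))\<^sup>2)"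
      by (simp only:) (rule ennreal_mult; simp)
  qed
  also have "\<dots> = ennreal (1 / ?c\<^sup>2) * (ennreal ?c * (\<integral>\<^sup>+\<xi>. ennreal ((cmod (weighted_fourier s \<phi> \<xi>))\<^sup>2) \<partial>lborel))"
    using plancherel[OF int weighted_fourier_continuous[OF \<phi> s] C(2)] by (simp add: nn_integral_cmult)
  also have "\<dots> = ennreal (1 / ?c) * (\<integral>\<^sup>+\<xi>. ennreal ((cmod (weighted_fourier s \<phi> \<xi>))\<^sup>2) \<partial>lborel)"
    by (rule ennreal_cancel_square) simp
  finally have *: "(\<integral>\<^sup>+x. ennreal ((cmod (frac_laplacian_half s \<phi> x))\<^sup>2) \<partial>lborel)
     = ennreal (1 / ?c) * (\<integral>\<^sup>+\<xi>. ennreal ((cmod (weighted_fourier s \<phi> \<xi>))\<^sup>2) \<partial>lborel)" .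
  then show "(\<integral>\<^sup>+x. ennreal ((cmod (frac_laplacian_half s \<phi> x))\<^sup>2) \<partial>lborel)
    = ennreal (1 / ?c) * (\<integral>\<^sup>+\<xi>. ennreal ((norm \<xi> powr s * cmod (ft_test \<phi> \<xi>))\<^sup>2) \<partial>lborel)"
    by (simp add: weighted_fourier_def fourier_eq_cnj_ft[OF \<phi>] norm_mult)
  have "(\<integral>\<^sup>+\<xi>. ennreal ((cmod (weighted_fourier s \<phi> \<xi>))\<^sup>2) \<partial>lborel)
    \<le> (\<integral>\<^sup>+\<xi>. ennreal C * ennreal (cmod (weighted_fourier s \<phi> \<xi>)) \<partial>lborel)"
    using C(1,2) by (intro nn_integral_mono) (auto simp: ennreal_mult[symmetric] power2_eq_square intro!: ennreal_leI mult_right_mono)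
  also have "\<dots> < \<infinity>" using int by (simp add: nn_integral_cmult ennreal_mult_less_top integrable_iff_bounded)
  finally show "(\<integral>\<^sup>+x. ennreal ((cmod (frac_laplacian_half s \<phi> x))\<^sup>2) \<partial>lborel) < \<infinity>"
    unfolding * by (simp add: ennreal_mult_less_top)
qed

text \<open>The Bochner integral of a non-integrable function is 0 by default, so the norm agrees
  with the extended integral only once the latter is known to be finite.\<close>

lemma D_norm_test_eq_L2:
  assumes [measurable]: "frac_laplacian_half s f \<in> borel_measurable borel"
    and fin: "(\<integral>\<^sup>+x. ennreal ((cmod (frac_laplacian_half s f x))\<^sup>2) \<partial>lborel) < \<infinity>"
  shows "ennreal ((D_norm_test s f)\<^sup>2) = (\<integral>\<^sup>+x. ennreal ((cmod (frac_laplacian_half s f x))\<^sup>2) \<partial>lborel)"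
proof -
  have "(LINT x|lebesgue. (cmod (frac_laplacian_half s f x))\<^sup>2) = (LINT x|lborel. (cmod (frac_laplacian_half s f x))\<^sup>2)"
    by (intro integral_completion) measurable
  then have "(D_norm_test s f)\<^sup>2 = (LINT x|lborel. (cmod (frac_laplacian_half s f x))\<^sup>2)"
    by (simp add: D_norm_test_def)
  moreover have "integrable lborel (\<lambda>x. (cmod (frac_laplacian_half s f x))\<^sup>2)"
    using fin by (intro integrableI_bounded) auto
  ultimately show ?thesis by (simp add: nn_integral_eq_integral)
qed

lemma D_norm_test_nonneg: "D_norm_test s f \<ge> 0"
  by (simp add: D_norm_test_def)

section \<open>The square function of a test function\<close>

lemma fdiff_test_function:
  fixes \<phi> :: "real ^ 'n::finite \<Rightarrow> real" and m :: nat
  assumes \<phi>: "\<phi> \<in> test_functions"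
  defines "F h x \<equiv> complex_of_real (fdiff m h \<phi> x)"
  shows "integrable lborel (F h)" and "continuous_on UNIV (F h)" and "\<exists>B. \<forall>x. cmod (F h x) \<le> B"
    and "ft (F h) \<xi> = (1 - iexp (- (\<xi> \<bullet> h))) ^ m * ft_test \<phi> \<xi>"
proof -
  have F: "F h x = (\<Sum>k\<le>m. complex_of_real ((-1) ^ k * real (m choose k)) * complex_of_real (\<phi> (x + real k *\<^sub>R h)))" for x
    by (simp add: F_def fdiff_def)
  have int: "integrable lborel (\<lambda>x. complex_of_real ((-1) ^ k * real (m choose k)) * complex_of_real (\<phi> (x + real k *\<^sub>R h)))" for k
    using test_function_translate_integrable[OF \<phi>] by (rule integrable_mult_right)
  show "integrable lborel (F h)"
    unfolding F[abs_def] by (intro Bochner_Integration.integrable_sum int)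
  have "continuous_on UNIV (\<lambda>x. \<phi> (x + real k *\<^sub>R h))" for k
    by (rule continuous_on_compose2[OF test_function_continuous[OF \<phi>, of UNIV]]) (auto intro!: continuous_intros)
  then show "continuous_on UNIV (F h)"
    unfolding F[abs_def] by (intro continuous_intros) auto
  obtain B where B: "\<And>x. \<bar>\<phi> x\<bar> \<le> B" using test_function_bounded[OF \<phi>] by blast
  have "cmod (F h x) \<le> (\<Sum>k\<le>m. real (m choose k) * B)" for x
    unfolding F
    by (intro order_trans[OF norm_sum] sum_mono) (simp add: norm_mult norm_power mult_left_mono B)
  then show "\<exists>B. \<forall>x. cmod (F h x) \<le> B" by blast
  let ?z = "iexp (- (\<xi> \<bullet> h))"
  have "ft (F h) \<xi> = (LINT y|lborel. (\<Sum>k\<le>m. complex_of_real ((-1) ^ k * real (m choose k)) * complex_of_real (\<phi> (y + real k *\<^sub>R h)) * iexp (\<xi> \<bullet> y)))"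
    unfolding ft_def F by (simp only: sum_distrib_right)
  also have "\<dots> = (\<Sum>k\<le>m. LINT y|lborel. complex_of_real ((-1) ^ k * real (m choose k)) * complex_of_real (\<phi> (y + real k *\<^sub>R h)) * iexp (\<xi> \<bullet> y))"
    by (intro Bochner_Integration.integral_sum integrable_iexp int)
  also have "\<dots> = (\<Sum>k\<le>m. complex_of_real ((-1) ^ k * real (m choose k)) * ft (\<lambda>y. complex_of_real (\<phi> (y + real k *\<^sub>R h))) \<xi>)"
    unfolding ft_def by (simp only: mult.assoc integral_mult_right_zero)
  also have "\<dots> = (\<Sum>k\<le>m. complex_of_real ((-1) ^ k * real (m choose k)) * (?z ^ k * ft_test \<phi> \<xi>))"
  proof (intro sum.cong refl arg_cong2[where f="(*)"])
    fix k
    have [measurable]: "\<phi> \<in> borel_measurable borel" by (rule test_function_measurable[OF \<phi>])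
    have "ft (\<lambda>y. complex_of_real (\<phi> (y + real k *\<^sub>R h))) \<xi> = iexp (- (\<xi> \<bullet> (real k *\<^sub>R h))) * ft_test \<phi> \<xi>"
      unfolding ft_test_def by (rule ft_translate[of "\<lambda>y. complex_of_real (\<phi> y)"]) measurable
    also have "iexp (- (\<xi> \<bullet> (real k *\<^sub>R h))) = ?z ^ k"
      by (simp add: exp_of_nat_mult[symmetric] mult_ac)
    finally show "ft (\<lambda>y. complex_of_real (\<phi> (y + real k *\<^sub>R h))) \<xi> = ?z ^ k * ft_test \<phi> \<xi>" .
  qed
  \<comment> \<open>Translation by k h multiplies the transform by \<open>?z ^ k\<close>, so the
    alternating sum is a binomial expansion.\<close>
  also have "\<dots> = (\<Sum>k\<le>m. of_nat (m choose k) * (- ?z) ^ k * 1 ^ (m - k)) * ft_test \<phi> \<xi>"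
    unfolding sum_distrib_right
    by (intro sum.cong refl) (subst power_minus, simp add: mult_ac)
  also have "\<dots> = (1 - ?z) ^ m * ft_test \<phi> \<xi>"
    by (simp only: binomial_ring[symmetric]) simp
  finally show "ft (F h) \<xi> = (1 - ?z) ^ m * ft_test \<phi> \<xi>" .
qed

lemma norm_one_minus_iexp_le: "cmod (1 - iexp t) \<le> min 2 \<bar>t\<bar>"
proof -
  have "cmod (1 - iexp t) \<le> 2" using norm_triangle_ineq4[of 1 "iexp t"] by simp
  moreover have "cmod (iexp t - 1) \<le> \<bar>t\<bar>" using iexp_approx1[of t 0] by simp
  ultimately show ?thesis by (simp add: norm_minus_commute)
qed

lemma fdiff_L2_le:
  fixes \<phi> :: "real ^ 'n::finite \<Rightarrow> real"
  assumes \<phi>: "\<phi> \<in> test_functions"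
  shows "(\<integral>\<^sup>+x. ennreal ((fdiff m h \<phi> x)\<^sup>2) \<partial>lborel)
    \<le> ennreal (1 / (2 * pi) ^ CARD('n)) *
      (\<integral>\<^sup>+\<xi>. ennreal ((min 2 \<bar>\<xi> \<bullet> h\<bar>) ^ (2 * m) * (cmod (ft_test \<phi> \<xi>))\<^sup>2) \<partial>lborel)"
proof -
  let ?c = "(2 * pi) ^ CARD('n)"
  obtain B where B: "\<And>x. cmod (complex_of_real (fdiff m h \<phi> x)) \<le> B" using fdiff_test_function(3)[OF \<phi>] by blast
  have "ennreal ?c * (\<integral>\<^sup>+x. ennreal ((fdiff m h \<phi> x)\<^sup>2) \<partial>lborel)
    = (\<integral>\<^sup>+\<xi>. ennreal ((cmod (ft (\<lambda>x. complex_of_real (fdiff m h \<phi> x)) \<xi>))\<^sup>2) \<partial>lborel)"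
    using plancherel[OF fdiff_test_function(1)[OF \<phi>, of m h] fdiff_test_function(2)[OF \<phi>, of m h] B] by simp
  also have "\<dots> \<le> (\<integral>\<^sup>+\<xi>. ennreal ((min 2 \<bar>\<xi> \<bullet> h\<bar>) ^ (2 * m) * (cmod (ft_test \<phi> \<xi>))\<^sup>2) \<partial>lborel)"
  proof (intro nn_integral_mono ennreal_leI)
    fix \<xi>
    have "cmod (1 - iexp (- (\<xi> \<bullet> h))) ^ (2 * m) \<le> (min 2 \<bar>\<xi> \<bullet> h\<bar>) ^ (2 * m)"
      using norm_one_minus_iexp_le[of "- (\<xi> \<bullet> h)"] by (intro power_mono) auto
    then show "(cmod (ft (\<lambda>x. complex_of_real (fdiff m h \<phi> x)) \<xi>))\<^sup>2 \<le> (min 2 \<bar>\<xi> \<bullet> h\<bar>) ^ (2 * m) * (cmod (ft_test \<phi> \<xi>))\<^sup>2"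
      unfolding fdiff_test_function(4)[OF \<phi>] norm_mult norm_power power_mult_distrib power_mult[symmetric]
      by (simp only: mult.commute[of m 2]) (intro mult_right_mono, auto)
  qed
  finally have "ennreal (1 / ?c) * (ennreal ?c * (\<integral>\<^sup>+x. ennreal ((fdiff m h \<phi> x)\<^sup>2) \<partial>lborel))
    \<le> ennreal (1 / ?c) * (\<integral>\<^sup>+\<xi>. ennreal ((min 2 \<bar>\<xi> \<bullet> h\<bar>) ^ (2 * m) * (cmod (ft_test \<phi> \<xi>))\<^sup>2) \<partial>lborel)"
    by (rule mult_left_mono) simp
  then show ?thesis by (simp add: mult.assoc[symmetric] ennreal_mult[symmetric])
qed

lemma diff_square_integral_swap:
  fixes u :: "'a::euclidean_space \<Rightarrow> real"
  assumes [measurable]: "u \<in> borel_measurable borel"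
  shows "(\<integral>\<^sup>+x. diff_square m \<sigma> u x \<partial>lborel)
    = (\<integral>\<^sup>+h. \<integral>\<^sup>+x. ennreal ((fdiff m h u x)\<^sup>2 * norm h powr (- \<sigma>)) \<partial>lborel \<partial>lborel)"
  unfolding diff_square_def by (intro lborel_pair.Fubini') measurable

lemma test_function_energy:
  fixes \<phi> :: "real ^ 'n::finite \<Rightarrow> real"
  assumes "\<phi> \<in> test_functions" "s > 0"
  shows "ennreal ((D_norm_test s \<phi>)\<^sup>2)
    = ennreal (1 / (2 * pi) ^ CARD('n)) * (\<integral>\<^sup>+\<xi>. ennreal ((norm \<xi> powr s * cmod (ft_test \<phi> \<xi>))\<^sup>2) \<partial>lborel)"
  by (simp only: D_norm_test_eq_L2[OF frac_laplacian_half_measurable[OF assms] frac_laplacian_half_energy(2)[OF assms]]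
      frac_laplacian_half_energy(1)[OF assms])

text \<open>For fixed h, Plancherel in x replaces the difference by its multiplier; exchanging h and
  \<xi> then leaves the integral of \<open>truncated_multiplier_integral\<close>, bounded by the
  squared symbol. The factor 1 / (2 pi)^n occurs in both energies, so the constant is the one from
  the multiplier.\<close>

lemma diff_square_test_function_energy:
  fixes s :: real and m :: nat
  assumes s: "0 < s" "s < real m"
  shows "\<exists>C>0. \<forall>\<phi>::real ^ 'n::finite \<Rightarrow> real. \<phi> \<in> test_functions \<longrightarrow>
    (\<integral>\<^sup>+x. diff_square m (real CARD('n) + 2 * s) \<phi> x \<partial>lborel) \<le> ennreal (C * (D_norm_test s \<phi>)\<^sup>2)"
proof -
  let ?\<sigma> = "real CARD('n) + 2 * s" and ?c = "1 / (2 * pi) ^ CARD('n)"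
  obtain C where C: "C > 0" "\<And>\<xi>::real ^ 'n.
    (\<integral>\<^sup>+h. ennreal ((min 2 \<bar>\<xi> \<bullet> h\<bar>) ^ (2 * m) * norm h powr (- ?\<sigma>)) \<partial>lborel)
      \<le> ennreal (C * norm \<xi> powr (2 * s))"
    using truncated_multiplier_integral[OF s, where 'a="real ^ 'n"] by auto
  have "(\<integral>\<^sup>+x. diff_square m ?\<sigma> \<phi> x \<partial>lborel) \<le> ennreal (C * (D_norm_test s \<phi>)\<^sup>2)"
    if \<phi>: "\<phi> \<in> test_functions" for \<phi> :: "real ^ 'n \<Rightarrow> real"
  proof -
    note [measurable] = test_function_measurable[OF \<phi>] ft_test_measurable[OF \<phi>]
    let ?g = "\<lambda>h \<xi>. ennreal ((cmod (ft_test \<phi> \<xi>))\<^sup>2) * ennreal ((min 2 \<bar>\<xi> \<bullet> h\<bar>) ^ (2 * m) * norm h powr (- ?\<sigma>))"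
    have "(\<integral>\<^sup>+x. diff_square m ?\<sigma> \<phi> x \<partial>lborel)
      \<le> (\<integral>\<^sup>+h. ennreal ?c * (\<integral>\<^sup>+\<xi>. ?g h \<xi> \<partial>lborel) \<partial>lborel)"
      unfolding diff_square_integral_swap[OF test_function_measurable[OF \<phi>]]
    proof (intro nn_integral_mono)
      fix h :: "real ^ 'n"
      have [measurable]: "(\<lambda>x. fdiff m h \<phi> x) \<in> borel_measurable borel" unfolding fdiff_def by measurable
      have "(\<integral>\<^sup>+x. ennreal ((fdiff m h \<phi> x)\<^sup>2 * norm h powr (- ?\<sigma>)) \<partial>lborel)
         = (\<integral>\<^sup>+x. ennreal ((fdiff m h \<phi> x)\<^sup>2) \<partial>lborel) * ennreal (norm h powr (- ?\<sigma>))"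
        by (simp add: ennreal_mult nn_integral_multc)
      also have "\<dots> \<le> ennreal ?c * (\<integral>\<^sup>+\<xi>. ennreal ((min 2 \<bar>\<xi> \<bullet> h\<bar>) ^ (2 * m) * (cmod (ft_test \<phi> \<xi>))\<^sup>2) \<partial>lborel) * ennreal (norm h powr (- ?\<sigma>))"
        by (intro mult_right_mono fdiff_L2_le[OF \<phi>]) auto
      also have "\<dots> = ennreal ?c * (\<integral>\<^sup>+\<xi>. ennreal ((min 2 \<bar>\<xi> \<bullet> h\<bar>) ^ (2 * m) * (cmod (ft_test \<phi> \<xi>))\<^sup>2) * ennreal (norm h powr (- ?\<sigma>)) \<partial>lborel)"
        by (simp only: mult.assoc) (subst nn_integral_multc, measurable)
      also have "(\<integral>\<^sup>+\<xi>. ennreal ((min 2 \<bar>\<xi> \<bullet> h\<bar>) ^ (2 * m) * (cmod (ft_test \<phi> \<xi>))\<^sup>2) * ennreal (norm h powr (- ?\<sigma>)) \<partial>lborel) = (\<integral>\<^sup>+\<xi>. ?g h \<xi> \<partial>lborel)"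
        by (intro nn_integral_cong) (simp add: ennreal_mult[symmetric] mult_ac)
      finally show "(\<integral>\<^sup>+x. ennreal ((fdiff m h \<phi> x)\<^sup>2 * norm h powr (- ?\<sigma>)) \<partial>lborel) \<le> ennreal ?c * (\<integral>\<^sup>+\<xi>. ?g h \<xi> \<partial>lborel)" .
    qed
    also have "\<dots> = ennreal ?c * (\<integral>\<^sup>+h. \<integral>\<^sup>+\<xi>. ?g h \<xi> \<partial>lborel \<partial>lborel)"
    proof (rule nn_integral_cmult)
      have "(\<lambda>(h, \<xi>). ?g h \<xi>) \<in> borel_measurable (borel \<Otimes>\<^sub>M lborel)" by measurable
      then show "(\<lambda>h. \<integral>\<^sup>+\<xi>. ?g h \<xi> \<partial>lborel) \<in> borel_measurable lborel"
        using sigma_finite_measure.borel_measurable_nn_integral[OF sigma_finite_lborel, of "\<lambda>h \<xi>. ?g h \<xi>" borel] by simp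
    qed
    also have "(\<integral>\<^sup>+h. \<integral>\<^sup>+\<xi>. ?g h \<xi> \<partial>lborel \<partial>lborel) = (\<integral>\<^sup>+\<xi>. \<integral>\<^sup>+h. ?g h \<xi> \<partial>lborel \<partial>lborel)"
      by (intro lborel_pair.Fubini') measurable
    also have "\<dots> \<le> (\<integral>\<^sup>+\<xi>. ennreal C * ennreal ((norm \<xi> powr s * cmod (ft_test \<phi> \<xi>))\<^sup>2) \<partial>lborel)"
    proof (intro nn_integral_mono)
      fix \<xi> :: "real ^ 'n"
      have "(\<integral>\<^sup>+h. ?g h \<xi> \<partial>lborel) = ennreal ((cmod (ft_test \<phi> \<xi>))\<^sup>2) * (\<integral>\<^sup>+h. ennreal ((min 2 \<bar>\<xi> \<bullet> h\<bar>) ^ (2 * m) * norm h powr (- ?\<sigma>)) \<partial>lborel)"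
        by (intro nn_integral_cmult) measurable
      also have "\<dots> \<le> ennreal ((cmod (ft_test \<phi> \<xi>))\<^sup>2) * ennreal (C * norm \<xi> powr (2 * s))"
        by (intro mult_left_mono C) auto
      also have "\<dots> = ennreal C * ennreal ((norm \<xi> powr s * cmod (ft_test \<phi> \<xi>))\<^sup>2)"
      proof -
        have "norm \<xi> powr (2 * s) = (norm \<xi> powr s)\<^sup>2"
          by (simp only: power2_eq_square powr_add[symmetric]) simp
        then show ?thesis using C(1) by (simp add: ennreal_mult[symmetric] power_mult_distrib mult_ac)
      qed
      finally show "(\<integral>\<^sup>+h. ?g h \<xi> \<partial>lborel) \<le> ennreal C * ennreal ((norm \<xi> powr s * cmod (ft_test \<phi> \<xi>))\<^sup>2)" .
    qed
    also have "\<dots> = ennreal C * (\<integral>\<^sup>+\<xi>. ennreal ((norm \<xi> powr s * cmod (ft_test \<phi> \<xi>))\<^sup>2) \<partial>lborel)"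
      by (intro nn_integral_cmult) measurable
    also have "ennreal ?c * (ennreal C * (\<integral>\<^sup>+\<xi>. ennreal ((norm \<xi> powr s * cmod (ft_test \<phi> \<xi>))\<^sup>2) \<partial>lborel))
      = ennreal C * ennreal ((D_norm_test s \<phi>)\<^sup>2)"
      unfolding test_function_energy[OF \<phi> s(1)] by (simp only: mult_ac)
    also have "\<dots> = ennreal (C * (D_norm_test s \<phi>)\<^sup>2)" using C by (simp add: ennreal_mult)
    finally show ?thesis by (simp add: mult_left_mono)
  qed
  then show ?thesis using C(1) by blast
qed

text \<open>Minkowski's inequality in L^2, obtained from the quadratic bound \<open>young\<close>
  with a free parameter t that is optimised after integration. The asymmetric form serves to compare
  the norms of two members of an approximating sequence.\<close>

lemma D_norm_test_triangle:
  fixes \<phi> \<psi> :: "real ^ 'n::finite \<Rightarrow> real"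
  assumes \<phi>: "\<phi> \<in> test_functions" and \<psi>: "\<psi> \<in> test_functions" and s: "s > 0"
  shows "D_norm_test s \<phi> \<le> D_norm_test s \<psi> + D_norm_test s (\<lambda>x. \<phi> x - \<psi> x)"
proof -
  let ?a = "frac_laplacian_half s \<phi>" and ?b = "frac_laplacian_half s \<psi>"
  let ?A = "D_norm_test s \<phi>" and ?B = "D_norm_test s \<psi>" and ?D = "D_norm_test s (\<lambda>x. \<phi> x - \<psi> x)"
  note [measurable] = frac_laplacian_half_measurable[OF \<phi> s] frac_laplacian_half_measurable[OF \<psi> s]
  have diff: "frac_laplacian_half s (\<lambda>x. \<phi> x - \<psi> x) = (\<lambda>x. ?a x - ?b x)"
    by (rule ext) (rule frac_laplacian_half_diff[OF \<phi> \<psi> s])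
  note A = D_norm_test_eq_L2[OF frac_laplacian_half_measurable[OF \<phi> s] frac_laplacian_half_energy(2)[OF \<phi> s]]
  note B = D_norm_test_eq_L2[OF frac_laplacian_half_measurable[OF \<psi> s] frac_laplacian_half_energy(2)[OF \<psi> s]]
  have young: "(p + q)\<^sup>2 \<le> (1 + t) * p\<^sup>2 + (1 + 1 / t) * q\<^sup>2" if "t > 0" for p q t :: real
  proof -
    have "0 \<le> (t * p - q)\<^sup>2 / t" using that by simp
    also have "\<dots> = t * p\<^sup>2 - 2 * p * q + q\<^sup>2 / t" using that by (simp add: power2_eq_square field_simps)
    finally show ?thesis by (simp add: power2_eq_square algebra_simps)
  qed
  have step: "(\<integral>\<^sup>+x. ennreal ((cmod (f x + g x))\<^sup>2) \<partial>lborel)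
      \<le> ennreal (1 + t) * (\<integral>\<^sup>+x. ennreal ((cmod (f x))\<^sup>2) \<partial>lborel) + ennreal (1 + 1 / t) * (\<integral>\<^sup>+x. ennreal ((cmod (g x))\<^sup>2) \<partial>lborel)"
    if [measurable]: "f \<in> borel_measurable borel" "g \<in> borel_measurable borel" and t: "t > 0" for f g :: "real ^ 'n \<Rightarrow> complex" and t
  proof -
    have "(\<integral>\<^sup>+x. ennreal ((cmod (f x + g x))\<^sup>2) \<partial>lborel)
      \<le> (\<integral>\<^sup>+x. ennreal (1 + t) * ennreal ((cmod (f x))\<^sup>2) + ennreal (1 + 1 / t) * ennreal ((cmod (g x))\<^sup>2) \<partial>lborel)"
    proof (intro nn_integral_mono)
      fix x
      have "(cmod (f x + g x))\<^sup>2 \<le> (cmod (f x) + cmod (g x))\<^sup>2" by (intro power_mono norm_triangle_ineq) auto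
      also have "\<dots> \<le> (1 + t) * (cmod (f x))\<^sup>2 + (1 + 1 / t) * (cmod (g x))\<^sup>2" by (rule young[OF t])
      finally have "ennreal ((cmod (f x + g x))\<^sup>2) \<le> ennreal ((1 + t) * (cmod (f x))\<^sup>2 + (1 + 1 / t) * (cmod (g x))\<^sup>2)"
        by (rule ennreal_leI)
      also have "\<dots> = ennreal (1 + t) * ennreal ((cmod (f x))\<^sup>2) + ennreal (1 + 1 / t) * ennreal ((cmod (g x))\<^sup>2)"
        using t by (simp add: ennreal_plus ennreal_mult del: ennreal_1)
      finally show "ennreal ((cmod (f x + g x))\<^sup>2) \<le> \<dots>" .
    qed
    then show ?thesis by (simp add: nn_integral_add nn_integral_cmult)
  qed
  \<comment> \<open>Finiteness of the energy of the difference comes from the two test functions,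
    through the quadratic bound with t = 1.\<close>
  have fin: "(\<integral>\<^sup>+x. ennreal ((cmod (?a x - ?b x))\<^sup>2) \<partial>lborel) < \<infinity>"
  proof -
    have "(\<integral>\<^sup>+x. ennreal ((cmod (?a x + - ?b x))\<^sup>2) \<partial>lborel)
      \<le> ennreal (1 + 1) * (\<integral>\<^sup>+x. ennreal ((cmod (?a x))\<^sup>2) \<partial>lborel) + ennreal (1 + 1 / 1) * (\<integral>\<^sup>+x. ennreal ((cmod (- ?b x))\<^sup>2) \<partial>lborel)"
      by (rule step) auto
    also have "\<dots> = ennreal (1 + 1) * ennreal (?A\<^sup>2) + ennreal (1 + 1 / 1) * ennreal (?B\<^sup>2)"
      by (simp only: A B norm_minus_cancel)
    also have "\<dots> < \<infinity>" by (simp add: ennreal_mult_less_top del: ennreal_plus)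
    finally show ?thesis by simp
  qed
  have D: "ennreal (?D\<^sup>2) = (\<integral>\<^sup>+x. ennreal ((cmod (?a x - ?b x))\<^sup>2) \<partial>lborel)"
    using D_norm_test_eq_L2[of s "\<lambda>x. \<phi> x - \<psi> x"] fin unfolding diff by simp
  have le: "?A \<le> (?B + e) + (?D + e)" if e: "e > 0" for e
  proof -
    have pos: "?B + e > 0" "?D + e > 0" using e D_norm_test_nonneg by (auto intro: add_nonneg_pos)
    \<comment> \<open>This ratio turns the quadratic bound into a perfect square; e > 0 keeps it
      defined and positive when one of the norms is 0.\<close>
    define t where "t = (?D + e) / (?B + e)"
    have t: "t > 0" using pos by (simp add: t_def)
    have "ennreal (?A\<^sup>2) \<le> ennreal (1 + t) * ennreal (?B\<^sup>2) + ennreal (1 + 1 / t) * ennreal (?D\<^sup>2)"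
      using step[of ?b "\<lambda>x. ?a x - ?b x" t] t unfolding A B D by simp
    also have "\<dots> = ennreal ((1 + t) * ?B\<^sup>2 + (1 + 1 / t) * ?D\<^sup>2)"
      using t by (simp add: ennreal_plus ennreal_mult del: ennreal_1)
    finally have "?A\<^sup>2 \<le> (1 + t) * ?B\<^sup>2 + (1 + 1 / t) * ?D\<^sup>2"
      using t by (subst (asm) ennreal_le_iff) auto
    also have "\<dots> \<le> (1 + t) * (?B + e)\<^sup>2 + (1 + 1 / t) * (?D + e)\<^sup>2"
      using t e by (intro add_mono mult_left_mono power_mono) (auto simp: D_norm_test_nonneg)
    also have "\<dots> = ((?B + e) + (?D + e))\<^sup>2"
    proof -
      define p q where "p = ?B + e" and "q = ?D + e"
      have "p > 0" "q > 0" "t = q / p" using pos by (simp_all add: p_def q_def t_def)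
      then have 1: "t * p\<^sup>2 = q * p" "1 / t * q\<^sup>2 = p * q"
        by (simp_all add: power2_eq_square)
      have "(1 + t) * p\<^sup>2 + (1 + 1 / t) * q\<^sup>2 = p\<^sup>2 + q * p + (q\<^sup>2 + p * q)"
        by (simp only: distrib_right 1 mult_1)
      also have "\<dots> = (p + q)\<^sup>2" by (simp add: power2_sum)
      finally show ?thesis unfolding p_def q_def .
    qed
    finally show ?thesis by (rule power2_le_imp_le) (use pos in linarith)
  qed
  show ?thesis
  proof (rule field_le_epsilon)
    fix e :: real assume "e > 0"
    then show "?A \<le> ?B + ?D + e" using le[of "e / 2"] by simp
  qed
qed

text \<open>The \<open>SOME\<close> in \<^const>\<open>D_norm\<close> is harmless once one admissible limit exists: whichever value it
  selects comes with its own approximating sequence, so uniqueness of the limit is never needed.\<close>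

lemma D_norm_attained:
  fixes u :: "real ^ 'n::finite \<Rightarrow> real"
  assumes u: "u \<in> D_space s" and s: "s > 0"
  obtains \<phi> where "D_approx s \<phi> u" "(\<lambda>k. D_norm_test s (\<phi> k)) \<longlonglongrightarrow> D_norm s u"
proof -
  obtain \<phi> where \<phi>: "D_approx s \<phi> u" using u by (auto simp: D_space_def)
  then have test: "\<phi> k \<in> test_functions" for k by (simp add: D_approx_def)
  have "Cauchy (\<lambda>k. D_norm_test s (\<phi> k))"
  proof (rule metric_CauchyI)
    fix e :: real assume "e > 0"
    then obtain K where K: "\<And>j k. j \<ge> K \<Longrightarrow> k \<ge> K \<Longrightarrow> D_norm_test s (\<lambda>x. \<phi> j x - \<phi> k x) < e"
      using \<phi> unfolding D_approx_def by meson
    show "\<exists>K. \<forall>j\<ge>K. \<forall>k\<ge>K. dist (D_norm_test s (\<phi> j)) (D_norm_test s (\<phi> k)) < e"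
    proof (intro exI allI impI)
      fix j k assume jk: "j \<ge> K" "k \<ge> K"
      \<comment> \<open>The two triangle inequalities use the Cauchy condition for (j, k) and for
        (k, j).\<close>
      show "dist (D_norm_test s (\<phi> j)) (D_norm_test s (\<phi> k)) < e"
        using D_norm_test_triangle[OF test test s, of j k] D_norm_test_triangle[OF test test s, of k j]
          K[OF jk] K[OF jk(2,1)] by (simp add: dist_real_def abs_less_iff)
    qed
  qed
  then obtain r where "(\<lambda>k. D_norm_test s (\<phi> k)) \<longlonglongrightarrow> r"
    using real_Cauchy_convergent by (auto simp: convergent_def)
  with \<phi> have "\<exists>r \<phi>. D_approx s \<phi> u \<and> (\<lambda>k. D_norm_test s (\<phi> k)) \<longlonglongrightarrow> r" by blast
  then have "\<exists>\<phi>. D_approx s \<phi> u \<and> (\<lambda>k. D_norm_test s (\<phi> k)) \<longlonglongrightarrow> D_norm s u"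
    unfolding D_norm_def by (rule someI_ex)
  then show ?thesis using that by blast
qed

section \<open>Passage to the limit\<close>

lemma AE_lborel_translate:
  fixes a :: "'a::euclidean_space"
  assumes "AE y in lborel. P y"
  shows "AE x in lborel. P (x + a)"
proof -
  obtain N where N: "{x \<in> space lborel. \<not> P x} \<subseteq> N" "emeasure lborel N = 0" "N \<in> sets lborel"
    using assms by (rule AE_E)
  have "AE y in lborel. y \<notin> N" using N(2,3) by (intro AE_not_in) auto
  then have "AE y in distr lborel borel ((+) a). y \<notin> N" by (simp only: lborel_distr_plus)
  then have "AE x in lborel. a + x \<notin> N" using N(3) by (subst (asm) AE_distr_iff) auto
  then show ?thesis by eventually_elim (use N(1) in \<open>auto simp: add.commute\<close>)
qed

text \<open>The L^1 statement is applied to the q-th powers of the differences, and the q-th root is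
  taken pointwise. The first K terms are dropped because their integrals may be infinite; the shift
  by K keeps the subsequence strictly increasing.\<close>

lemma powr_tendsto_0_AE_subseq:
  fixes f :: "nat \<Rightarrow> 'a \<Rightarrow> real" and g :: "'a \<Rightarrow> real"
  assumes [measurable]: "\<And>k. f k \<in> borel_measurable M" "g \<in> borel_measurable M" and q: "q > 0"
    and lim: "(\<lambda>k. \<integral>\<^sup>+x. ennreal (\<bar>f k x - g x\<bar> powr q) \<partial>M) \<longlonglongrightarrow> 0"
  obtains r :: "nat \<Rightarrow> nat" where "strict_mono r" "AE x in M. (\<lambda>k. f (r k) x) \<longlonglongrightarrow> g x"
proof -
  have "\<forall>\<^sub>F k in sequentially. (\<integral>\<^sup>+x. ennreal (\<bar>f k x - g x\<bar> powr q) \<partial>M) < 1"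
    using lim by (rule order_tendstoD) simp
  then obtain K where K: "\<And>k. k \<ge> K \<Longrightarrow> (\<integral>\<^sup>+x. ennreal (\<bar>f k x - g x\<bar> powr q) \<partial>M) < 1"
    by (auto simp: eventually_sequentially)
  define w where "w n x = \<bar>f (n + K) x - g x\<bar> powr q" for n x
  have [measurable]: "w n \<in> borel_measurable M" for n unfolding w_def by measurable
  have int: "integrable M (w n)" for n
    using order_less_trans[OF K[of "n + K"] ennreal_one_less_top] by (intro integrableI_bounded) (auto simp: w_def)
  have "(\<lambda>n. LINT x|M. norm (w n x)) \<longlonglongrightarrow> 0"
  proof -
    have "(\<lambda>n. enn2real (\<integral>\<^sup>+x. ennreal (\<bar>f (n + K) x - g x\<bar> powr q) \<partial>M)) \<longlonglongrightarrow> 0"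
      using LIMSEQ_ignore_initial_segment[OF lim, of K] by (intro tendsto_enn2real) auto
    moreover have "(LINT x|M. norm (w n x)) = enn2real (\<integral>\<^sup>+x. ennreal (\<bar>f (n + K) x - g x\<bar> powr q) \<partial>M)" for n
      by (subst integral_eq_nn_integral) (auto simp: w_def)
    ultimately show ?thesis by simp
  qed
  then obtain r :: "nat \<Rightarrow> nat" where r: "strict_mono r" "AE x in M. (\<lambda>n. w (r n) x) \<longlonglongrightarrow> 0"
    using tendsto_L1_AE_subseq[of M w] int by blast
  have "AE x in M. (\<lambda>k. f (r k + K) x) \<longlonglongrightarrow> g x"
    using r(2)
  proof eventually_elim
    case (elim x)
    have "(\<lambda>n. w (r n) x powr (1 / q)) \<longlonglongrightarrow> 0 powr (1 / q)"
      using elim q by (intro tendsto_powr' tendsto_const) (auto simp: w_def)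
    then have "(\<lambda>n. \<bar>f (r n + K) x - g x\<bar>) \<longlonglongrightarrow> 0" using q by (simp add: w_def powr_powr)
    then show ?case by (simp add: tendsto_rabs_zero_iff LIM_zero_iff)
  qed
  moreover have "strict_mono (\<lambda>k. r k + K)" using r(1) by (simp add: strict_mono_def)
  ultimately show ?thesis using that by blast
qed

lemma fatou_AE:
  fixes F :: "nat \<Rightarrow> 'a \<Rightarrow> ennreal"
  assumes "\<And>k. F k \<in> borel_measurable M" and "AE x in M. (\<lambda>k. F k x) \<longlonglongrightarrow> f x"
  shows "(\<integral>\<^sup>+x. f x \<partial>M) \<le> liminf (\<lambda>k. \<integral>\<^sup>+x. F k x \<partial>M)"
proof -
  have "(\<integral>\<^sup>+x. f x \<partial>M) = (\<integral>\<^sup>+x. liminf (\<lambda>k. F k x) \<partial>M)"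
    using assms(2) by (intro nn_integral_cong_AE) (auto simp: lim_imp_Liminf elim!: eventually_mono)
  also have "\<dots> \<le> liminf (\<lambda>k. \<integral>\<^sup>+x. F k x \<partial>M)" using assms(1) by (rule nn_integral_liminf)
  finally show ?thesis .
qed

lemma liminf_le_of_bound:
  assumes "\<And>k. I k \<le> ennreal (c k)" "c \<longlonglongrightarrow> c0"
  shows "liminf I \<le> ennreal c0"
proof -
  have "liminf I \<le> liminf (\<lambda>k. ennreal (c k))" using assms(1) by (intro Liminf_mono) auto
  also have "\<dots> = ennreal c0" using assms(2) by (intro lim_imp_Liminf tendsto_ennrealI) auto
  finally show ?thesis .
qed

text \<open>The order of integration is exchanged first: for fixed h, convergence at the finitely
  many points x + i h holds for almost every x by translation invariance of null sets. Fatou's lemma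
  is then used in x and once more in h.\<close>

lemma diff_square_lower_semicontinuous:
  fixes f :: "nat \<Rightarrow> 'a::euclidean_space \<Rightarrow> real"
  assumes [measurable]: "\<And>k. f k \<in> borel_measurable borel" "g \<in> borel_measurable borel"
    and lim: "AE x in lborel. (\<lambda>k. f k x) \<longlonglongrightarrow> g x"
  shows "(\<integral>\<^sup>+x. diff_square m \<sigma> g x \<partial>lborel) \<le> liminf (\<lambda>k. \<integral>\<^sup>+x. diff_square m \<sigma> (f k) x \<partial>lborel)"
proof -
  let ?F = "\<lambda>u h x. ennreal ((fdiff m h u x)\<^sup>2 * norm h powr (- \<sigma>))"
  have "(\<integral>\<^sup>+x. diff_square m \<sigma> g x \<partial>lborel) = (\<integral>\<^sup>+h. \<integral>\<^sup>+x. ?F g h x \<partial>lborel \<partial>lborel)"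
    by (rule diff_square_integral_swap) measurable
  also have "\<dots> \<le> (\<integral>\<^sup>+h. liminf (\<lambda>k. \<integral>\<^sup>+x. ?F (f k) h x \<partial>lborel) \<partial>lborel)"
  proof (intro nn_integral_mono fatou_AE)
    fix h :: 'a
    show "(\<lambda>x. ?F (f k) h x) \<in> borel_measurable lborel" for k unfolding fdiff_def by measurable
    have "AE x in lborel. \<forall>i\<le>m. (\<lambda>k. f k (x + real i *\<^sub>R h)) \<longlonglongrightarrow> g (x + real i *\<^sub>R h)"
      using AE_lborel_translate[OF lim] by (simp add: AE_all_countable)
    then show "AE x in lborel. (\<lambda>k. ?F (f k) h x) \<longlonglongrightarrow> ?F g h x"
    proof eventually_elim
      case (elim x)
      then show ?case unfolding fdiff_def by (intro tendsto_ennrealI tendsto_intros) auto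
    qed
  qed
  also have "\<dots> \<le> liminf (\<lambda>k. \<integral>\<^sup>+h. \<integral>\<^sup>+x. ?F (f k) h x \<partial>lborel \<partial>lborel)"
  proof (rule nn_integral_liminf)
    fix k
    have "(\<lambda>(h, x). ?F (f k) h x) \<in> borel_measurable (borel \<Otimes>\<^sub>M lborel)"
      unfolding fdiff_def by measurable
    then show "(\<lambda>h. \<integral>\<^sup>+x. ?F (f k) h x \<partial>lborel) \<in> borel_measurable lborel"
      using sigma_finite_measure.borel_measurable_nn_integral[OF sigma_finite_lborel, of "\<lambda>h x. ?F (f k) h x" borel] by simp
  qed
  also have "(\<lambda>k. \<integral>\<^sup>+h. \<integral>\<^sup>+x. ?F (f k) h x \<partial>lborel \<partial>lborel) = (\<lambda>k. \<integral>\<^sup>+x. diff_square m \<sigma> (f k) x \<partial>lborel)"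
    by (intro ext diff_square_integral_swap[symmetric]) measurable
  finally show ?thesis .
qed

section \<open>The two integral bounds for limits of test functions\<close>

lemma test_function_hardy_finite:
  fixes \<phi> :: "real ^ 'n::finite \<Rightarrow> real"
  assumes \<phi>: "\<phi> \<in> test_functions" and s: "2 * s < real CARD('n)"
  shows "(\<integral>\<^sup>+x. ennreal ((\<phi> x)\<^sup>2 * norm x powr (- (2 * s))) \<partial>lborel) < \<infinity>"
proof -
  obtain R where R: "R > 0" "\<And>x. norm x \<ge> R \<Longrightarrow> \<phi> x = 0" using test_function_support[OF \<phi>] by blast
  obtain B where B: "B \<ge> 0" "\<And>x. \<bar>\<phi> x\<bar> \<le> B" using test_function_bounded[OF \<phi>] by blast
  \<comment> \<open>\<open>2 * s < n\<close> is local integrability of the Hardy weight at the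
    origin. The resulting finiteness is what the absorption argument requires.\<close>
  have b: "- (2 * s) + real DIM(real ^ 'n) > 0" using s by simp
  obtain C where C: "(\<integral>\<^sup>+x. ennreal (norm x powr (- (2 * s))) * indicator {x. norm x < R} x \<partial>(lborel :: (real ^ 'n) measure))
    \<le> ennreal (C * R powr (- (2 * s) + real DIM(real ^ 'n)))"
    using nn_integral_norm_powr_ball[OF b] R(1) by blast
  have "(\<integral>\<^sup>+x. ennreal ((\<phi> x)\<^sup>2 * norm x powr (- (2 * s))) \<partial>lborel)
    \<le> (\<integral>\<^sup>+x. ennreal (B\<^sup>2) * (ennreal (norm x powr (- (2 * s))) * indicator {x. norm x < R} x) \<partial>(lborel :: (real ^ 'n) measure))"
  proof (intro nn_integral_mono)
    fix x :: "real ^ 'n"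
    show "ennreal ((\<phi> x)\<^sup>2 * norm x powr (- (2 * s))) \<le> ennreal (B\<^sup>2) * (ennreal (norm x powr (- (2 * s))) * indicator {x. norm x < R} x)"
    proof (cases "norm x < R")
      case True
      have "(\<phi> x)\<^sup>2 \<le> B\<^sup>2" using B(2)[of x] by (metis abs_ge_zero power2_abs power_mono)
      then have "(\<phi> x)\<^sup>2 * norm x powr (- (2 * s)) \<le> B\<^sup>2 * norm x powr (- (2 * s))" by (intro mult_right_mono) auto
      then show ?thesis using True by (simp add: ennreal_mult[symmetric] ennreal_leI)
    qed (use R in auto)
  qed
  also have "\<dots> = ennreal (B\<^sup>2) * (\<integral>\<^sup>+x. ennreal (norm x powr (- (2 * s))) * indicator {x. norm x < R} x \<partial>(lborel :: (real ^ 'n) measure))"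
    by (intro nn_integral_cmult) measurable
  also have "\<dots> < \<infinity>" using le_less_trans[OF C ennreal_less_top] by (simp add: ennreal_mult_less_top)
  finally show ?thesis .
qed

text \<open>The Hardy integral of v is not known to be finite beforehand, so Hardy's inequality is
  taken for each \<open>\<phi> k\<close> and carried to v by Fatou's lemma. The constants are fixed
  before the sequence, and r is any limit of its norms, which matches the way \<open>D_norm\<close>
  is attained.\<close>

lemma D_limit_bounds:
  fixes s :: real and m :: nat
  assumes s: "0 < s" "2 * s < real CARD('n::finite)" "s < real m"
  shows "\<exists>C>0. \<exists>C'>0. \<forall>(\<phi> :: nat \<Rightarrow> real ^ 'n \<Rightarrow> real) v r.
    (\<forall>k. \<phi> k \<in> test_functions) \<longrightarrow> v \<in> borel_measurable borel \<longrightarrow>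
    (AE x in lborel. (\<lambda>k. \<phi> k x) \<longlonglongrightarrow> v x) \<longrightarrow> (\<lambda>k. D_norm_test s (\<phi> k)) \<longlonglongrightarrow> r \<longrightarrow>
    (\<integral>\<^sup>+x. diff_square m (real CARD('n) + 2 * s) v x \<partial>lborel) \<le> ennreal (C * r\<^sup>2) \<and>
    (\<integral>\<^sup>+x. ennreal ((v x)\<^sup>2 * norm x powr (- (2 * s))) \<partial>lborel) \<le> ennreal (C' * r\<^sup>2)"
proof -
  let ?\<sigma> = "real CARD('n) + 2 * s"
  obtain C where C: "C > 0" "\<And>\<phi>::real ^ 'n \<Rightarrow> real. \<phi> \<in> test_functions \<Longrightarrow>
    (\<integral>\<^sup>+x. diff_square m ?\<sigma> \<phi> x \<partial>lborel) \<le> ennreal (C * (D_norm_test s \<phi>)\<^sup>2)"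
    using diff_square_test_function_energy[OF s(1,3)] by blast
  obtain C2 where C2: "C2 > 0" "\<And>u::real ^ 'n \<Rightarrow> real. u \<in> borel_measurable borel \<Longrightarrow>
    (\<integral>\<^sup>+x. ennreal ((u x)\<^sup>2 * norm x powr (- (2 * s))) \<partial>lborel) < \<infinity> \<Longrightarrow>
    (\<integral>\<^sup>+x. ennreal ((u x)\<^sup>2 * norm x powr (- (2 * s))) \<partial>lborel)
      \<le> ennreal C2 * (\<integral>\<^sup>+x. diff_square m ?\<sigma> u x \<partial>lborel)"
    using hardy_absorbed[where 'a="real ^ 'n", of s m] s by auto
  have "(\<integral>\<^sup>+x. diff_square m ?\<sigma> v x \<partial>lborel) \<le> ennreal (C * r\<^sup>2) \<and>
    (\<integral>\<^sup>+x. ennreal ((v x)\<^sup>2 * norm x powr (- (2 * s))) \<partial>lborel) \<le> ennreal (C2 * C * r\<^sup>2)"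
    if \<phi>: "\<And>k. \<phi> k \<in> test_functions" and [measurable]: "v \<in> borel_measurable borel"
      and ae: "AE x in lborel. (\<lambda>k. \<phi> k x) \<longlonglongrightarrow> v x" and lim: "(\<lambda>k. D_norm_test s (\<phi> k)) \<longlonglongrightarrow> r"
    for \<phi> :: "nat \<Rightarrow> real ^ 'n \<Rightarrow> real" and v r
  proof
    note [measurable] = test_function_measurable[OF \<phi>]
    have "(\<integral>\<^sup>+x. diff_square m ?\<sigma> v x \<partial>lborel) \<le> liminf (\<lambda>k. \<integral>\<^sup>+x. diff_square m ?\<sigma> (\<phi> k) x \<partial>lborel)"
      by (rule diff_square_lower_semicontinuous[OF _ _ ae]) measurable
    also have "\<dots> \<le> ennreal (C * r\<^sup>2)"
      by (rule liminf_le_of_bound[OF C(2)[OF \<phi>]]) (intro tendsto_intros lim)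
    finally show "(\<integral>\<^sup>+x. diff_square m ?\<sigma> v x \<partial>lborel) \<le> ennreal (C * r\<^sup>2)" .
    have "(\<integral>\<^sup>+x. ennreal ((v x)\<^sup>2 * norm x powr (- (2 * s))) \<partial>lborel)
      \<le> liminf (\<lambda>k. \<integral>\<^sup>+x. ennreal ((\<phi> k x)\<^sup>2 * norm x powr (- (2 * s))) \<partial>lborel)"
    proof (rule fatou_AE)
      show "AE x in lborel. (\<lambda>k. ennreal ((\<phi> k x)\<^sup>2 * norm x powr (- (2 * s)))) \<longlonglongrightarrow> ennreal ((v x)\<^sup>2 * norm x powr (- (2 * s)))"
        using ae by eventually_elim (intro tendsto_ennrealI tendsto_mult tendsto_power tendsto_const)
    qed measurable
    also have "\<dots> \<le> ennreal (C2 * C * r\<^sup>2)"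
    proof (rule liminf_le_of_bound)
      show "(\<integral>\<^sup>+x. ennreal ((\<phi> k x)\<^sup>2 * norm x powr (- (2 * s))) \<partial>lborel) \<le> ennreal (C2 * C * (D_norm_test s (\<phi> k))\<^sup>2)" for k
      proof -
        have "(\<integral>\<^sup>+x. ennreal ((\<phi> k x)\<^sup>2 * norm x powr (- (2 * s))) \<partial>lborel)
          \<le> ennreal C2 * (\<integral>\<^sup>+x. diff_square m ?\<sigma> (\<phi> k) x \<partial>lborel)"
          by (intro C2(2) test_function_measurable[OF \<phi>] test_function_hardy_finite[OF \<phi> s(2)])
        also have "\<dots> \<le> ennreal C2 * ennreal (C * (D_norm_test s (\<phi> k))\<^sup>2)" by (intro mult_left_mono C(2)[OF \<phi>]) auto
        finally show ?thesis using C2(1) C(1) by (simp add: ennreal_mult[symmetric] mult.assoc)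
      qed
      show "(\<lambda>k. C2 * C * (D_norm_test s (\<phi> k))\<^sup>2) \<longlonglongrightarrow> C2 * C * r\<^sup>2" by (intro tendsto_intros lim)
    qed
    finally show "(\<integral>\<^sup>+x. ennreal ((v x)\<^sup>2 * norm x powr (- (2 * s))) \<partial>lborel) \<le> ennreal (C2 * C * r\<^sup>2)" .
  qed
  moreover have "C2 * C > 0" using C C2 by simp
  ultimately show ?thesis using C(1) by blast
qed

text \<open>The pointwise bound raised to the power 1 - l, times the Hardy density to the power l,
  gives the integrand on the left. Hoelder's inequality with the weights a, b and l then separates
  the Coulomb energy, the square function and the Hardy integral. The first is finite by hypothesis,
  the other two come from \<open>D_limit_bounds\<close>.\<close>

lemma borel_hardy_coulomb:
  fixes s \<theta> \<alpha> :: real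
  defines "n \<equiv> real CARD('n::finite)"
  assumes s: "0 < s" "2 * s < n" and \<theta>: "0 < \<theta>" "\<theta> < 2 * s" and \<alpha>: "0 < \<alpha>" "\<alpha> < n"
  defines "p \<equiv> coulomb_exponent n s \<alpha>"
  shows "\<exists>C>0. \<forall>(\<phi> :: nat \<Rightarrow> real ^ 'n \<Rightarrow> real) v r E.
    (\<forall>k. \<phi> k \<in> test_functions) \<longrightarrow> v \<in> borel_measurable borel \<longrightarrow>
    (AE x in lborel. (\<lambda>k. \<phi> k x) \<longlonglongrightarrow> v x) \<longrightarrow> (\<lambda>k. D_norm_test s (\<phi> k)) \<longlonglongrightarrow> r \<longrightarrow>
    E = (\<integral>\<^sup>+x. \<integral>\<^sup>+y. ennreal (\<bar>v x\<bar> powr p * \<bar>v y\<bar> powr p / norm (x - y) powr \<alpha>) \<partial>lborel \<partial>lborel) \<longrightarrow> E < \<infinity> \<longrightarrow>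
    (\<integral>\<^sup>+x. ennreal (\<bar>v x\<bar> powr hardy_sobolev_exponent n s \<theta> / norm x powr \<theta>) \<partial>lborel)
      \<le> ennreal (C * r powr (2 * (n + \<theta> - \<alpha>) / (n + 2 * s - \<alpha>)) * enn2real E powr ((2 * s - \<theta>) / (n + 2 * s - \<alpha>)))"
proof -
  \<comment> \<open>\<open>Suc\<close> makes s < m strict also when s is an integer.\<close>
  define m where "m = Suc (nat \<lceil>s\<rceil>)"
  have m: "s < real m" using s by (simp add: m_def) linarith
  define \<kappa> where "\<kappa> = 2 * s / (n + 2 * s - \<alpha>)"
  define l where "l = \<theta> / (2 * s)"
  define a b where "a = \<kappa> * (1 - l)" and "b = (1 - \<kappa>) * (1 - l)"
  let ?\<sigma> = "n + 2 * s"
  have \<kappa>: "0 < \<kappa>" "\<kappa> < 1" using s \<alpha> by (auto simp: \<kappa>_def)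
  have l: "0 < l" "l < 1" using s \<theta> by (auto simp: l_def)
  have ab: "a > 0" "b > 0" "a + b + l = 1" using \<kappa> l by (simp_all add: a_def b_def) (simp add: algebra_simps)
  have a_eq: "a = (2 * s - \<theta>) / (n + 2 * s - \<alpha>)"
  proof -
    have "1 - l = (2 * s - \<theta>) / (2 * s)" using s by (simp add: l_def field_simps)
    then show ?thesis using s by (simp add: a_def \<kappa>_def)
  qed
  \<comment> \<open>The bounds for the square function and the Hardy integral are both quadratic in
    r, so r receives the exponent \<open>2 * b + 2 * l\<close>.\<close>
  have bl: "2 * b + 2 * l = 2 * (n + \<theta> - \<alpha>) / (n + 2 * s - \<alpha>)"
  proof -
    have "n + 2 * s - \<alpha> \<noteq> 0" using s \<alpha> by simp
    moreover have "1 - c / d = (d - c) / d" if "d \<noteq> 0" for c d :: real using that by (simp add: diff_divide_distrib)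
    ultimately have "1 - a = ((n + 2 * s - \<alpha>) - (2 * s - \<theta>)) / (n + 2 * s - \<alpha>)" unfolding a_eq by blast
    also have "(n + 2 * s - \<alpha>) - (2 * s - \<theta>) = n + \<theta> - \<alpha>" by simp
    finally have 1: "1 - a = (n + \<theta> - \<alpha>) / (n + 2 * s - \<alpha>)" .
    have "b + l = 1 - a" using ab(3) by (simp only: eq_diff_eq ac_simps)
    then have "2 * b + 2 * l = 2 * (1 - a)" by (simp only: distrib_left[symmetric])
    then show ?thesis unfolding 1 by simp
  qed
  \<comment> \<open>The exponent is the mean of 2 n / (n - 2 s), from the pointwise bound, and 2,
    from the Hardy density, with weights 1 - l and l.\<close>
  have q_eq: "hardy_sobolev_exponent n s \<theta> = 2 * n / (n - 2 * s) * (1 - l) + 2 * l"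
  proof -
    have "n - 2 * s \<noteq> 0" using s by simp
    have "2 * n / (n - 2 * s) * (1 - l) + 2 * l = (2 * n - l * (4 * s)) / (n - 2 * s)"
    proof -
      have "2 * l = 2 * l * (n - 2 * s) / (n - 2 * s)" using \<open>n - 2 * s \<noteq> 0\<close> by simp
      then have "2 * n / (n - 2 * s) * (1 - l) + 2 * l = (2 * n * (1 - l) + 2 * l * (n - 2 * s)) / (n - 2 * s)"
        by (simp only: add_divide_distrib times_divide_eq_left)
      also have "2 * n * (1 - l) + 2 * l * (n - 2 * s) = 2 * n - l * (4 * s)" by (simp add: algebra_simps)
      finally show ?thesis .
    qed
    also have "l * (4 * s) = 2 * \<theta>" using s by (simp add: l_def)
    finally show ?thesis by (simp add: hardy_sobolev_exponent_def right_diff_distrib)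
  qed
  have n: "n = real DIM(real ^ 'n)" by (simp add: n_def)
  obtain C1 where C1: "C1 > 0" "\<And>(u::real ^ 'n \<Rightarrow> real) x. u \<in> borel_measurable borel \<Longrightarrow>
    riesz_potential \<alpha> p u x < \<infinity> \<Longrightarrow> diff_square m ?\<sigma> u x < \<infinity> \<Longrightarrow>
    \<bar>u x\<bar> powr (2 * n / (n - 2 * s))
      \<le> C1 * (\<bar>u x\<bar> powr p * enn2real (riesz_potential \<alpha> p u x)) powr \<kappa>
          * enn2real (diff_square m ?\<sigma> u x) powr (1 - \<kappa>)"
    using pointwise_interpolation[where 'a="real ^ 'n", of s \<alpha> p \<kappa> m] s \<alpha>
    unfolding n[symmetric] p_def coulomb_exponent_def \<kappa>_def by blast
  obtain C2 C3 where C23: "C2 > 0" "C3 > 0" "\<And>(\<phi> :: nat \<Rightarrow> real ^ 'n \<Rightarrow> real) v r.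
    \<lbrakk>\<forall>k. \<phi> k \<in> test_functions; v \<in> borel_measurable borel;
     AE x in lborel. (\<lambda>k. \<phi> k x) \<longlonglongrightarrow> v x; (\<lambda>k. D_norm_test s (\<phi> k)) \<longlonglongrightarrow> r\<rbrakk> \<Longrightarrow>
    (\<integral>\<^sup>+x. diff_square m ?\<sigma> v x \<partial>lborel) \<le> ennreal (C2 * r\<^sup>2) \<and>
    (\<integral>\<^sup>+x. ennreal ((v x)\<^sup>2 * norm x powr (- (2 * s))) \<partial>lborel) \<le> ennreal (C3 * r\<^sup>2)"
    using D_limit_bounds[where 'n='n, of s m] s m unfolding n_def by blast
  define C where "C = C1 powr (1 - l) * C2 powr b * C3 powr l"
  have "C > 0" using C1 C23 by (simp add: C_def)
  moreover have "(\<integral>\<^sup>+x. ennreal (\<bar>v x\<bar> powr hardy_sobolev_exponent n s \<theta> / norm x powr \<theta>) \<partial>lborel)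
      \<le> ennreal (C * r powr (2 * (n + \<theta> - \<alpha>) / (n + 2 * s - \<alpha>)) * enn2real E powr ((2 * s - \<theta>) / (n + 2 * s - \<alpha>)))"
    if \<phi>: "\<forall>k. \<phi> k \<in> test_functions" and v: "v \<in> borel_measurable borel"
      and ae: "AE x in lborel. (\<lambda>k. \<phi> k x) \<longlonglongrightarrow> v x" and lim: "(\<lambda>k. D_norm_test s (\<phi> k)) \<longlonglongrightarrow> r"
      and E: "E = (\<integral>\<^sup>+x. \<integral>\<^sup>+y. ennreal (\<bar>v x\<bar> powr p * \<bar>v y\<bar> powr p / norm (x - y) powr \<alpha>) \<partial>lborel \<partial>lborel)"
      and fin: "E < \<infinity>"
    for \<phi> :: "nat \<Rightarrow> real ^ 'n \<Rightarrow> real" and v r E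
  proof -
    note [measurable] = v
    have r: "r \<ge> 0" by (rule tendsto_lowerbound[OF lim]) (simp_all add: D_norm_test_nonneg)
    note G = conjunct1[OF C23(3)[OF \<phi> v ae lim]] and H = conjunct2[OF C23(3)[OF \<phi> v ae lim]]
    let ?V = "riesz_potential \<alpha> p v" and ?G = "diff_square m ?\<sigma> v"
    let ?A = "\<lambda>x. \<bar>v x\<bar> powr p * enn2real (?V x)" and ?B = "\<lambda>x. enn2real (?G x)"
      and ?H = "\<lambda>x. (v x)\<^sup>2 * norm x powr (- (2 * s))"
    have [measurable]: "?V \<in> borel_measurable borel" "?G \<in> borel_measurable borel" by measurable
    have E': "E = (\<integral>\<^sup>+x. ennreal (\<bar>v x\<bar> powr p) * ?V x \<partial>lborel)"
    proof -
      have "(\<integral>\<^sup>+y. ennreal (\<bar>v x\<bar> powr p * \<bar>v y\<bar> powr p / norm (x - y) powr \<alpha>) \<partial>lborel) = ennreal (\<bar>v x\<bar> powr p) * ?V x" for x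
        unfolding riesz_potential_def
        by (subst nn_integral_cmult[symmetric]) (simp_all add: ennreal_mult[symmetric])
      then show ?thesis unfolding E by simp
    qed
    have enn2real_le: "ennreal (enn2real z) \<le> z" for z by (cases z) auto
    have A: "(\<integral>\<^sup>+x. ennreal (?A x) \<partial>lborel) \<le> ennreal (enn2real E)"
    proof -
      have "(\<integral>\<^sup>+x. ennreal (?A x) \<partial>lborel) \<le> E"
        unfolding E' by (intro nn_integral_mono) (simp add: ennreal_mult mult_left_mono enn2real_le)
      then show ?thesis using fin by simp
    qed
    have B: "(\<integral>\<^sup>+x. ennreal (?B x) \<partial>lborel) \<le> ennreal (C2 * r\<^sup>2)"
      by (rule order_trans[OF nn_integral_mono G]) (simp add: enn2real_le)
    have fin_V: "AE x in lborel. ennreal (\<bar>v x\<bar> powr p) * ?V x \<noteq> \<infinity>"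
      using fin unfolding E' by (intro nn_integral_PInf_AE) auto
    have fin_G: "AE x in lborel. ?G x \<noteq> \<infinity>"
      using le_less_trans[OF G ennreal_less_top] by (intro nn_integral_PInf_AE) auto
    have "(\<integral>\<^sup>+x. ennreal (\<bar>v x\<bar> powr hardy_sobolev_exponent n s \<theta> / norm x powr \<theta>) \<partial>lborel)
      \<le> (\<integral>\<^sup>+x. ennreal (C1 powr (1 - l)) * ennreal (?A x powr a * ?B x powr b * ?H x powr l) \<partial>lborel)"
    proof (rule nn_integral_mono_AE)
      show "AE x in lborel. ennreal (\<bar>v x\<bar> powr hardy_sobolev_exponent n s \<theta> / norm x powr \<theta>)
        \<le> ennreal (C1 powr (1 - l)) * ennreal (?A x powr a * ?B x powr b * ?H x powr l)"
        using fin_V fin_G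
      proof eventually_elim
        case (elim x)
        show ?case
        proof (cases "v x = 0")
          case False
          \<comment> \<open>Finiteness of the product \<open>\<bar>v x\<bar> powr p * ?V x\<close>
            bounds the potential only where v does not vanish; elsewhere the left-hand side is
            0.\<close>
          have Vx: "?V x < \<infinity>" using elim(1) False by (auto simp: ennreal_mult_eq_top_iff less_top)
          have Gx: "?G x < \<infinity>" using elim(2) by (simp add: less_top)
          have "(\<bar>v x\<bar> powr (2 * n / (n - 2 * s))) powr (1 - l)
             \<le> (C1 * ?A x powr \<kappa> * ?B x powr (1 - \<kappa>)) powr (1 - l)"
            using C1(2)[OF v Vx Gx] l by (intro powr_mono2) auto
          also have "\<dots> = C1 powr (1 - l) * ?A x powr a * ?B x powr b"
            by (simp only: powr_mult[of "C1 * _"] powr_mult[of C1] powr_powr a_def b_def)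
          finally have "\<bar>v x\<bar> powr (2 * n / (n - 2 * s) * (1 - l)) * ?H x powr l
             \<le> C1 powr (1 - l) * ?A x powr a * ?B x powr b * ?H x powr l"
            by (simp only: powr_powr) (intro mult_right_mono, auto)
          moreover have "?H x powr l = \<bar>v x\<bar> powr (2 * l) * norm x powr (- \<theta>)"
          proof -
            have "(v x)\<^sup>2 = \<bar>v x\<bar> powr 2" using False by simp
            moreover have "- (2 * s) * l = - \<theta>" using s by (simp add: l_def)
            ultimately show ?thesis by (simp only: powr_mult powr_powr)
          qed
          ultimately have "\<bar>v x\<bar> powr hardy_sobolev_exponent n s \<theta> / norm x powr \<theta>
             \<le> C1 powr (1 - l) * (?A x powr a * ?B x powr b * ?H x powr l)"
            unfolding q_eq by (simp add: powr_add powr_minus_divide mult.assoc)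
          then have "ennreal (\<bar>v x\<bar> powr hardy_sobolev_exponent n s \<theta> / norm x powr \<theta>)
             \<le> ennreal (C1 powr (1 - l) * (?A x powr a * ?B x powr b * ?H x powr l))" by (rule ennreal_leI)
          also have "\<dots> = ennreal (C1 powr (1 - l)) * ennreal (?A x powr a * ?B x powr b * ?H x powr l)"
            by (rule ennreal_mult) auto
          finally show ?thesis .
        qed simp
      qed
    qed
    also have "\<dots> = ennreal (C1 powr (1 - l)) * (\<integral>\<^sup>+x. ennreal (?A x powr a * ?B x powr b * ?H x powr l) \<partial>lborel)"
      by (intro nn_integral_cmult) measurable
    also have "\<dots> \<le> ennreal (C1 powr (1 - l)) * ennreal (enn2real E powr a * (C2 * r\<^sup>2) powr b * (C3 * r\<^sup>2) powr l)"
      using C23 l ab A B H by (intro mult_left_mono Holder3_nn_integral) auto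
    also have "\<dots> = ennreal (C1 powr (1 - l) * (enn2real E powr a * (C2 * r\<^sup>2) powr b * (C3 * r\<^sup>2) powr l))"
      by (rule ennreal_mult[symmetric]) auto
    also have "C1 powr (1 - l) * (enn2real E powr a * (C2 * r\<^sup>2) powr b * (C3 * r\<^sup>2) powr l)
       = C * r powr (2 * b + 2 * l) * enn2real E powr a"
    proof -
      \<comment> \<open>\<open>r\<^sup>2\<close> equals \<open>r powr 2\<close> because r, as a
        limit of norms, is nonnegative.\<close>
      have 1: "(r\<^sup>2) powr t = r powr (2 * t)" for t
      proof -
        have "r\<^sup>2 = r powr 2" using r by simp
        then show ?thesis by (simp only: powr_powr)
      qed
      show ?thesis unfolding C_def powr_mult 1 powr_add by (simp only: mult_ac)
    qed
    finally show ?thesis unfolding a_eq bl .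
  qed
  ultimately show ?thesis by blast
qed

theorem lemma3p3:
  fixes N :: nat and s \<theta> \<alpha> :: real
  assumes "N = CARD('n::finite)"
    and "N \<ge> 3"
    and "0 < s" and "s < real N / 2"
    and "0 < \<theta>" and "\<theta> < 2 * s"
    and "0 < \<alpha>" and "\<alpha> < real N"
  shows "\<exists>C4>0. \<forall>u :: real ^ 'n \<Rightarrow> real.
    u \<in> coulomb_sobolev_space s \<alpha> (coulomb_exponent N s \<alpha>) \<longrightarrow>
      (\<integral>\<^sup>+x. ennreal (\<bar>u x\<bar> powr hardy_sobolev_exponent N s \<theta> / norm x powr \<theta>) \<partial>lebesgue)
        \<le> ennreal (C4 * D_norm s u powr (2 * (N + \<theta> - \<alpha>) / (N + 2 * s - \<alpha>))
            * enn2real (coulomb_energy \<alpha> (coulomb_exponent N s \<alpha>) u)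
                powr ((2 * s - \<theta>) / (N + 2 * s - \<alpha>)))"
proof -
  let ?p = "coulomb_exponent (real N) s \<alpha>" and ?q = "hardy_sobolev_exponent (real N) s \<theta>"
  obtain C where C: "C > 0" "\<And>(\<phi> :: nat \<Rightarrow> real ^ 'n \<Rightarrow> real) v r E.
    \<lbrakk>\<forall>k. \<phi> k \<in> test_functions; v \<in> borel_measurable borel;
     AE x in lborel. (\<lambda>k. \<phi> k x) \<longlonglongrightarrow> v x; (\<lambda>k. D_norm_test s (\<phi> k)) \<longlonglongrightarrow> r;
     E = (\<integral>\<^sup>+x. \<integral>\<^sup>+y. ennreal (\<bar>v x\<bar> powr ?p * \<bar>v y\<bar> powr ?p / norm (x - y) powr \<alpha>) \<partial>lborel \<partial>lborel); E < \<infinity>\<rbrakk> \<Longrightarrow>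
    (\<integral>\<^sup>+x. ennreal (\<bar>v x\<bar> powr ?q / norm x powr \<theta>) \<partial>lborel)
      \<le> ennreal (C * r powr (2 * (N + \<theta> - \<alpha>) / (N + 2 * s - \<alpha>)) * enn2real E powr ((2 * s - \<theta>) / (N + 2 * s - \<alpha>)))"
    using borel_hardy_coulomb[where 'n='n, of s \<theta> \<alpha>] assms by auto
  have "(\<integral>\<^sup>+x. ennreal (\<bar>u x\<bar> powr ?q / norm x powr \<theta>) \<partial>lebesgue)
        \<le> ennreal (C * D_norm s u powr (2 * (N + \<theta> - \<alpha>) / (N + 2 * s - \<alpha>))
            * enn2real (coulomb_energy \<alpha> ?p u) powr ((2 * s - \<theta>) / (N + 2 * s - \<alpha>)))"
    if u: "u \<in> coulomb_sobolev_space s \<alpha> ?p" for u :: "real ^ 'n \<Rightarrow> real"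
  proof -
    have uD: "u \<in> D_space s" and fin: "coulomb_energy \<alpha> ?p u < \<infinity>"
      using u by (auto simp: coulomb_sobolev_space_def)
    then have "u \<in> borel_measurable lebesgue" by (simp add: D_space_def)
    \<comment> \<open>v is a Borel representative of u. The approximation property, the Coulomb
      energy and the left-hand side depend only on the almost everywhere class, while the
      translations and the exchanges of integrals were carried out for Borel functions.\<close>
    then obtain v where v: "v \<in> borel_measurable borel" and uv: "AE x in lborel. u x = v x"
      by (auto dest: completion_ex_borel_measurable_real)
    obtain \<phi> where \<phi>: "D_approx s \<phi> u" "(\<lambda>k. D_norm_test s (\<phi> k)) \<longlonglongrightarrow> D_norm s u"
      using D_norm_attained[OF uD] assms by auto
    have test: "\<phi> k \<in> test_functions" for k using \<phi>(1) by (simp add: D_approx_def)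
    let ?t = "sobolev_exponent (real CARD('n)) s"
    have "(\<integral>\<^sup>+x. ennreal (\<bar>\<phi> k x - u x\<bar> powr ?t) \<partial>lebesgue) = (\<integral>\<^sup>+x. ennreal (\<bar>\<phi> k x - v x\<bar> powr ?t) \<partial>lborel)" for k
      unfolding nn_integral_completion using uv by (intro nn_integral_cong_AE) (auto elim!: eventually_mono)
    then have lim: "(\<lambda>k. \<integral>\<^sup>+x. ennreal (\<bar>\<phi> k x - v x\<bar> powr ?t) \<partial>lborel) \<longlonglongrightarrow> 0"
      using \<phi>(1) by (simp add: D_approx_def)
    have t: "?t > 0" using assms by (simp add: sobolev_exponent_def)
    obtain r where r: "strict_mono r" "AE x in lborel. (\<lambda>k. \<phi> (r k) x) \<longlonglongrightarrow> v x"
      using powr_tendsto_0_AE_subseq[of \<phi> lborel v ?t] test_function_measurable[OF test] v t lim by auto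
    have lim_r: "(\<lambda>k. D_norm_test s (\<phi> (r k))) \<longlonglongrightarrow> D_norm s u"
      using LIMSEQ_subseq_LIMSEQ[OF \<phi>(2) r(1)] by (simp add: comp_def)
    \<comment> \<open>The inner integral is changed for every x, afterwards the outer one for almost
      every x; null sets of the product space do not arise.\<close>
    have "(\<integral>\<^sup>+y. ennreal (\<bar>u x\<bar> powr ?p * \<bar>u y\<bar> powr ?p / norm (x - y) powr \<alpha>) \<partial>lborel)
       = (\<integral>\<^sup>+y. ennreal (\<bar>u x\<bar> powr ?p * \<bar>v y\<bar> powr ?p / norm (x - y) powr \<alpha>) \<partial>lborel)" for x
      using uv by (intro nn_integral_cong_AE) (auto elim!: eventually_mono)
    then have energy: "coulomb_energy \<alpha> ?p u
       = (\<integral>\<^sup>+x. \<integral>\<^sup>+y. ennreal (\<bar>v x\<bar> powr ?p * \<bar>v y\<bar> powr ?p / norm (x - y) powr \<alpha>) \<partial>lborel \<partial>lborel)"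
      unfolding coulomb_energy_def nn_integral_completion
      using uv by (intro nn_integral_cong_AE) (auto elim!: eventually_mono)
    have "(\<integral>\<^sup>+x. ennreal (\<bar>u x\<bar> powr ?q / norm x powr \<theta>) \<partial>lebesgue)
       = (\<integral>\<^sup>+x. ennreal (\<bar>v x\<bar> powr ?q / norm x powr \<theta>) \<partial>lborel)"
      unfolding nn_integral_completion using uv by (intro nn_integral_cong_AE) (auto elim!: eventually_mono)
    also have "\<dots> \<le> ennreal (C * D_norm s u powr (2 * (N + \<theta> - \<alpha>) / (N + 2 * s - \<alpha>))
            * enn2real (coulomb_energy \<alpha> ?p u) powr ((2 * s - \<theta>) / (N + 2 * s - \<alpha>)))"
      by (rule C(2)[OF _ v r(2) lim_r energy fin]) (simp add: test)
    finally show ?thesis .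
  qed
  with C(1) show ?thesis by blast
qed

end
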